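(* Let $K$ be a field, $E$ a directed graph and $L=L_K(E)$. The following are equivalent. (1) Every proper ideal of $L$ is a product of (finitely many) semiprime ideals. (2) For every ideal $I$ of $L$, $I/\mathrm{gr}(I)$ is finitely generated. (3) Given any hereditary saturated subset $H$ of $E^0$, there are only finitely many cycles $c$ in $E$ with the property that $\{c^0\}\cap H=\emptyset$ and $r(e)\in H$ for all exits $e$ of $c$.
   Context: Graphs: $E=(E^0,E^1,r,s)$ with $E^0\neq\emptyset$, $r,s:E^1\to E^0$, no cardinality restrictions. A path is a finite sequence $e_1\cdots e_n$ of edges with $r(e_i)=s(e_{i+1})$; $\{\mu^0\}$ is the set of vertices on $\mu$. A cycle is a path with $r(e_n)=s(e_1)$ and $s(e_i)\ne s(e_j)$ for $i\ne j$ (cycles are distinguished by their sets of edges); an exit of $e_1\cdots e_n$ is an edge $f\notin\{e_1,\dots,e_n\}$ with $s(f)=s(e_i)$ for some $i$. A vertex $v$ is regular if $s^{-1}(v)$ is finite nonempty, an infinite emitter if $s^{-1}(v)$ is infinite. $H\subseteq E^0$ is hereditary if $u\in H$ and a path from $u$ to $v$ imply $v\in H$; saturated if every regular $v$ with $r(s^{-1}(v))\subseteq H$ lies in $H$. The Leavitt path algebra $L_K(E)$ is generated by $\{v:v\in E^0\}\cup\{e,e^*:e\in E^1\}$ with relations $vw=\delta_{v,w}v$; $s(e)e=er(e)=e$; $r(e)e^*=e^*s(e)=e^*$; $e^*f=\delta_{e,f}r(e)$; $v=\sum_{e\in s^{-1}(v)}ee^*$ for regular $v$. For an ideal (two-sided)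 $I$, let $H=I\cap E^0$, $B_H$ the set of infinite emitters $w\notin H$ with $0<|s^{-1}(w)\cap r^{-1}(E^0\setminus H)|<\infty$, $v^H:=v-\sum_{s(e)=v,\,r(e)\notin H}ee^*$, $S=\{v\in B_H:v^H\in I\}$; the graded part $\mathrm{gr}(I)$ is the ideal generated by $H\cup\{v^H:v\in S\}$. A proper ideal $J$ is semiprime if $A^2\subseteq J$ for an ideal $A$ implies $A\subseteq J$; a product of semiprime ideals includes the case of a single semiprime ideal. *)

theory Defs
  imports Main
begin

text \<open>Leavitt path algebras of graphs with infinitely many vertices have no unit,
so we use a small record of non-unital rings instead of the unital HOL-Algebra rings.\<close>

record 'a nrng =
  rcarr :: "'a set"
  radd  :: "'a \<Rightarrow> 'a \<Rightarrow> 'a"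
  rmul  :: "'a \<Rightarrow> 'a \<Rightarrow> 'a"
  rzero :: "'a"
  rneg  :: "'a \<Rightarrow> 'a"

definition add_subgroup :: "'a nrng \<Rightarrow> 'a set \<Rightarrow> bool" where
  "add_subgroup R J \<longleftrightarrow> J \<subseteq> rcarr R \<and> rzero R \<in> J \<and>
     (\<forall>x\<in>J. \<forall>y\<in>J. radd R x y \<in> J) \<and> (\<forall>x\<in>J. rneg R x \<in> J)"

definition rideal :: "'a nrng \<Rightarrow> 'a set \<Rightarrow> bool" where
  "rideal R J \<longleftrightarrow> add_subgroup R J \<and>
     (\<forall>x\<in>J. \<forall>a\<in>rcarr R. rmul R a x \<in> J \<and> rmul R x a \<in> J)"

definition rgenideal :: "'a nrng \<Rightarrow> 'a set \<Rightarrow> 'a set" where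
  "rgenideal R X = \<Inter>{J. rideal R J \<and> X \<subseteq> J}"

definition ideal_prod :: "'a nrng \<Rightarrow> 'a set \<Rightarrow> 'a set \<Rightarrow> 'a set" where
  "ideal_prod R A B = \<Inter>{J. add_subgroup R J \<and> {rmul R a b | a b. a \<in> A \<and> b \<in> B} \<subseteq> J}"

fun ideal_prods :: "'a nrng \<Rightarrow> 'a set list \<Rightarrow> 'a set" where
  "ideal_prods R [] = rcarr R"
| "ideal_prods R [A] = A"
| "ideal_prods R (A # B # As) = ideal_prod R A (ideal_prods R (B # As))"

definition semiprime :: "'a nrng \<Rightarrow> 'a set \<Rightarrow> bool" where
  "semiprime R J \<longleftrightarrow> rideal R J \<and> J \<noteq> rcarr R \<and>
     (\<forall>A. rideal R A \<and> ideal_prod R A A \<subseteq> J \<longrightarrow> A \<subseteq> J)"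

definition rcoset :: "'a nrng \<Rightarrow> 'a set \<Rightarrow> 'a \<Rightarrow> 'a set" where
  "rcoset R J x = {y \<in> rcarr R. radd R y (rneg R x) \<in> J}"

definition rquot :: "'a nrng \<Rightarrow> 'a set \<Rightarrow> 'a set nrng" where
  "rquot R J = \<lparr> rcarr = rcoset R J ` rcarr R,
     radd = (\<lambda>X Y. rcoset R J (radd R (SOME x. x \<in> X) (SOME y. y \<in> Y))),
     rmul = (\<lambda>X Y. rcoset R J (rmul R (SOME x. x \<in> X) (SOME y. y \<in> Y))),
     rzero = rcoset R J (rzero R),
     rneg = (\<lambda>X. rcoset R J (rneg R (SOME x. x \<in> X))) \<rparr>"

definition is_path :: "'e set \<Rightarrow> ('e \<Rightarrow> 'v) \<Rightarrow> ('e \<Rightarrow> 'v) \<Rightarrow> 'e list \<Rightarrow> bool" where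
  "is_path E1 r s p \<longleftrightarrow> p \<noteq> [] \<and> set p \<subseteq> E1 \<and>
     (\<forall>i. Suc i < length p \<longrightarrow> r (p ! i) = s (p ! Suc i))"

definition is_cycle :: "'e set \<Rightarrow> ('e \<Rightarrow> 'v) \<Rightarrow> ('e \<Rightarrow> 'v) \<Rightarrow> 'e list \<Rightarrow> bool" where
  "is_cycle E1 r s c \<longleftrightarrow> is_path E1 r s c \<and> r (last c) = s (hd c) \<and> distinct (map s c)"

definition path_verts :: "('e \<Rightarrow> 'v) \<Rightarrow> ('e \<Rightarrow> 'v) \<Rightarrow> 'e list \<Rightarrow> 'v set" where
  "path_verts r s p = s ` set p \<union> r ` set p"

definition is_exit :: "'e set \<Rightarrow> ('e \<Rightarrow> 'v) \<Rightarrow> 'e list \<Rightarrow> 'e \<Rightarrow> bool" where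
  "is_exit E1 s c f \<longleftrightarrow> f \<in> E1 \<and> f \<notin> set c \<and> (\<exists>e\<in>set c. s f = s e)"

definition hereditary :: "'v set \<Rightarrow> 'e set \<Rightarrow> ('e \<Rightarrow> 'v) \<Rightarrow> ('e \<Rightarrow> 'v) \<Rightarrow> 'v set \<Rightarrow> bool" where
  "hereditary E0 E1 r s H \<longleftrightarrow> H \<subseteq> E0 \<and>
     (\<forall>p. is_path E1 r s p \<and> s (hd p) \<in> H \<longrightarrow> r (last p) \<in> H)"

definition regular_vertex :: "'v set \<Rightarrow> 'e set \<Rightarrow> ('e \<Rightarrow> 'v) \<Rightarrow> 'v \<Rightarrow> bool" where
  "regular_vertex E0 E1 s v \<longleftrightarrow> v \<in> E0 \<and> finite {e \<in> E1. s e = v} \<and> {e \<in> E1. s e = v} \<noteq> {}"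

definition infinite_emitter :: "'v set \<Rightarrow> 'e set \<Rightarrow> ('e \<Rightarrow> 'v) \<Rightarrow> 'v \<Rightarrow> bool" where
  "infinite_emitter E0 E1 s v \<longleftrightarrow> v \<in> E0 \<and> infinite {e \<in> E1. s e = v}"

definition saturated :: "'v set \<Rightarrow> 'e set \<Rightarrow> ('e \<Rightarrow> 'v) \<Rightarrow> ('e \<Rightarrow> 'v) \<Rightarrow> 'v set \<Rightarrow> bool" where
  "saturated E0 E1 r s H \<longleftrightarrow>
     (\<forall>v. regular_vertex E0 E1 s v \<and> r ` {e \<in> E1. s e = v} \<subseteq> H \<longrightarrow> v \<in> H)"

datatype ('v, 'e) gen = Vt 'v | Ed 'e | Gh 'e

definition gens :: "'v set \<Rightarrow> 'e set \<Rightarrow> ('v, 'e) gen set" where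
  "gens E0 E1 = Vt ` E0 \<union> Ed ` E1 \<union> Gh ` E1"

text \<open>The free non-unital K-algebra on the generators: finitely supported
  K-valued functions on nonempty words in the generators.\<close>
definition fa_carr :: "'v set \<Rightarrow> 'e set \<Rightarrow> (('v, 'e) gen list \<Rightarrow> 'k::field) set" where
  "fa_carr E0 E1 = {f. finite {w. f w \<noteq> 0} \<and> f [] = 0 \<and>
      (\<forall>w. f w \<noteq> 0 \<longrightarrow> set w \<subseteq> gens E0 E1)}"

definition fa_mul :: "(('v, 'e) gen list \<Rightarrow> 'k::field) \<Rightarrow> (('v, 'e) gen list \<Rightarrow> 'k) \<Rightarrow> ('v, 'e) gen list \<Rightarrow> 'k" where
  "fa_mul f g = (\<lambda>w. \<Sum>i\<le>length w. f (take i w) * g (drop i w))"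

definition free_alg :: "'v set \<Rightarrow> 'e set \<Rightarrow> (('v, 'e) gen list \<Rightarrow> 'k::field) nrng" where
  "free_alg E0 E1 = \<lparr> rcarr = fa_carr E0 E1,
     radd = (\<lambda>f g w. f w + g w),
     rmul = fa_mul,
     rzero = (\<lambda>w. 0),
     rneg = (\<lambda>f w. - f w) \<rparr>"

definition fa_smult :: "'k::field \<Rightarrow> (('v, 'e) gen list \<Rightarrow> 'k) \<Rightarrow> ('v, 'e) gen list \<Rightarrow> 'k" where
  "fa_smult c f = (\<lambda>w. c * f w)"

definition fa_gen :: "('v, 'e) gen \<Rightarrow> ('v, 'e) gen list \<Rightarrow> 'k::field" where
  "fa_gen x = (\<lambda>w. if w = [x] then 1 else 0)"

definition fa_sub :: "(('v, 'e) gen list \<Rightarrow> 'k::field) \<Rightarrow> (('v, 'e) gen list \<Rightarrow> 'k) \<Rightarrow> ('v, 'e) gen list \<Rightarrow> 'k" where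
  "fa_sub f g = (\<lambda>w. f w - g w)"

definition lpa_rels :: "'v set \<Rightarrow> 'e set \<Rightarrow> ('e \<Rightarrow> 'v) \<Rightarrow> ('e \<Rightarrow> 'v) \<Rightarrow>
    (('v, 'e) gen list \<Rightarrow> 'k::field) set" where
  "lpa_rels E0 E1 r s =
     {fa_sub (fa_mul (fa_gen (Vt v)) (fa_gen (Vt w)))
             (if v = w then fa_gen (Vt v) else (\<lambda>_. 0)) | v w. v \<in> E0 \<and> w \<in> E0}
   \<union> {fa_sub (fa_mul (fa_gen (Vt (s e))) (fa_gen (Ed e))) (fa_gen (Ed e)) | e. e \<in> E1}
   \<union> {fa_sub (fa_mul (fa_gen (Ed e)) (fa_gen (Vt (r e)))) (fa_gen (Ed e)) | e. e \<in> E1}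
   \<union> {fa_sub (fa_mul (fa_gen (Vt (r e))) (fa_gen (Gh e))) (fa_gen (Gh e)) | e. e \<in> E1}
   \<union> {fa_sub (fa_mul (fa_gen (Gh e)) (fa_gen (Vt (s e)))) (fa_gen (Gh e)) | e. e \<in> E1}
   \<union> {fa_sub (fa_mul (fa_gen (Gh e)) (fa_gen (Ed f)))
             (if e = f then fa_gen (Vt (r e)) else (\<lambda>_. 0)) | e f. e \<in> E1 \<and> f \<in> E1}
   \<union> {(\<lambda>w. fa_gen (Vt v) w - (\<Sum>e\<in>{e \<in> E1. s e = v}. fa_mul (fa_gen (Ed e)) (fa_gen (Gh e)) w))
        | v. regular_vertex E0 E1 s v}"

definition lpa_relideal :: "'v set \<Rightarrow> 'e set \<Rightarrow> ('e \<Rightarrow> 'v) \<Rightarrow> ('e \<Rightarrow> 'v) \<Rightarrow>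
    (('v, 'e) gen list \<Rightarrow> 'k::field) set" where
  "lpa_relideal E0 E1 r s = \<Inter>{J. rideal (free_alg E0 E1) J \<and>
      (\<forall>c x. x \<in> J \<longrightarrow> fa_smult c x \<in> J) \<and> lpa_rels E0 E1 r s \<subseteq> J}"

type_synonym ('v, 'e, 'k) lpa_elem = "(('v, 'e) gen list \<Rightarrow> 'k) set"

definition LPA :: "'v set \<Rightarrow> 'e set \<Rightarrow> ('e \<Rightarrow> 'v) \<Rightarrow> ('e \<Rightarrow> 'v) \<Rightarrow> ('v, 'e, 'k::field) lpa_elem nrng" where
  "LPA E0 E1 r s = rquot (free_alg E0 E1) (lpa_relideal E0 E1 r s)"

definition lpa_cls :: "'v set \<Rightarrow> 'e set \<Rightarrow> ('e \<Rightarrow> 'v) \<Rightarrow> ('e \<Rightarrow> 'v) \<Rightarrow>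
    (('v, 'e) gen list \<Rightarrow> 'k::field) \<Rightarrow> ('v, 'e, 'k) lpa_elem" where
  "lpa_cls E0 E1 r s f = rcoset (free_alg E0 E1) (lpa_relideal E0 E1 r s) f"

definition lpa_vertex :: "'v set \<Rightarrow> 'e set \<Rightarrow> ('e \<Rightarrow> 'v) \<Rightarrow> ('e \<Rightarrow> 'v) \<Rightarrow> 'v \<Rightarrow> ('v, 'e, 'k::field) lpa_elem" where
  "lpa_vertex E0 E1 r s v = lpa_cls E0 E1 r s (fa_gen (Vt v))"

definition ideal_verts :: "'v set \<Rightarrow> 'e set \<Rightarrow> ('e \<Rightarrow> 'v) \<Rightarrow> ('e \<Rightarrow> 'v) \<Rightarrow>
    ('v, 'e, 'k::field) lpa_elem set \<Rightarrow> 'v set" where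
  "ideal_verts E0 E1 r s I = {v \<in> E0. lpa_vertex E0 E1 r s v \<in> I}"

definition breaking_verts :: "'v set \<Rightarrow> 'e set \<Rightarrow> ('e \<Rightarrow> 'v) \<Rightarrow> ('e \<Rightarrow> 'v) \<Rightarrow> 'v set \<Rightarrow> 'v set" where
  "breaking_verts E0 E1 r s H = {w. infinite_emitter E0 E1 s w \<and> w \<notin> H \<and>
     finite {e \<in> E1. s e = w \<and> r e \<notin> H} \<and> {e \<in> E1. s e = w \<and> r e \<notin> H} \<noteq> {}}"

definition vH :: "'v set \<Rightarrow> 'e set \<Rightarrow> ('e \<Rightarrow> 'v) \<Rightarrow> ('e \<Rightarrow> 'v) \<Rightarrow> 'v set \<Rightarrow> 'v \<Rightarrow> ('v, 'e, 'k::field) lpa_elem" where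
  "vH E0 E1 r s H v = lpa_cls E0 E1 r s
     (\<lambda>w. fa_gen (Vt v) w - (\<Sum>e\<in>{e \<in> E1. s e = v \<and> r e \<notin> H}. fa_mul (fa_gen (Ed e)) (fa_gen (Gh e)) w))"

definition graded_part :: "'v set \<Rightarrow> 'e set \<Rightarrow> ('e \<Rightarrow> 'v) \<Rightarrow> ('e \<Rightarrow> 'v) \<Rightarrow>
    ('v, 'e, 'k::field) lpa_elem set \<Rightarrow> ('v, 'e, 'k) lpa_elem set" where
  "graded_part E0 E1 r s I =
    (let H = ideal_verts E0 E1 r s I;
         S = {v \<in> breaking_verts E0 E1 r s H. vH E0 E1 r s H v \<in> I}
     in rgenideal (LPA E0 E1 r s) (lpa_vertex E0 E1 r s ` H \<union> vH E0 E1 r s H ` S))"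

end

theory Submission
  imports Defs "HOL-Library.Poly_Mapping" "HOL-Library.Sublist" "HOL-Computational_Algebra.Polynomial_Factorial"
begin

text \<open>Let \<open>I\<close> be an ideal and \<open>H\<close> its set of vertices. Modulo \<open>gr(I)\<close> the ideal is generated by
  polynomials \<open>f\<^sub>c(c)\<close> in the cycles \<open>c\<close> whose exits all lead into \<open>H\<close>: multiplying an element of \<open>I\<close>
  by edges removes its ghost edges, and a closed-path polynomial \<open>v + \<dots>\<close> in \<open>I\<close> with \<open>v \<notin> H\<close> forces \<open>v\<close>
  onto such a cycle, because otherwise a long path \<open>p\<close> from \<open>v\<close> kills all its terms except
  \<open>p\<^sup>* v p = r(p)\<close>. If there are only finitely many such cycles, then \<open>I\<close> is finitely generated over \<open>gr(I)\<close>, and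
  splitting each \<open>f\<^sub>c\<close> into irreducible factors writes \<open>I\<close> as a product of semiprime ideals.
  Conversely, from infinitely many cycles \<open>c\<^sub>1, c\<^sub>2, \<dots>\<close> one builds the ideals generated by \<open>H\<close>, all \<open>v\<^sup>H\<close> and
  either all \<open>c\<^sub>n - 1\<close>, which is not finitely generated over its graded part, or all \<open>(c\<^sub>n - 1)\<^sup>n\<close>, which is not a product of
  finitely many semiprime ideals. Non-membership is detected by letting the algebra act on functions on
  infinite paths that end in a cycle, with values in Laurent polynomials.\<close>

section \<open>The free algebra and the defining relations\<close>

text \<open>The algebra has no unit and its elements are cosets, so everything is computed with
  representatives in a free algebra with unit, as congruences modulo ideals; finite sums of vertices
  act as local units. At a cycle that is exitless modulo a graded ideal, the corner is the ring of
  Laurent polynomials in the cycle, and different cycles are orthogonal. This yields one polynomial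
  per cycle and turns products of ideals into products of polynomials. The delicate vertices are
  infinite emitters: no relation v = sum of e e^* holds there, so a cycle through one behaves well
  only if the corresponding \<open>v^H\<close> lies in the ideal. This is why the ideals of the
  converse contain every \<open>v^H\<close>. The polynomial x - 1 is used there because it stays a
  nonunit in the Laurent ring. If a product of k semiprime ideals contains (c_n - 1)^n, then every
  factor contains c_n - 1, hence the product contains (c_n - 1)^k; the component at c_n allows only
  multiples of the n-th power, and n = k + 1 gives the contradiction.\<close>

instantiation list :: (type) monoid_add
begin
definition zero_list_def: "0 = []"
definition plus_list_def: "xs + ys = xs @ ys"
instance by standard (simp_all add: zero_list_def plus_list_def)
end

text \<open>Concatenation is the addition of lists, so the convolution product of finitely supported
  functions on words is the product of the free algebra with unit, the empty word being
  \<open>1\<close>.\<close>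

type_synonym ('v, 'e, 'k) fa = "('v, 'e) gen list \<Rightarrow>\<^sub>0 'k"

definition sc :: "'k::field \<Rightarrow> ('v, 'e, 'k) fa" where
  "sc k = Poly_Mapping.single [] k"

definition letter :: "('v, 'e) gen \<Rightarrow> ('v, 'e, 'k::field) fa" where
  "letter g = Poly_Mapping.single [g] 1"

text \<open>The augmentation ideal is the free algebra without unit. Keeping it inside the unital
  one makes \<open>1\<close> and the scalars \<open>sc k\<close> available as multipliers and allows
  empty paths as factors.\<close>

definition augm :: "('v, 'e, 'k::field) fa set" where
  "augm = {f. Poly_Mapping.lookup f [] = 0}"

lemma mult_single_list: "Poly_Mapping.single u a * Poly_Mapping.single w b = Poly_Mapping.single (u @ w) (a * b)"
  by (simp add: mult_single plus_list_def)

lemma sc_0 [simp]: "sc 0 = 0" by (simp add: sc_def)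
lemma sc_1 [simp]: "sc 1 = 1" unfolding sc_def by (simp flip: zero_list_def)
lemma sc_add: "sc (a + b) = sc a + sc b" by (simp add: sc_def single_add)
lemma sc_mult: "sc (a * b) = sc a * sc b" by (simp add: sc_def mult_single_list)
lemma sc_uminus: "sc (- a) = - sc a" by (simp add: sc_def single_uminus)

lemma fa_expand: "f = (\<Sum>w\<in>Poly_Mapping.keys f. Poly_Mapping.single w (Poly_Mapping.lookup f w))" for f :: "('v, 'e, 'k::field) fa"
proof (rule poly_mapping_eqI)
  fix k
  have "Poly_Mapping.lookup (\<Sum>w\<in>Poly_Mapping.keys f. Poly_Mapping.single w (Poly_Mapping.lookup f w)) k
      = (\<Sum>w\<in>Poly_Mapping.keys f. if w = k then Poly_Mapping.lookup f w else 0)"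
    by (simp add: lookup_sum lookup_single when_def)
  also have "\<dots> = Poly_Mapping.lookup f k" by (simp add: in_keys_iff)
  finally show "Poly_Mapping.lookup f k = Poly_Mapping.lookup
      (\<Sum>w\<in>Poly_Mapping.keys f. Poly_Mapping.single w (Poly_Mapping.lookup f w)) k" by simp
qed

lemma fa_induct [case_names zero add single]:
  assumes "P 0" "\<And>f g. P f \<Longrightarrow> P g \<Longrightarrow> P (f + g)" "\<And>w k. P (Poly_Mapping.single w k)"
  shows "P (f :: ('v, 'e, 'k::field) fa)"
proof -
  have "P (\<Sum>w\<in>A. Poly_Mapping.single w (Poly_Mapping.lookup f w))" if "finite A" for A
    using that by induction (use assms in auto)
  then show ?thesis using fa_expand[of f] by (metis finite_keys)
qed

lemma sc_commute: "x * sc k = sc k * x"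
  by (induction x rule: fa_induct) (simp_all add: algebra_simps sc_def mult_single_list)

lemma sc_left_commute: "x * (sc k * y) = sc k * (x * y)"
  by (simp add: sc_commute mult.assoc[symmetric])

lemma single_Cons: "Poly_Mapping.single (g # w) k = letter g * Poly_Mapping.single w (k::'k::field)"
  by (simp add: letter_def mult_single_list)

lemma lookup_mult_Nil: "Poly_Mapping.lookup (f * g) [] = Poly_Mapping.lookup f [] * Poly_Mapping.lookup g []" for f g :: "('v, 'e, 'k::field) fa"
proof (induction f rule: fa_induct)
  case (single w k)
  show ?case
    by (induction g rule: fa_induct)
       (auto simp: algebra_simps mult_single_list lookup_add lookup_single when_def)
qed (simp_all add: algebra_simps lookup_add)

lemma augm_zero [simp]: "0 \<in> augm" by (simp add: augm_def)
lemma augm_letter [simp]: "letter g \<in> augm" by (simp add: augm_def letter_def lookup_single)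
lemma augm_add: "x \<in> augm \<Longrightarrow> y \<in> augm \<Longrightarrow> x + y \<in> augm" by (simp add: augm_def lookup_add)
lemma augm_diff: "x \<in> augm \<Longrightarrow> y \<in> augm \<Longrightarrow> x - y \<in> augm" by (simp add: augm_def lookup_minus)
lemma augm_uminus: "x \<in> augm \<Longrightarrow> - x \<in> augm" by (simp add: augm_def)
lemma augm_mult1: "x \<in> augm \<Longrightarrow> x * y \<in> augm" by (simp add: augm_def lookup_mult_Nil)
lemma augm_mult2: "y \<in> augm \<Longrightarrow> x * y \<in> augm" by (simp add: augm_def lookup_mult_Nil)
lemma augm_sum: "(\<And>i. i \<in> A \<Longrightarrow> f i \<in> augm) \<Longrightarrow> sum f A \<in> augm"
  by (induction A rule: infinite_finite_induct) (auto intro: augm_add)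

lemmas augm_intros = augm_zero augm_letter augm_add augm_diff augm_uminus augm_mult1 augm_mult2 augm_sum

text \<open>Words grow by letters on the left, which is how monomials are brought to normal form in
  \<open>spanned_letter\<close>.\<close>

lemma augm_induct [consumes 1, case_names zero add letter mult]:
  assumes "x \<in> augm" "P 0" "\<And>f g. P f \<Longrightarrow> P g \<Longrightarrow> P (f + g)"
    "\<And>g k. P (sc k * letter g)" "\<And>g x. P x \<Longrightarrow> P (letter g * x)"
  shows "P (x :: ('v, 'e, 'k::field) fa)"
proof -
  have S: "P (Poly_Mapping.single w k)" if "w \<noteq> []" for w k
    using that
  proof (induction w rule: list_nonempty_induct)
    case (single g)
    then show ?case using assms(4)[of k g] by (simp add: letter_def sc_def mult_single_list)
  next
    case (cons g w)
    then show ?case using assms(5) by (simp add: single_Cons)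
  qed
  have "P (\<Sum>w\<in>A. Poly_Mapping.single w (Poly_Mapping.lookup x w))" if "finite A" "[] \<notin> A" for A
    using that by induction (use assms(2,3) S in \<open>auto\<close>)
  moreover have "[] \<notin> Poly_Mapping.keys x" using assms(1) by (simp add: augm_def in_keys_iff)
  ultimately show ?thesis using fa_expand[of x] by (metis finite_keys)
qed

text \<open>The parameter \<open>K\<close> only fixes the type of scalars.\<close>

locale graph =
  fixes E0 :: "'v set" and E1 :: "'e set" and r s :: "'e \<Rightarrow> 'v" and K :: "'k::field itself"
  assumes s_E0: "e \<in> E1 \<Longrightarrow> s e \<in> E0" and r_E0: "e \<in> E1 \<Longrightarrow> r e \<in> E0"
begin

abbreviation VV :: "'v \<Rightarrow> ('v, 'e, 'k) fa" where "VV v \<equiv> letter (Vt v)"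
abbreviation DD :: "'e \<Rightarrow> ('v, 'e, 'k) fa" where "DD e \<equiv> letter (Ed e)"
abbreviation GG :: "'e \<Rightarrow> ('v, 'e, 'k) fa" where "GG e \<equiv> letter (Gh e)"

text \<open>The empty path gives \<open>1\<close> and not a vertex, so path monomials always carry a
  factor \<open>VV v\<close> that records where the path ends.\<close>

definition PP :: "'e list \<Rightarrow> ('v, 'e, 'k) fa" where "PP p = prod_list (map DD p)"
definition QQ :: "'e list \<Rightarrow> ('v, 'e, 'k) fa" where "QQ p = prod_list (map GG (rev p))"

lemma PP_Nil [simp]: "PP [] = 1" and PP_Cons: "PP (e # p) = DD e * PP p"
  and PP_append: "PP (p @ q) = PP p * PP q"
  by (simp_all add: PP_def)
lemma QQ_Nil [simp]: "QQ [] = 1" and QQ_Cons: "QQ (e # p) = QQ p * GG e"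
  and QQ_append: "QQ (p @ q) = QQ q * QQ p"
  by (simp_all add: QQ_def)

definition out :: "'v \<Rightarrow> 'e set" where "out v = {e \<in> E1. s e = v}"

definition rels :: "('v, 'e, 'k) fa set" where
  "rels = {VV v * VV w - (if v = w then VV v else 0) | v w. v \<in> E0 \<and> w \<in> E0}
   \<union> {VV (s e) * DD e - DD e | e. e \<in> E1}
   \<union> {DD e * VV (r e) - DD e | e. e \<in> E1}
   \<union> {VV (r e) * GG e - GG e | e. e \<in> E1}
   \<union> {GG e * VV (s e) - GG e | e. e \<in> E1}
   \<union> {GG e * DD f - (if e = f then VV (r e) else 0) | e f. e \<in> E1 \<and> f \<in> E1}
   \<union> {VV v - (\<Sum>e\<in>out v. DD e * GG e) | v. regular_vertex E0 E1 s v}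
   \<union> letter ` (- gens E0 E1)"

text \<open>Preimages in the free algebra of ideals of the Leavitt path algebra. Counting the letters outside the
  graph among the relations removes all membership conditions from the multiplicative closure.\<close>

definition lideal :: "('v, 'e, 'k) fa set \<Rightarrow> bool" where
  "lideal J \<longleftrightarrow> J \<subseteq> augm \<and> 0 \<in> J \<and> (\<forall>x\<in>J. \<forall>y\<in>J. x - y \<in> J) \<and>
     (\<forall>x\<in>J. \<forall>a. a * x \<in> J \<and> x * a \<in> J) \<and> rels \<subseteq> J"

lemma lideal_augm: "lideal J \<Longrightarrow> x \<in> J \<Longrightarrow> x \<in> augm"
  and lideal_0: "lideal J \<Longrightarrow> 0 \<in> J"
  and lideal_diff: "lideal J \<Longrightarrow> x \<in> J \<Longrightarrow> y \<in> J \<Longrightarrow> x - y \<in> J"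
  and lideal_lmult: "lideal J \<Longrightarrow> x \<in> J \<Longrightarrow> a * x \<in> J"
  and lideal_rmult: "lideal J \<Longrightarrow> x \<in> J \<Longrightarrow> x * a \<in> J"
  by (auto simp: lideal_def)

lemma lideal_uminus: "lideal J \<Longrightarrow> x \<in> J \<Longrightarrow> - x \<in> J"
  using lideal_diff[of J 0 x] lideal_0[of J] by simp

lemma lideal_add: "lideal J \<Longrightarrow> x \<in> J \<Longrightarrow> y \<in> J \<Longrightarrow> x + y \<in> J"
  using lideal_diff[of J x "- y"] lideal_uminus[of J y] by simp

lemma lideal_sum: "lideal J \<Longrightarrow> (\<And>i. i \<in> A \<Longrightarrow> f i \<in> J) \<Longrightarrow> sum f A \<in> J"
  by (induction A rule: infinite_finite_induct) (auto intro: lideal_add lideal_0)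

lemma rels_augm: "rels \<subseteq> augm"
  unfolding rels_def by (auto intro!: augm_intros)

lemma lideal_augm_self: "lideal augm"
  using rels_augm by (auto simp: lideal_def intro: augm_intros)

lemma lideal_Inter:
  assumes "\<A> \<noteq> {}" "\<And>J. J \<in> \<A> \<Longrightarrow> lideal J" shows "lideal (\<Inter>\<A>)"
  using assms unfolding lideal_def by (intro conjI; blast)

definition lgen :: "('v, 'e, 'k) fa set \<Rightarrow> ('v, 'e, 'k) fa set" where
  "lgen X = \<Inter>{J. lideal J \<and> X \<subseteq> J}"

lemma lideal_lgen: "X \<subseteq> augm \<Longrightarrow> lideal (lgen X)"
  unfolding lgen_def using lideal_augm_self by (intro lideal_Inter) auto

lemma lgen_incl: "X \<subseteq> lgen X" by (auto simp: lgen_def)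
lemma lgen_least: "lideal J \<Longrightarrow> X \<subseteq> J \<Longrightarrow> lgen X \<subseteq> J" by (auto simp: lgen_def)
lemma lgen_mono: "X \<subseteq> Y \<Longrightarrow> lgen X \<subseteq> lgen Y" by (auto simp: lgen_def)

definition NN :: "('v, 'e, 'k) fa set" where "NN = lgen {}"

lemma lideal_NN [simp]: "lideal NN" by (simp add: NN_def lideal_lgen)
lemma NN_least: "lideal J \<Longrightarrow> NN \<subseteq> J" by (simp add: NN_def lgen_least)

definition cg :: "('v, 'e, 'k) fa set \<Rightarrow> ('v, 'e, 'k) fa \<Rightarrow> ('v, 'e, 'k) fa \<Rightarrow> bool" where
  "cg J x y \<longleftrightarrow> x - y \<in> J"

abbreviation eqv :: "('v, 'e, 'k) fa \<Rightarrow> ('v, 'e, 'k) fa \<Rightarrow> bool" (infix "\<approx>" 50) where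
  "x \<approx> y \<equiv> cg NN x y"

lemma cg_refl [simp]: "lideal J \<Longrightarrow> cg J x x" by (simp add: cg_def lideal_0)
lemma cg_sym: "lideal J \<Longrightarrow> cg J x y \<Longrightarrow> cg J y x"
  unfolding cg_def using lideal_uminus by fastforce
lemma cg_trans: "lideal J \<Longrightarrow> cg J x y \<Longrightarrow> cg J y z \<Longrightarrow> cg J x z"
  unfolding cg_def using lideal_add[of J "x - y" "y - z"] by simp
lemma cg_add: "lideal J \<Longrightarrow> cg J x x' \<Longrightarrow> cg J y y' \<Longrightarrow> cg J (x + y) (x' + y')"
  unfolding cg_def using lideal_add[of J "x - x'" "y - y'"] by (simp add: algebra_simps)
lemma cg_diff: "lideal J \<Longrightarrow> cg J x x' \<Longrightarrow> cg J y y' \<Longrightarrow> cg J (x - y) (x' - y')"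
  unfolding cg_def using lideal_diff[of J "x - x'" "y - y'"] by (simp add: algebra_simps)
lemma cg_lmult: "lideal J \<Longrightarrow> cg J x y \<Longrightarrow> cg J (a * x) (a * y)"
  unfolding cg_def using lideal_lmult[of J "x - y" a] by (simp add: algebra_simps)
lemma cg_rmult: "lideal J \<Longrightarrow> cg J x y \<Longrightarrow> cg J (x * a) (y * a)"
  unfolding cg_def using lideal_rmult[of J "x - y" a] by (simp add: algebra_simps)
lemma cg_mult: "lideal J \<Longrightarrow> cg J x x' \<Longrightarrow> cg J y y' \<Longrightarrow> cg J (x * y) (x' * y')"
  using cg_lmult[of J y y' x] cg_rmult[of J x x' y'] cg_trans by blast
lemma cg_sum: "lideal J \<Longrightarrow> (\<And>i. i \<in> A \<Longrightarrow> cg J (f i) (g i)) \<Longrightarrow> cg J (sum f A) (sum g A)"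
  unfolding cg_def using lideal_sum[of J A "\<lambda>i. f i - g i"] by (simp add: sum_subtractf)
lemma cg_mem: "lideal J \<Longrightarrow> cg J x y \<Longrightarrow> x \<in> J \<longleftrightarrow> y \<in> J"
  unfolding cg_def using lideal_add[of J "x - y" y] lideal_diff[of J x "x - y"] by auto
lemma cg_0 [simp]: "cg J x 0 \<longleftrightarrow> x \<in> J" by (simp add: cg_def)
lemma cg_mono: "I \<subseteq> J \<Longrightarrow> cg I x y \<Longrightarrow> cg J x y" by (auto simp: cg_def)
lemma eqv_cg: "lideal J \<Longrightarrow> x \<approx> y \<Longrightarrow> cg J x y" using NN_least cg_mono by blast
lemma eqv_mem: "lideal J \<Longrightarrow> x \<approx> y \<Longrightarrow> x \<in> J \<longleftrightarrow> y \<in> J" using eqv_cg cg_mem by blast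

lemmas eqv_refl = cg_refl[OF lideal_NN]
lemmas eqv_sym = cg_sym[OF lideal_NN]
lemmas eqv_trans [trans] = cg_trans[OF lideal_NN]
lemmas eqv_add = cg_add[OF lideal_NN]
lemmas eqv_diff = cg_diff[OF lideal_NN]
lemmas eqv_lmult = cg_lmult[OF lideal_NN]
lemmas eqv_rmult = cg_rmult[OF lideal_NN]
lemmas eqv_mult = cg_mult[OF lideal_NN]
lemmas eqv_sum = cg_sum[OF lideal_NN]

lemma eqv_ctx: "x \<approx> y \<Longrightarrow> a * (x * b) \<approx> a * (y * b)"
  by (intro eqv_lmult eqv_rmult)

lemma NN_rels: "rels \<subseteq> NN" using lideal_NN unfolding lideal_def by blast

lemma rels_VV: "v \<in> E0 \<Longrightarrow> w \<in> E0 \<Longrightarrow> VV v * VV w - (if v = w then VV v else 0) \<in> rels"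
  and rels_VD: "e \<in> E1 \<Longrightarrow> VV (s e) * DD e - DD e \<in> rels"
  and rels_DV: "e \<in> E1 \<Longrightarrow> DD e * VV (r e) - DD e \<in> rels"
  and rels_VG: "e \<in> E1 \<Longrightarrow> VV (r e) * GG e - GG e \<in> rels"
  and rels_GV: "e \<in> E1 \<Longrightarrow> GG e * VV (s e) - GG e \<in> rels"
  and rels_GD: "e \<in> E1 \<Longrightarrow> f \<in> E1 \<Longrightarrow> GG e * DD f - (if e = f then VV (r e) else 0) \<in> rels"
  and rels_CK2: "regular_vertex E0 E1 s v \<Longrightarrow> VV v - (\<Sum>e\<in>out v. DD e * GG e) \<in> rels"
  and rels_junk: "g \<notin> gens E0 E1 \<Longrightarrow> letter g \<in> rels"
  unfolding rels_def by blast+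

lemma junk_letter: "g \<notin> gens E0 E1 \<Longrightarrow> letter g \<in> NN"
  using NN_rels rels_junk by blast

lemma junk_VV: "v \<notin> E0 \<Longrightarrow> VV v \<in> NN" and junk_DD: "e \<notin> E1 \<Longrightarrow> DD e \<in> NN"
  and junk_GG: "e \<notin> E1 \<Longrightarrow> GG e \<in> NN"
  by (auto intro!: junk_letter simp: gens_def)

text \<open>Letters outside the graph lie in \<open>NN\<close>, where both sides vanish; hence the
  relation can be stated without membership assumptions. The edge relations below are extended in
  the same way.\<close>

lemma rel_VV: "VV v * VV w \<approx> (if v = w then VV v else 0)"
proof (cases "v \<in> E0 \<and> w \<in> E0")
  case True then show ?thesis unfolding cg_def using NN_rels rels_VV by blast
next
  case False
  then have "VV v * VV w \<in> NN" "v = w \<Longrightarrow> VV v \<in> NN"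
    using junk_VV lideal_lmult lideal_rmult lideal_NN by blast+
  then show ?thesis by (auto simp: cg_def intro: lideal_diff)
qed

lemma rel_VD1: "VV (s e) * DD e \<approx> DD e"
proof (cases "e \<in> E1")
  case True then show ?thesis unfolding cg_def using NN_rels rels_VD by blast
next
  case False
  then show ?thesis unfolding cg_def by (intro lideal_diff lideal_lmult) (auto intro: junk_DD)
qed

lemma rel_DV1: "DD e * VV (r e) \<approx> DD e"
proof (cases "e \<in> E1")
  case True then show ?thesis unfolding cg_def using NN_rels rels_DV by blast
next
  case False
  then show ?thesis unfolding cg_def by (intro lideal_diff lideal_rmult) (auto intro: junk_DD)
qed

lemma rel_VG1: "VV (r e) * GG e \<approx> GG e"
proof (cases "e \<in> E1")
  case True then show ?thesis unfolding cg_def using NN_rels rels_VG by blast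
next
  case False
  then show ?thesis unfolding cg_def by (intro lideal_diff lideal_lmult) (auto intro: junk_GG)
qed

lemma rel_GV1: "GG e * VV (s e) \<approx> GG e"
proof (cases "e \<in> E1")
  case True then show ?thesis unfolding cg_def using NN_rels rels_GV by blast
next
  case False
  then show ?thesis unfolding cg_def by (intro lideal_diff lideal_rmult) (auto intro: junk_GG)
qed

text \<open>Here the assumption on \<open>e\<close> stays: for \<open>e\<close> outside the graph
  the left side vanishes, while \<open>r e\<close> may still be a vertex of the graph.\<close>

lemma rel_GD: assumes "e \<in> E1" shows "GG e * DD f \<approx> (if e = f then VV (r e) else 0)"
proof (cases "f \<in> E1")
  case True then show ?thesis unfolding cg_def using NN_rels rels_GD assms by blast
next
  case False
  then show ?thesis using assms by (auto intro!: lideal_lmult junk_DD)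
qed

lemma rel_GD1: "e \<in> E1 \<Longrightarrow> GG e * DD e \<approx> VV (r e)"
  and rel_GD0: "e \<in> E1 \<Longrightarrow> e \<noteq> f \<Longrightarrow> GG e * DD f \<approx> 0"
  using rel_GD[of e e] rel_GD[of e f] by auto

lemma rel_CK2: "regular_vertex E0 E1 s v \<Longrightarrow> VV v \<approx> (\<Sum>e\<in>out v. DD e * GG e)"
  unfolding cg_def using NN_rels rels_CK2 by blast

lemma rel_VV1: "VV v * VV v \<approx> VV v" and rel_VV0: "v \<noteq> w \<Longrightarrow> VV v * VV w \<approx> 0"
  using rel_VV[of v v] rel_VV[of v w] by auto

lemma rel_GV0: assumes "v \<noteq> s e" shows "GG e * VV v \<approx> 0"
proof -
  have "GG e * VV v \<approx> (GG e * VV (s e)) * VV v" by (rule eqv_sym, intro eqv_rmult rel_GV1)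
  also have "\<dots> = GG e * (VV (s e) * VV v)" by (simp add: mult.assoc)
  also have "\<dots> \<approx> GG e * 0" using assms by (intro eqv_lmult rel_VV0) auto
  finally show ?thesis by simp
qed

lemma rel_DV0: assumes "v \<noteq> r e" shows "DD e * VV v \<approx> 0"
proof -
  have "DD e * VV v \<approx> (DD e * VV (r e)) * VV v" by (rule eqv_sym, intro eqv_rmult rel_DV1)
  also have "\<dots> = DD e * (VV (r e) * VV v)" by (simp add: mult.assoc)
  also have "\<dots> \<approx> DD e * 0" using assms by (intro eqv_lmult rel_VV0) auto
  finally show ?thesis by simp
qed

section \<open>Walks and path monomials\<close>

fun walk :: "'v \<Rightarrow> 'e list \<Rightarrow> 'v \<Rightarrow> bool" where
  "walk u [] v \<longleftrightarrow> u = v \<and> u \<in> E0"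
| "walk u (e # p) v \<longleftrightarrow> e \<in> E1 \<and> s e = u \<and> walk (r e) p v"

lemma walk_E0: "walk u p v \<Longrightarrow> u \<in> E0 \<and> v \<in> E0"
  by (induction u p v rule: walk.induct) (auto intro: s_E0)

lemma walk_append: "walk u (p @ q) w \<longleftrightarrow> (\<exists>v. walk u p v \<and> walk v q w)"
  by (induction p arbitrary: u) (auto dest: walk_E0)

lemma walk_end_unique: "walk u p v \<Longrightarrow> walk u p w \<Longrightarrow> v = w"
  by (induction p arbitrary: u) auto

lemma VV_PP: "walk u p v \<Longrightarrow> VV u * (PP p * VV v) \<approx> PP p * VV v"
proof (cases p)
  case Nil
  then show "walk u p v \<Longrightarrow> ?thesis" by (auto simp: rel_VV1)
next
  case (Cons e q)
  assume w: "walk u p v"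
  have "VV u * (PP p * VV v) = (VV (s e) * DD e) * (PP q * VV v)"
    using w Cons by (simp add: PP_Cons mult.assoc)
  also have "\<dots> \<approx> DD e * (PP q * VV v)" by (intro eqv_rmult rel_VD1)
  finally show ?thesis using Cons by (simp add: PP_Cons mult.assoc)
qed

lemma VV_QQ: "walk u p v \<Longrightarrow> (VV v * QQ p) * VV u \<approx> VV v * QQ p"
proof (cases p)
  case Nil
  then show "walk u p v \<Longrightarrow> ?thesis" by (auto simp: rel_VV1)
next
  case (Cons e q)
  assume w: "walk u p v"
  have "(VV v * QQ p) * VV u = (VV v * QQ q) * (GG e * VV (s e))"
    using w Cons by (simp add: QQ_Cons mult.assoc)
  also have "\<dots> \<approx> (VV v * QQ q) * GG e" by (intro eqv_lmult rel_GV1)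
  finally show ?thesis using Cons by (simp add: QQ_Cons mult.assoc)
qed

lemma QQ_PP: "walk u p v \<Longrightarrow> QQ p * (PP p * VV v) \<approx> VV v"
proof (induction p arbitrary: u)
  case (Cons e p)
  then have w: "walk (r e) p v" "e \<in> E1" by auto
  have "QQ (e # p) * (PP (e # p) * VV v) = QQ p * ((GG e * DD e) * (PP p * VV v))"
    by (simp add: PP_Cons QQ_Cons mult.assoc)
  also have "\<dots> \<approx> QQ p * (VV (r e) * (PP p * VV v))" by (intro eqv_ctx rel_GD1 w)
  also have "\<dots> \<approx> QQ p * (PP p * VV v)" by (intro eqv_lmult VV_PP w)
  also have "\<dots> \<approx> VV v" by (rule Cons.IH[OF w(1)])
  finally show ?case .
qed (simp)

lemma QQ_PP_mid:
  assumes "walk u p v" "walk v q w" shows "QQ p * (PP p * (PP q * VV w)) \<approx> PP q * VV w"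
proof -
  have "QQ p * (PP p * (PP q * VV w)) \<approx> QQ p * (PP p * (VV v * (PP q * VV w)))"
    by (rule eqv_sym, intro eqv_lmult VV_PP assms)
  also have "\<dots> = QQ p * (PP p * VV v) * (PP q * VV w)" by (simp add: mult.assoc)
  also have "\<dots> \<approx> VV v * (PP q * VV w)" by (intro eqv_rmult QQ_PP[OF assms(1)])
  also have "\<dots> \<approx> PP q * VV w" by (intro VV_PP assms)
  finally show ?thesis .
qed

lemma QQ_PP_ext:
  assumes "walk u p v" "walk v q w" shows "QQ p * (PP (p @ q) * VV w) \<approx> PP q * VV w"
  using QQ_PP_mid[OF assms] by (simp add: PP_append mult.assoc)

text \<open>Incomparable paths from the same vertex part at some position, and there a ghost edge
  meets a different real edge.\<close>

lemma QQ_PP_incomp: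
  assumes "walk u p v" "walk u q w" "\<not> prefix p q" "\<not> prefix q p"
  shows "QQ p * (PP q * VV w) \<approx> 0"
  using assms
proof (induction p arbitrary: u q)
  case (Cons e p)
  then obtain f q' where q: "q = f # q'" by (cases q) auto
  have e: "e \<in> E1" "walk (r e) p v" using Cons.prems by auto
  have *: "QQ (e # p) * (PP q * VV w) = QQ p * ((GG e * DD f) * (PP q' * VV w))"
    by (simp add: q PP_Cons QQ_Cons mult.assoc)
  show ?case
  proof (cases "e = f")
    case True
    have w': "walk (r e) q' w" using Cons.prems q True by auto
    have "QQ p * ((GG e * DD f) * (PP q' * VV w)) \<approx> QQ p * (VV (r e) * (PP q' * VV w))"
      using rel_GD1[OF e(1)] True by (intro eqv_ctx) simp
    also have "\<dots> \<approx> QQ p * (PP q' * VV w)" by (intro eqv_lmult VV_PP w')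
    also have "\<dots> \<approx> 0" using Cons.IH[OF e(2) w'] Cons.prems q True by simp
    finally show ?thesis using * by simp
  next
    case False
    have "QQ p * ((GG e * DD f) * (PP q' * VV w)) \<approx> QQ p * (0 * (PP q' * VV w))"
      by (intro eqv_ctx rel_GD0 e False)
    then show ?thesis using * by simp
  qed
qed simp

section \<open>Spanning monomials and local units\<close>

inductive_set addspan :: "('v, 'e, 'k) fa set \<Rightarrow> ('v, 'e, 'k) fa set" for X where
  zero: "0 \<in> addspan X"
| add: "x \<in> X \<Longrightarrow> y \<in> addspan X \<Longrightarrow> x + y \<in> addspan X"

lemma addspan_incl: "x \<in> X \<Longrightarrow> x \<in> addspan X"
  by (metis add.right_neutral addspan.add addspan.zero)

lemma addspan_plus: "x \<in> addspan X \<Longrightarrow> y \<in> addspan X \<Longrightarrow> x + y \<in> addspan X"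
  by (induction rule: addspan.induct) (auto simp: add.assoc intro: addspan.add)

lemma addspan_mono: assumes "X \<subseteq> Y" shows "addspan X \<subseteq> addspan Y"
proof
  fix x assume "x \<in> addspan X"
  then show "x \<in> addspan Y" by induction (use assms in \<open>auto intro: addspan.intros\<close>)
qed

text \<open>The monomials \<open>\<alpha> \<beta>\<^sup>*\<close>; the index bounds the number of ghost edges.\<close>

definition Mon :: "nat \<Rightarrow> 'v \<Rightarrow> 'v \<Rightarrow> ('v, 'e, 'k) fa set" where
  "Mon n u v = {sc k * (PP a * (VV m * QQ b)) | k a b m. walk u a m \<and> walk v b m \<and> length b \<le> n}"

definition MonSpan :: "nat \<Rightarrow> 'v \<Rightarrow> 'v \<Rightarrow> ('v, 'e, 'k) fa set" where
  "MonSpan n u v = {x. \<exists>y\<in>addspan (Mon n u v). x \<approx> y}"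

lemma MonSpan_plus: "x \<in> MonSpan n u v \<Longrightarrow> y \<in> MonSpan n u v \<Longrightarrow> x + y \<in> MonSpan n u v"
  unfolding MonSpan_def using addspan_plus eqv_add by blast

lemma Mon_mono: "m \<le> n \<Longrightarrow> Mon m u v \<subseteq> Mon n u v"
  unfolding Mon_def by force

lemma MonSpan_mono: assumes "m \<le> n" shows "MonSpan m u v \<subseteq> MonSpan n u v"
  using addspan_mono[OF Mon_mono[OF assms]] unfolding MonSpan_def by auto

lemma MonSpan_0: "0 \<in> MonSpan n u v"
  unfolding MonSpan_def using addspan.zero eqv_refl by blast

lemma MonSpan_mono_mem: "x \<in> Mon n u v \<Longrightarrow> x \<in> MonSpan n u v"
  unfolding MonSpan_def using addspan_incl eqv_refl by blast

lemma MonSpan_eqv: "x \<approx> y \<Longrightarrow> y \<in> MonSpan n u v \<Longrightarrow> x \<in> MonSpan n u v"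
  unfolding MonSpan_def using eqv_trans by blast

definition AllMon :: "('v, 'e, 'k) fa set" where
  "AllMon = (\<Union>n u v. Mon n u v)"

lemma MonI: "walk u a m \<Longrightarrow> walk v b m \<Longrightarrow> length b \<le> n \<Longrightarrow>
    sc k * (PP a * (VV m * QQ b)) \<in> Mon n u v"
  unfolding Mon_def by (rule CollectI) (intro exI conjI, rule refl)

lemma AllMonI: "walk u a m \<Longrightarrow> walk v b m \<Longrightarrow> sc k * (PP a * (VV m * QQ b)) \<in> AllMon"
  unfolding AllMon_def using MonI[of u a m v b "length b" k] by blast

definition spanned :: "('v, 'e, 'k) fa \<Rightarrow> bool" where
  "spanned x \<longleftrightarrow> (\<exists>y\<in>addspan AllMon. x \<approx> y)"

lemma spanned_0: "spanned 0" unfolding spanned_def using addspan.zero eqv_refl by blast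
lemma spanned_add: "spanned x \<Longrightarrow> spanned y \<Longrightarrow> spanned (x + y)"
  unfolding spanned_def using addspan_plus eqv_add by blast
lemma spanned_eqv: "x \<approx> y \<Longrightarrow> spanned y \<Longrightarrow> spanned x"
  unfolding spanned_def using eqv_trans by blast
lemma spanned_mon: "walk u a m \<Longrightarrow> walk v b m \<Longrightarrow> spanned (sc k * (PP a * (VV m * QQ b)))"
  unfolding spanned_def using AllMonI addspan_incl eqv_refl by blast
lemma spanned_NN: "x \<in> NN \<Longrightarrow> spanned x"
  using spanned_eqv[of x 0] spanned_0 by simp

text \<open>A letter in front of a monomial gives a monomial or zero: a vertex tests the source, a
  real edge prolongs \<open>a\<close>, and a ghost edge cancels the first edge of \<open>a\<close>
  or, if \<open>a\<close> is empty, prolongs \<open>b\<close>.\<close>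

lemma spanned_letter_mon:
  assumes "walk u a m" "walk v b m"
  shows "spanned (letter g * (sc k * (PP a * (VV m * QQ b))))"
proof (cases "g \<in> gens E0 E1")
  case False
  then show ?thesis by (intro spanned_NN lideal_rmult junk_letter) auto
next
  case True
  have m: "m \<in> E0" using walk_E0 assms(1) by blast
  have c: "letter g * (sc k * (PP a * (VV m * QQ b))) = sc k * ((letter g * (PP a * VV m)) * QQ b)"
    by (simp add: sc_left_commute mult.assoc)
  have red: "spanned (sc k * ((letter g * (PP a * VV m)) * QQ b))"
    if "letter g * (PP a * VV m) \<approx> y" "spanned (sc k * (y * QQ b))" for y
    using that(2) by (rule spanned_eqv[rotated]) (intro eqv_ctx that(1))
  consider w where "g = Vt w" | e where "g = Ed e" "e \<in> E1" | e where "g = Gh e" "e \<in> E1"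
    using True by (auto simp: gens_def)
  then show ?thesis
  proof cases
    case 1
    show ?thesis
    proof (cases "w = u")
      case True
      have "spanned (sc k * ((PP a * VV m) * QQ b))"
        using spanned_mon[OF assms, of k] by (simp add: mult.assoc)
      then show ?thesis unfolding c using VV_PP[OF assms(1)] True 1 red by blast
    next
      case False
      have "letter g * (PP a * VV m) \<approx> VV w * (VV u * (PP a * VV m))"
        unfolding 1 by (rule eqv_sym, intro eqv_lmult VV_PP assms)
      also have "\<dots> = (VV w * VV u) * (PP a * VV m)" by (simp add: mult.assoc)
      also have "\<dots> \<approx> 0 * (PP a * VV m)" by (intro eqv_rmult rel_VV0 False)
      finally show ?thesis unfolding c by (intro red[of 0]) (auto simp: spanned_0)
    qed
  next
    case 2
    show ?thesis
    proof (cases "r e = u")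
      case True
      have "walk (s e) (e # a) m" using 2 True assms by simp
      from spanned_mon[OF this assms(2), of k] show ?thesis unfolding 2
        by (simp add: PP_Cons mult.assoc sc_left_commute)
    next
      case False
      have "letter g * (PP a * VV m) \<approx> DD e * (VV u * (PP a * VV m))"
        unfolding 2 by (rule eqv_sym, intro eqv_lmult VV_PP assms)
      also have "\<dots> = (DD e * VV u) * (PP a * VV m)" by (simp add: mult.assoc)
      also have "\<dots> \<approx> 0 * (PP a * VV m)" using False by (intro eqv_rmult rel_DV0) auto
      finally show ?thesis unfolding c by (intro red[of 0]) (auto simp: spanned_0)
    qed
  next
    case 3
    show ?thesis
    proof (cases a)
      case Nil
      show ?thesis
      proof (cases "m = s e")
        case True
        have w: "walk v (b @ [e]) (r e)" using assms 3 True by (auto simp: walk_append r_E0)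
        have "letter g * (PP a * VV m) \<approx> GG e" using Nil 3 True by (simp add: rel_GV1)
        also have "GG e \<approx> VV (r e) * GG e" by (rule eqv_sym, intro rel_VG1)
        finally have *: "letter g * (PP a * VV m) \<approx> VV (r e) * GG e" .
        have "spanned (sc k * (PP [] * (VV (r e) * QQ (b @ [e]))))"
          using spanned_mon[OF _ w, of "r e" "[]" k] 3 r_E0 by simp
        then show ?thesis unfolding c by (intro red[OF *]) (simp add: QQ_append QQ_Cons mult.assoc)
      next
        case False
        then have "letter g * (PP a * VV m) \<approx> 0" using Nil 3 by (simp add: rel_GV0 del: cg_0)
        then show ?thesis unfolding c by (intro red[of 0]) (auto simp: spanned_0)
      qed
    next
      case (Cons f a')
      have w: "f \<in> E1" "walk (r f) a' m" using assms Cons by auto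
      have l: "letter g * (PP a * VV m) = (GG e * DD f) * (PP a' * VV m)"
        using Cons 3 by (simp add: PP_Cons mult.assoc)
      show ?thesis
      proof (cases "e = f")
        case True
        have "(GG e * DD f) * (PP a' * VV m) \<approx> VV (r e) * (PP a' * VV m)"
          using True w by (intro eqv_rmult) (simp add: rel_GD1)
        also have "\<dots> \<approx> PP a' * VV m" using VV_PP w True by simp
        finally show ?thesis unfolding c
          by (intro red[of "PP a' * VV m"]) (use l spanned_mon[OF w(2) assms(2), of k] in \<open>simp_all add: mult.assoc\<close>)
      next
        case False
        have "(GG e * DD f) * (PP a' * VV m) \<approx> 0 * (PP a' * VV m)"
          by (intro eqv_rmult rel_GD0 False 3)
        then show ?thesis unfolding c by (intro red[of 0]) (use l in \<open>auto simp: spanned_0\<close>)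
      qed
    qed
  qed
qed

lemma spanned_letter: assumes "spanned x" shows "spanned (letter g * x)"
proof -
  from assms obtain y where y: "y \<in> addspan AllMon" "x \<approx> y" by (auto simp: spanned_def)
  from y(1) have "spanned (letter g * y)"
  proof induction
    case zero then show ?case by (simp add: spanned_0)
  next
    case (add x y)
    then show ?case
      by (auto simp: distrib_left AllMon_def Mon_def intro!: spanned_add spanned_letter_mon)
  qed
  then show ?thesis using spanned_eqv eqv_lmult y(2) by blast
qed

lemma spanned_single_letter: "spanned (sc k * letter g)"
proof (cases "g \<in> gens E0 E1")
  case False
  then show ?thesis by (intro spanned_NN lideal_lmult junk_letter) auto
next
  case True
  then consider w where "g = Vt w" "w \<in> E0" | e where "g = Ed e" "e \<in> E1" | e where "g = Gh e" "e \<in> E1"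
    by (auto simp: gens_def)
  then show ?thesis
  proof cases
    case 1
    then show ?thesis using spanned_mon[of w "[]" w w "[]" k] by simp
  next
    case 2
    have "sc k * letter g \<approx> sc k * (DD e * VV (r e))" unfolding 2 by (rule eqv_sym, intro eqv_lmult rel_DV1)
    then show ?thesis
      using spanned_mon[of "s e" "[e]" "r e" "r e" "[]" k] 2 r_E0
      by (auto intro: spanned_eqv simp: PP_Cons)
  next
    case 3
    have "sc k * letter g \<approx> sc k * (VV (r e) * GG e)" unfolding 3 by (rule eqv_sym, intro eqv_lmult rel_VG1)
    then show ?thesis
      using spanned_mon[of "r e" "[]" "r e" "s e" "[e]" k] 3 r_E0
      by (auto intro: spanned_eqv simp: QQ_Cons)
  qed
qed

lemma augm_spanned: "x \<in> augm \<Longrightarrow> spanned x"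
  by (induction rule: augm_induct) (auto intro: spanned_0 spanned_add spanned_letter spanned_single_letter)

text \<open>Multiplying by the two vertices keeps the monomials from \<open>u\<close> to
  \<open>v\<close> and kills the others; as there are finitely many, their ghost lengths have a
  common bound.\<close>

lemma corner_MonSpan: assumes "x \<in> augm" shows "\<exists>n. VV u * (x * VV v) \<in> MonSpan n u v"
proof -
  obtain y where y: "y \<in> addspan AllMon" "x \<approx> y" using augm_spanned[OF assms] by (auto simp: spanned_def)
  from y(1) have "\<exists>n. VV u * (y * VV v) \<in> MonSpan n u v"
  proof induction
    case zero then show ?case using MonSpan_0 by auto
  next
    case (add x y)
    then obtain n where n: "VV u * (y * VV v) \<in> MonSpan n u v" by blast
    from add(1) obtain k a b m u' v' where x: "x = sc k * (PP a * (VV m * QQ b))" "walk u' a m" "walk v' b m"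
      by (auto simp: AllMon_def Mon_def)
    have x1: "VV u * (x * VV v) \<approx> VV u * (x * (VV v' * VV v))"
      unfolding x(1) using eqv_lmult[OF eqv_rmult[OF eqv_sym[OF VV_QQ[OF x(3)]]], of "VV u * (sc k * PP a)" "VV v"]
      by (simp add: mult.assoc)
    have x2: "VV u * x \<approx> VV u * VV u' * x"
      using eqv_lmult[OF eqv_rmult[OF eqv_sym[OF VV_PP[OF x(2)]]], of "VV u * sc k" "QQ b"] x(1)
      by (simp add: mult.assoc sc_left_commute)
    have "VV u * (x * VV v) \<in> MonSpan (length b) u v"
    proof (cases "u = u' \<and> v = v'")
      case True
      have "VV u * x \<approx> x" unfolding x(1)
        using eqv_lmult[OF eqv_rmult[OF VV_PP[OF x(2)]], of "sc k" "QQ b"] True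
        by (simp add: mult.assoc sc_left_commute)
      then have "VV u * (x * VV v) \<approx> x * VV v" using eqv_rmult by (metis mult.assoc)
      also have "\<dots> \<approx> x" unfolding x(1)
        using eqv_lmult[OF VV_QQ[OF x(3)], of "sc k * PP a"] True by (simp add: mult.assoc)
      finally have "VV u * (x * VV v) \<approx> x" .
      moreover have "x \<in> Mon (length b) u v" unfolding x(1) using x(2,3) True by (intro MonI) auto
      ultimately show ?thesis using MonSpan_eqv MonSpan_mono_mem by blast
    next
      case False
      have "VV u * (x * VV v) \<approx> 0"
      proof (cases "u = u'")
        case True
        then have "VV v' * VV v \<approx> 0" using False by (intro rel_VV0) auto
        then have "VV u * (x * (VV v' * VV v)) \<approx> VV u * (x * 0)" by (intro eqv_lmult)
        then show ?thesis using x1 by (metis eqv_trans mult_zero_right)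
      next
        case False
        then have "VV u * VV u' * x \<approx> 0 * x" by (intro eqv_rmult rel_VV0)
        then have "VV u * x \<approx> 0" using x2 by (metis eqv_trans mult_zero_left)
        then have "VV u * x * VV v \<approx> 0 * VV v" by (intro eqv_rmult)
        then show ?thesis by (simp add: mult.assoc)
      qed
      then show ?thesis using MonSpan_eqv MonSpan_0 by blast
    qed
    then have "VV u * (x * VV v) + VV u * (y * VV v) \<in> MonSpan (max (length b) n) u v"
      using n MonSpan_mono[of "length b" "max (length b) n" u v] MonSpan_mono[of n "max (length b) n" u v]
      by (intro MonSpan_plus) auto
    then show ?case by (auto simp: algebra_simps)
  qed
  then show ?thesis using MonSpan_eqv eqv_ctx[OF y(2)] by blast
qed

text \<open>Each monomial is fixed by its two end vertices. Asking for every finite \<open>W\<close>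
  above \<open>U\<close> lets the induction merge the sets of two summands.\<close>

lemma local_unit: assumes "x \<in> augm"
  shows "\<exists>U. finite U \<and> (\<forall>W. finite W \<longrightarrow> U \<subseteq> W \<longrightarrow> sum VV W * x \<approx> x \<and> x * sum VV W \<approx> x)"
proof -
  have ul: "sum VV W * VV u \<approx> VV u" and ur: "VV u * sum VV W \<approx> VV u" if "finite W" "u \<in> W" for W u
  proof -
    have "(\<Sum>w\<in>W. VV w * VV u) \<approx> (\<Sum>w\<in>W. if w = u then VV w else 0)" by (intro eqv_sum rel_VV)
    then show "sum VV W * VV u \<approx> VV u" using that by (simp add: sum_distrib_right sum.delta)
    have "(\<Sum>w\<in>W. VV u * VV w) \<approx> (\<Sum>w\<in>W. if u = w then VV u else 0)" by (intro eqv_sum rel_VV)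
    then show "VV u * sum VV W \<approx> VV u" using that by (simp add: sum_distrib_left sum.delta')
  qed
  obtain y where y: "y \<in> addspan AllMon" "x \<approx> y" using augm_spanned[OF assms] by (auto simp: spanned_def)
  from y(1) have "\<exists>U. finite U \<and> (\<forall>W. finite W \<longrightarrow> U \<subseteq> W \<longrightarrow> sum VV W * y \<approx> y \<and> y * sum VV W \<approx> y)"
  proof induction
    case zero then show ?case by (intro exI[of _ "{}"]) (auto simp: lideal_0)
  next
    case (add x y)
    then obtain U where U: "finite U" "\<And>W. finite W \<Longrightarrow> U \<subseteq> W \<Longrightarrow> sum VV W * y \<approx> y \<and> y * sum VV W \<approx> y" by blast
    from add(1) obtain k a b m u v where x: "x = sc k * (PP a * (VV m * QQ b))" "walk u a m" "walk v b m"
      by (auto simp: AllMon_def Mon_def)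
    have ux: "VV u * x \<approx> x" unfolding x(1)
        using eqv_lmult[OF eqv_rmult[OF VV_PP[OF x(2)]], of "sc k" "QQ b"]
        by (simp add: mult.assoc sc_left_commute)
    have xv: "x * VV v \<approx> x" unfolding x(1)
        using eqv_lmult[OF VV_QQ[OF x(3)], of "sc k * PP a"] by (simp add: mult.assoc)
    have "sum VV W * (x + y) \<approx> x + y \<and> (x + y) * sum VV W \<approx> x + y"
      if W: "finite W" "insert u (insert v U) \<subseteq> W" for W
    proof -
      have "sum VV W * x \<approx> sum VV W * (VV u * x)" by (rule eqv_sym, intro eqv_lmult ux)
      also have "\<dots> = (sum VV W * VV u) * x" by (simp add: mult.assoc)
      also have "\<dots> \<approx> VV u * x" using W by (intro eqv_rmult ul) auto
      also have "\<dots> \<approx> x" by (rule ux)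
      finally have 1: "sum VV W * x \<approx> x" .
      have "x * sum VV W \<approx> (x * VV v) * sum VV W" by (rule eqv_sym, intro eqv_rmult xv)
      also have "\<dots> = x * (VV v * sum VV W)" by (simp add: mult.assoc)
      also have "\<dots> \<approx> x * VV v" using W by (intro eqv_lmult ur) auto
      also have "\<dots> \<approx> x" by (rule xv)
      finally have 2: "x * sum VV W \<approx> x" .
      show ?thesis using 1 2 U(2)[of W] W by (auto simp: distrib_left distrib_right intro!: eqv_add simp del: sum_distrib_left)
    qed
    then show ?case using U(1) by (intro exI[of _ "insert u (insert v U)"]) auto
  qed
  then obtain U where U: "finite U" "\<And>W. finite W \<Longrightarrow> U \<subseteq> W \<Longrightarrow> sum VV W * y \<approx> y \<and> y * sum VV W \<approx> y" by blast
  have "sum VV W * x \<approx> x \<and> x * sum VV W \<approx> x" if "finite W" "U \<subseteq> W" for W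
    using U(2)[OF that] y(2) eqv_sym[OF y(2)] eqv_lmult[OF y(2)] eqv_rmult[OF y(2)] by (meson eqv_trans)
  then show ?thesis using U(1) by blast
qed

text \<open>With a local unit \<open>sum VV U\<close> on both sides, \<open>x\<close> becomes a
  finite sum of its corners.\<close>

lemma lideal_mem_corners:
  assumes J: "lideal J" and x: "x \<in> augm" and c: "\<And>u v. VV u * (x * VV v) \<in> J"
  shows "x \<in> J"
proof -
  obtain U where U: "finite U" "sum VV U * x \<approx> x" "x * sum VV U \<approx> x" using local_unit[OF x] by blast
  have "sum VV U * (x * sum VV U) = (\<Sum>u\<in>U. \<Sum>v\<in>U. VV u * (x * VV v))"
    by (simp add: sum_distrib_right) (simp add: sum_distrib_left)
  also have "\<dots> \<in> J" by (intro lideal_sum J c)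
  finally have "sum VV U * (x * sum VV U) \<in> J" .
  moreover have "sum VV U * (x * sum VV U) \<approx> x" using eqv_lmult[OF U(3), of "sum VV U"] U(2) eqv_trans by blast
  ultimately show ?thesis using eqv_mem J by blast
qed

end

section \<open>Closed walks and cycles\<close>

context graph begin

lemma VV_walk: assumes "lideal I" "VV u \<in> I" "walk u p v" shows "VV v \<in> I"
proof -
  have "QQ p * (VV u * (PP p * VV v)) \<approx> QQ p * (PP p * VV v)" by (intro eqv_lmult VV_PP assms)
  also have "\<dots> \<approx> VV v" by (rule QQ_PP[OF assms(3)])
  finally show ?thesis using assms by (meson eqv_mem lideal_lmult lideal_rmult)
qed

lemma DD_mem_r: "lideal I \<Longrightarrow> VV (r e) \<in> I \<Longrightarrow> DD e \<in> I"
  using rel_DV1[of e] eqv_mem lideal_lmult by blast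
lemma VV_E0: "lideal I \<Longrightarrow> VV v \<notin> I \<Longrightarrow> v \<in> E0"
  using junk_VV NN_least by blast

text \<open>Since \<open>g @ p\<close> is longer than \<open>p\<close>, the two are comparable only
  if \<open>p\<close> is the prefix. Then the ghost of \<open>p\<close> cancels and a closed walk at
  \<open>w\<close> remains; otherwise the product is zero.\<close>

lemma QQ_PP_shift:
  assumes "walk v p w" "walk v g v" "g \<noteq> []"
  shows "(\<exists>d. g @ p = p @ d \<and> walk w d w \<and> d \<noteq> [] \<and> QQ p * (PP (g @ p) * VV w) \<approx> PP d * VV w) \<or>
     (\<not> prefix p (g @ p) \<and> QQ p * (PP (g @ p) * VV w) \<approx> 0)"
proof (cases "prefix p (g @ p)")
  case True
  then obtain d where d: "g @ p = p @ d" by (auto simp: prefix_def)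
  have w: "walk v (g @ p) w" using assms by (auto simp: walk_append)
  then have "walk w d w" unfolding d using assms(1) walk_end_unique by (auto simp: walk_append)
  moreover have "d \<noteq> []" using d assms(3) by (metis append_self_conv2 append_same_eq self_append_conv)
  ultimately show ?thesis using d QQ_PP_ext[OF assms(1)] by auto
next
  case False
  have "\<not> prefix (g @ p) p" using assms(3) by (auto dest: prefix_length_le)
  moreover have "walk v (g @ p) w" using assms by (auto simp: walk_append)
  ultimately show ?thesis using QQ_PP_incomp[OF assms(1) _ False] False by blast
qed

definition closed_sum :: "'v \<Rightarrow> 'e list set \<Rightarrow> ('e list \<Rightarrow> 'k) \<Rightarrow> ('v, 'e, 'k) fa" where
  "closed_sum v \<Gamma> b = VV v + (\<Sum>g\<in>\<Gamma>. sc (b g) * (PP g * VV v))"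

lemma closed_sum_conj:
  assumes "\<And>g. g \<in> \<Gamma> \<Longrightarrow> walk v g v" "walk v p w"
  shows "QQ p * (closed_sum v \<Gamma> b * (PP p * VV w)) \<approx> VV w + (\<Sum>g\<in>\<Gamma>. sc (b g) * (QQ p * (PP (g @ p) * VV w)))"
proof -
  have 1: "QQ p * (VV v * (PP p * VV w)) \<approx> VV w"
    using eqv_trans[OF eqv_lmult[OF VV_PP[OF assms(2)]] QQ_PP[OF assms(2)]] .
  have 2: "QQ p * (sc (b g) * (PP g * (VV v * (PP p * VV w)))) \<approx> sc (b g) * (QQ p * (PP (g @ p) * VV w))" for g
    using eqv_lmult[OF VV_PP[OF assms(2)], of "QQ p * (sc (b g) * PP g)"]
    by (simp add: sc_left_commute PP_append mult.assoc)
  have "QQ p * (closed_sum v \<Gamma> b * (PP p * VV w)) = QQ p * (VV v * (PP p * VV w)) +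
      (\<Sum>g\<in>\<Gamma>. QQ p * (sc (b g) * (PP g * (VV v * (PP p * VV w)))))"
    by (simp add: closed_sum_def distrib_left distrib_right sum_distrib_right mult.assoc) (simp add: sum_distrib_left)
  also have "\<dots> \<approx> VV w + (\<Sum>g\<in>\<Gamma>. sc (b g) * (QQ p * (PP (g @ p) * VV w)))"
    by (intro eqv_add eqv_sum 1 2)
  finally show ?thesis .
qed

lemma walk_is_path: "walk u p v \<Longrightarrow> p \<noteq> [] \<Longrightarrow> is_path E1 r s p \<and> s (hd p) = u \<and> r (last p) = v"
proof (induction u p v rule: walk.induct)
  case (2 u e p v)
  show ?case
  proof (cases p)
    case Nil then show ?thesis using 2 by (auto simp: is_path_def)
  next
    case (Cons f q)
    then have p: "is_path E1 r s p" "s (hd p) = r e" "r (last p) = v" using 2 by auto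
    have "is_path E1 r s (e # p)" unfolding is_path_def
    proof (intro conjI allI impI)
      fix i assume "Suc i < length (e # p)"
      then show "r ((e # p) ! i) = s ((e # p) ! Suc i)"
        using p Cons by (cases i) (auto simp: is_path_def)
    qed (use 2 p in \<open>auto simp: is_path_def\<close>)
    then show ?thesis using 2 p Cons by auto
  qed
qed simp

lemma is_path_walk: "is_path E1 r s p \<Longrightarrow> walk (s (hd p)) p (r (last p))"
proof (induction p)
  case (Cons e p)
  show ?case
  proof (cases p)
    case Nil then show ?thesis using Cons.prems r_E0 by (auto simp: is_path_def)
  next
    case (Cons f q)
    have "is_path E1 r s p" unfolding is_path_def
    proof (intro conjI allI impI)
      fix i assume "Suc i < length p"
      then show "r (p ! i) = s (p ! Suc i)" using Cons.prems by (auto simp: is_path_def)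
    qed (use Cons.prems Cons in \<open>auto simp: is_path_def\<close>)
    moreover have "r e = s (hd p)" using Cons.prems Cons by (auto simp: is_path_def hd_conv_nth dest: spec[of _ 0])
    ultimately show ?thesis using Cons.IH Cons.prems Cons by (auto simp: is_path_def)
  qed
qed (simp add: is_path_def)

lemma walk_take_nth:
  assumes "walk u p v" "i < length p"
  shows "walk u (take i p) (s (p ! i))" "walk (s (p ! i)) (drop i p) v" "p ! i \<in> E1"
    "walk (r (p ! i)) (drop (Suc i) p) v"
proof -
  have p: "p = take i p @ drop i p" "drop i p = p ! i # drop (Suc i) p" using assms(2) by (simp_all add: Cons_nth_drop_Suc)
  obtain w where w: "walk u (take i p) w" "walk w (drop i p) v" using assms(1) p(1) walk_append by metis
  have "w = s (p ! i)" "p ! i \<in> E1" "walk (r (p ! i)) (drop (Suc i) p) v" using w(2) p(2) by auto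
  then show "walk u (take i p) (s (p ! i))" "walk (s (p ! i)) (drop i p) v" "p ! i \<in> E1"
    "walk (r (p ! i)) (drop (Suc i) p) v" using w by auto
qed

text \<open>Having all exits end in vertices of \<open>I\<close> would not be enough at an infinite
  emitter: the condition on \<open>DD e * GG e\<close> also puts the element \<open>v^H\<close> into
  \<open>I\<close>.\<close>

definition proper_exitless :: "('v, 'e, 'k) fa set \<Rightarrow> 'e list \<Rightarrow> bool" where
  "proper_exitless I c \<longleftrightarrow> is_cycle E1 r s c \<and> VV (s (hd c)) \<notin> I \<and> (\<forall>e\<in>set c. VV (s e) - DD e * GG e \<in> I)"

abbreviation rep :: "nat \<Rightarrow> 'e list \<Rightarrow> 'e list" where "rep k p \<equiv> concat (replicate k p)"

lemma length_rep: "length (rep k p) = k * length p" by (induction k) auto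

lemma nth_rep: "j < k * length p \<Longrightarrow> rep k p ! j = p ! (j mod length p)"
proof (induction k arbitrary: j)
  case (Suc k)
  show ?case
  proof (cases "j < length p")
    case False
    then show ?thesis using Suc.IH[of "j - length p"] Suc.prems by (simp add: nth_append le_mod_geq)
  qed (simp add: nth_append)
qed simp

lemma walk_rep: "walk v p v \<Longrightarrow> walk v (rep k p) v"
  by (induction k) (auto simp: walk_append dest: walk_E0)

text \<open>The word has the two periods \<open>length g\<close> and \<open>length h\<close>; its last letter is traced back by the second
  period, then by the first one, and forward again by the second one.\<close>

lemma period_exit:
  fixes M :: nat
  assumes g: "g \<noteq> []" "i < length g" and h: "h \<noteq> []" "length h \<le> M"
    and p: "prefix (rep (Suc M) g @ take i g @ [f]) (h @ rep (Suc M) g @ take i g @ [f])"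
  shows "f = g ! i"
proof -
  define n where "n = length g"
  define q where "q = rep (Suc M) g @ take i g"
  define l where "l = length h"
  have n: "n > 0" "i < n" using g by (auto simp: n_def)
  have lq: "length q = Suc M * n + i" using n by (simp add: q_def length_rep n_def)
  have W: "q ! j = g ! (j mod n)" if "j < length q" for j
  proof (cases "j < Suc M * n")
    case True
    have "q ! j = rep (Suc M) g ! j"
      unfolding q_def nth_append length_rep using True n_def by (metis (full_types))
    then show ?thesis using nth_rep[of j "Suc M" g] True unfolding n_def by presburger
  next
    case False
    define d where "d = j - Suc M * n"
    have d: "j = d + Suc M * n" "d < i" using False that lq by (simp_all add: d_def)
    have "j mod n = d" using d n by (simp only: d(1) mod_mult_self1) simp
    moreover have "q ! j = take i g ! d"
      unfolding q_def nth_append length_rep n_def[symmetric] using d(1) by simp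
    ultimately show ?thesis using d by simp
  qed
  \<comment> \<open>The period of \<open>h\<close> reaches up to the last letter \<open>f\<close>,
    whereas that of \<open>g\<close> is known only on \<open>q\<close>.\<close>
  have per: "(q @ [f]) ! j = (q @ [f]) ! (j - l)" if "l \<le> j" "j \<le> length q" for j
  proof -
    have "prefix (q @ [f]) (h @ (q @ [f]))" using p by (simp add: q_def)
    then obtain d where "h @ (q @ [f]) = (q @ [f]) @ d" by (auto simp: prefix_def)
    then have "(q @ [f]) ! j = (h @ (q @ [f])) ! j" using that by (metis le_imp_less_Suc length_append_singleton nth_append)
    then show ?thesis using that by (simp add: nth_append l_def)
  qed
  \<comment> \<open>This is what the \<open>Suc M\<close> copies of \<open>g\<close> are for: one
    copy makes room for the period of \<open>g\<close>, the other \<open>M\<close> for the period of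
    \<open>h\<close>.\<close>
  have l: "l > 0" "l + n \<le> length q"
  proof -
    show "l > 0" using h by (simp add: l_def)
    have "M \<le> M * n" using n by (cases n) auto
    then have "length h \<le> M * n" using h by linarith
    then show "l + n \<le> length q" using h by (simp add: lq l_def)
  qed
  have lt: "length q - l < length q" "length q - n < length q" "length q - n - l < length q"
    using l n by linarith+
  have mn: "(j - n) mod n = j mod n" if "n \<le> j" for j :: nat using that le_mod_geq by simp
  have "f = (q @ [f]) ! length q" by simp
  also have "\<dots> = (q @ [f]) ! (length q - l)" using l n by (intro per) auto
  also have "\<dots> = q ! (length q - l)" using l n lt by (simp add: nth_append)
  also have "\<dots> = g ! ((length q - l) mod n)" using l n by (intro W) auto
  also have "(length q - l) mod n = (length q - n - l) mod n"
    using mn[of "length q - l"] l by (simp add: add.commute)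
  also have "g ! \<dots> = q ! (length q - n - l)" using l n by (intro W[symmetric]) auto
  also have "\<dots> = (q @ [f]) ! (length q - n - l)" using l n lt by (simp add: nth_append)
  also have "\<dots> = (q @ [f]) ! (length q - n)" using l n by (intro per[symmetric]) auto
  also have "\<dots> = q ! (length q - n)" using l n lt by (simp add: nth_append)
  also have "\<dots> = g ! ((length q - n) mod n)" using l n by (intro W) auto
  also have "(length q - n) mod n = i" using mn[of "length q"] l n lq by simp
  finally show ?thesis .
qed

text \<open>The cycle is the part of \<open>g\<close> up to its first return to \<open>v\<close>. If
  a source occurred at positions i < j before that, unique continuation would make the walk from i
  copy the walk from j and so return to \<open>v\<close> at i + (m - j) < m.\<close>

lemma first_return_cycle:
  assumes g: "walk v g v" "g \<noteq> []"
    and uniq: "\<And>i f. i < length g \<Longrightarrow> f \<in> E1 \<Longrightarrow> s f = s (g ! i) \<Longrightarrow> VV (r f) \<notin> I \<Longrightarrow> f = g ! i"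
    and out: "\<And>i. i < length g \<Longrightarrow> VV (r (g ! i)) \<notin> I"
  shows "\<exists>m. is_cycle E1 r s (take m g) \<and> s (hd (take m g)) = v \<and> take m g \<noteq> []"
proof -
  define n where "n = length g"
  define Q where "Q m \<longleftrightarrow> 0 < m \<and> m \<le> n \<and> walk v (take m g) v" for m
  define m where "m = (LEAST m. Q m)"
  have "Q n" using g by (auto simp: Q_def n_def)
  then have Qm: "Q m" unfolding m_def by (rule LeastI)
  have least: "\<not> Q k" if "k < m" for k using that not_less_Least m_def by auto
  define c where "c = take m g"
  have c: "c \<noteq> []" "walk v c v" "length c = m" using Qm g by (auto simp: Q_def c_def n_def)
  have ip: "is_path E1 r s c" "s (hd c) = v" "r (last c) = v" using walk_is_path[OF c(2,1)] by auto
  \<comment> \<open>The vertex reached after \<open>k\<close> edges; for \<open>k = n\<close> the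
    edge \<open>g ! k\<close> does not exist and the walk is back at \<open>v\<close>.\<close>
  define pos where "pos k = (if k < n then s (g ! k) else v)" for k
  have wk: "walk v (take k g) (pos k)" if "k \<le> n" for k
    using that walk_take_nth(1)[OF g(1), of k] g(1) by (auto simp: pos_def n_def)
  have pos_Suc: "pos (Suc k) = r (g ! k)" if "k < n" for k
  proof -
    have "walk v (take k g @ [g ! k]) (pos (Suc k))" using wk[of "Suc k"] that by (simp add: take_Suc_conv_app_nth n_def)
    then show ?thesis by (auto simp: walk_append)
  qed
  have "distinct (map s c)"
  proof (rule ccontr)
    assume "\<not> distinct (map s c)"
    then obtain i j where ij: "i < j" "j < m" "s (g ! i) = s (g ! j)"
      using c(3) by (auto simp: distinct_conv_nth c_def nat_neq_iff)
    have mn: "m \<le> n" using Qm by (simp add: Q_def)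
    have "j + t \<le> m \<Longrightarrow> pos (i + t) = pos (j + t)" for t
    proof (induction t)
      case 0 then show ?case using ij mn by (simp add: pos_def)
    next
      case (Suc t)
      then have "s (g ! (i + t)) = s (g ! (j + t))" using ij mn by (simp add: pos_def)
      then have "g ! (j + t) = g ! (i + t)"
        using Suc.prems ij mn walk_take_nth(3)[OF g(1), of "j + t"]
        by (intro uniq out) (auto simp: n_def)
      then show ?case using pos_Suc[of "i + t"] pos_Suc[of "j + t"] Suc.prems ij mn by simp
    qed
    from this[of "m - j"] have "pos (i + (m - j)) = pos m" using ij by simp
    moreover have "pos m = v" using wk[of m] c(2) walk_end_unique mn by (auto simp: c_def)
    ultimately have "walk v (take (i + (m - j)) g) v" using wk[of "i + (m - j)"] ij mn by simp
    then have "Q (i + (m - j))" using ij mn by (simp add: Q_def)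
    moreover have "i + (m - j) < m" using ij by linarith
    ultimately show False using least by blast
  qed
  then have "is_cycle E1 r s c" using ip by (simp add: is_cycle_def)
  then show ?thesis using ip c unfolding c_def by blast
qed

lemma nu_DD: assumes "e \<in> E1" shows "(VV (s e) - DD e * GG e) * DD e \<approx> 0"
proof -
  have "DD e * (GG e * DD e) \<approx> DD e * VV (r e)" using assms by (intro eqv_lmult rel_GD1)
  also have "\<dots> \<approx> DD e" by (rule rel_DV1)
  finally have "VV (s e) * DD e - DD e * (GG e * DD e) \<approx> DD e - DD e" by (intro eqv_diff rel_VD1)
  then show ?thesis by (simp add: algebra_simps)
qed

text \<open>Two tests are applied to \<open>closed_sum\<close>. Conjugating by a path that runs
  round a closed walk and then deviates shows that no edge outside that walk avoids
  \<open>I\<close>. Conjugating to a vertex of the cycle and multiplying by \<open>u\<close> puts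
  the elements \<open>VV (s e) - DD e * GG e\<close> into \<open>I\<close>, also at infinite
  emitters.\<close>

lemma closed_sum_proper_exitless:
  assumes I: "lideal I" and \<Gamma>: "finite \<Gamma>" "\<And>g. g \<in> \<Gamma> \<Longrightarrow> g \<noteq> [] \<and> walk v g v"
    and y: "closed_sum v \<Gamma> b \<in> I" and v: "VV v \<notin> I"
  shows "\<exists>c. proper_exitless I c \<and> s (hd c) = v"
proof -
  have conj: "VV w + (\<Sum>g\<in>\<Gamma>. sc (b g) * (QQ p * (PP (g @ p) * VV w))) \<in> I" if "walk v p w" for p w
    using eqv_mem[OF I closed_sum_conj[OF _ that, of \<Gamma> b]] \<Gamma>(2) y lideal_lmult[OF I lideal_rmult[OF I y]] by blast
  \<comment> \<open>Otherwise conjugation by \<open>p\<close> kills every term except \<open>w\<close>.\<close>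
  have per: "\<exists>g\<in>\<Gamma>. prefix p (g @ p)" if p: "walk v p w" "VV w \<notin> I" for p w
  proof (rule ccontr)
    assume "\<not> ?thesis"
    then have "sc (b g) * (QQ p * (PP (g @ p) * VV w)) \<in> I" if "g \<in> \<Gamma>" for g
      using QQ_PP_shift[OF p(1)] \<Gamma>(2)[OF that] that I by (metis cg_0 eqv_mem lideal_0 lideal_lmult prefixI)
    then have "(\<Sum>g\<in>\<Gamma>. sc (b g) * (QQ p * (PP (g @ p) * VV w))) \<in> I" by (intro lideal_sum I)
    then show False using conj[OF p(1)] p(2) lideal_diff[OF I] by fastforce
  qed
  have v0: "v \<in> E0" using VV_E0 I v by blast
  obtain g where g: "g \<in> \<Gamma>" using per[of "[]" v] v v0 by auto
  have gw: "walk v g v" "g \<noteq> []" using \<Gamma>(2) g by auto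
  define M where "M = Max (length ` \<Gamma>)"
  have out: "VV w \<notin> I" if "walk w p v" for w p using VV_walk[OF I _ that] v by blast
  have uniq: "f = g ! i" if f: "i < length g" "f \<in> E1" "s f = s (g ! i)" "VV (r f) \<notin> I" for i f
  proof -
    \<comment> \<open>The path goes round \<open>g\<close> more often than the longest member of
      \<Gamma> is long and then leaves along \<open>f\<close>; \<open>per\<close> gives it a second
      period, and \<open>period_exit\<close> forces \<open>f\<close> back onto
      \<open>g\<close>.\<close>
    define p where "p = rep (Suc M) g @ take i g @ [f]"
    have "walk v p (r f)" unfolding p_def
      using walk_rep[OF gw(1), of "Suc M"] walk_take_nth(1)[OF gw(1) f(1)] f r_E0
      by (auto simp: walk_append simp del: replicate.simps)
    then obtain h where h: "h \<in> \<Gamma>" "prefix p (h @ p)" using per f(4) by blast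
    have "length h \<le> M" using h \<Gamma>(1) by (simp add: M_def)
    then show ?thesis using period_exit[OF gw(2) f(1), of h M f] h \<Gamma>(2) unfolding p_def by auto
  qed
  obtain m where m: "is_cycle E1 r s (take m g)" "s (hd (take m g)) = v" "take m g \<noteq> []"
    using first_return_cycle[OF gw uniq] walk_take_nth(4)[OF gw(1)] out by blast
  have "VV (s e) - DD e * GG e \<in> I" if em: "e \<in> set (take m g)" for e
  proof -
    obtain i where i: "i < length g" "e = g ! i" using in_set_takeD[OF em] by (auto simp: in_set_conv_nth)
    define w where "w = s e"
    define p where "p = take i g"
    have p: "walk v p w" and e: "e \<in> E1" and wv: "walk w (drop i g) v"
      using walk_take_nth[OF gw(1) i(1)] i by (auto simp: p_def w_def)
    have wI: "VV w \<notin> I" using out wv by blast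
    \<comment> \<open>\<open>u\<close> kills \<open>e\<close>, and by \<open>uniq\<close> every
      closed walk at \<open>w\<close> starts with \<open>e\<close>. Multiplying the conjugated sum
      by \<open>u\<close> therefore leaves only \<open>u * VV w\<close>.\<close>
    define u where "u = VV w - DD e * GG e"
    have "u * (sc (b h) * (QQ p * (PP (h @ p) * VV w))) \<in> I" if h: "h \<in> \<Gamma>" for h
    proof -
      have "QQ p * (PP (h @ p) * VV w) \<approx> 0 \<or> (\<exists>d. walk w d w \<and> d \<noteq> [] \<and> QQ p * (PP (h @ p) * VV w) \<approx> PP d * VV w)"
        using QQ_PP_shift[OF p] \<Gamma>(2)[OF h] by blast
      then have "u * (QQ p * (PP (h @ p) * VV w)) \<in> I"
      proof
        assume "QQ p * (PP (h @ p) * VV w) \<approx> 0"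
        then show ?thesis using I by (meson cg_0 eqv_mem lideal_0 lideal_lmult)
      next
        assume "\<exists>d. walk w d w \<and> d \<noteq> [] \<and> QQ p * (PP (h @ p) * VV w) \<approx> PP d * VV w"
        then obtain d where d: "walk w d w" "d \<noteq> []" "QQ p * (PP (h @ p) * VV w) \<approx> PP d * VV w" by blast
        obtain f d' where d': "d = f # d'" using d(2) by (cases d) auto
        then have f: "f \<in> E1" "s f = w" "walk (r f) d' w" using d(1) by auto
        have "VV (r f) \<notin> I" using VV_walk[OF I _ f(3)] wI by blast
        then have fe: "f = e" using uniq[OF i(1), of f] f i(2) w_def by auto
        have "u * (PP d * VV w) = ((VV (s e) - DD e * GG e) * DD e) * (PP d' * VV w)"
          by (simp add: u_def w_def d' fe PP_Cons mult.assoc)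
        also have "\<dots> \<approx> 0 * (PP d' * VV w)" by (intro eqv_rmult nu_DD e)
        finally have "u * (PP d * VV w) \<approx> 0" by simp
        then have "u * (QQ p * (PP (h @ p) * VV w)) \<approx> 0" using eqv_lmult[OF d(3), of u] eqv_trans by blast
        then show ?thesis using I by (simp add: subsetD[OF NN_least])
      qed
      then show ?thesis by (simp add: sc_left_commute lideal_lmult[OF I])
    qed
    then have "(\<Sum>h\<in>\<Gamma>. u * (sc (b h) * (QQ p * (PP (h @ p) * VV w)))) \<in> I" by (intro lideal_sum I)
    moreover have "u * (VV w + (\<Sum>h\<in>\<Gamma>. sc (b h) * (QQ p * (PP (h @ p) * VV w)))) \<in> I"
      using conj[OF p] lideal_lmult I by blast
    ultimately have "u * VV w \<in> I" using lideal_diff[OF I] by (fastforce simp: distrib_left sum_distrib_left)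
    moreover have "u * VV w \<approx> u"
    proof -
      have "VV w * VV w - DD e * (GG e * VV w) \<approx> VV w - DD e * GG e"
        unfolding w_def by (intro eqv_diff eqv_lmult rel_VV1 rel_GV1)
      then show ?thesis by (simp add: u_def algebra_simps)
    qed
    ultimately show ?thesis using eqv_mem I u_def w_def by blast
  qed
  then show ?thesis using m v unfolding proper_exitless_def by blast
qed

text \<open>\<open>a1\<close> is a path of minimal length in \<open>A\<close>. No other path is then
  a proper prefix of it, so its ghost kills everything except the extensions of \<open>a1\<close>,
  each of which leaves a closed walk at \<open>v\<close>. The last equation lets this part of the
  sum be split off.\<close>

lemma closed_sum_lead:
  assumes A: "finite A" "A \<noteq> {}" "\<And>a. a \<in> A \<Longrightarrow> walk u a v \<and> c a \<noteq> 0"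
  defines "z \<equiv> \<Sum>a\<in>A. sc (c a) * (PP a * VV v)"
  shows "\<exists>a1\<in>A. \<exists>\<Gamma> b. finite \<Gamma> \<and> (\<forall>g\<in>\<Gamma>. g \<noteq> [] \<and> walk v g v) \<and> QQ a1 * z \<approx> sc (c a1) * closed_sum v \<Gamma> b \<and>
    sc (c a1) * (PP a1 * closed_sum v \<Gamma> b) = (\<Sum>a\<in>{a\<in>A. prefix a1 a}. sc (c a) * (PP a * VV v))"
proof -
  obtain a1 where a1: "a1 \<in> A" "\<And>a. a \<in> A \<Longrightarrow> length a1 \<le> length a"
    using ex_min_if_finite[of "length ` A"] A(1,2) by (metis (no_types, lifting) arg_min_on_def arg_min_if_finite(1) arg_min_least)
  define \<Gamma> where "\<Gamma> = {g. g \<noteq> [] \<and> a1 @ g \<in> A}"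
  define b where "b g = c (a1 @ g) / c a1" for g
  have inj: "inj_on (\<lambda>g. a1 @ g) X" for X by (auto simp: inj_on_def)
  have fin: "finite \<Gamma>" by (rule inj_on_finite[OF inj _ A(1)]) (auto simp: \<Gamma>_def)
  have wA: "walk u a1 v" "c a1 \<noteq> 0" using A(3) a1 by auto
  have w\<Gamma>: "g \<noteq> [] \<and> walk v g v" if "g \<in> \<Gamma>" for g
  proof -
    have "walk u (a1 @ g) v" using that A(3) by (auto simp: \<Gamma>_def)
    then show ?thesis using that walk_end_unique[OF wA(1)] by (auto simp: walk_append \<Gamma>_def)
  qed
  have part: "{a \<in> A. prefix a1 a} = insert a1 ((\<lambda>g. a1 @ g) ` \<Gamma>)"
  proof (intro equalityI subsetI)
    fix a assume "a \<in> {a \<in> A. prefix a1 a}"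
    then obtain g where "a = a1 @ g" "a \<in> A" by (auto simp: prefix_def)
    then show "a \<in> insert a1 ((\<lambda>g. a1 @ g) ` \<Gamma>)" by (cases "g = []") (auto simp: \<Gamma>_def)
  qed (use a1 in \<open>auto simp: \<Gamma>_def\<close>)
  have notin: "a1 \<notin> (\<lambda>g. a1 @ g) ` \<Gamma>" by (auto simp: \<Gamma>_def)
  have split: "(\<Sum>a\<in>{a\<in>A. prefix a1 a}. F a) = F a1 + (\<Sum>g\<in>\<Gamma>. F (a1 @ g))" for F :: "'e list \<Rightarrow> ('v,'e,'k) fa"
    unfolding part using fin notin by (simp add: sum.reindex[OF inj])
  have sb: "sc (c a1) * (sc (b g) * x) = sc (c (a1 @ g)) * x" for g and x :: "('v,'e,'k) fa"
    using wA(2) by (simp add: mult.assoc[symmetric] sc_mult[symmetric] b_def)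
  have "sc (c a1) * (PP a1 * closed_sum v \<Gamma> b) = (\<Sum>a\<in>{a\<in>A. prefix a1 a}. sc (c a) * (PP a * VV v))"
  proof -
    have "PP a1 * closed_sum v \<Gamma> b = PP a1 * VV v + (\<Sum>g\<in>\<Gamma>. sc (b g) * (PP (a1 @ g) * VV v))"
      by (simp add: closed_sum_def distrib_left sum_distrib_left sc_left_commute PP_append mult.assoc)
    then show ?thesis unfolding split by (simp add: distrib_left sum_distrib_left sb)
  qed
  moreover have "QQ a1 * z \<approx> sc (c a1) * closed_sum v \<Gamma> b"
  proof -
    have "QQ a1 * z = (\<Sum>a\<in>A. sc (c a) * (QQ a1 * (PP a * VV v)))"
      by (simp add: z_def sum_distrib_left sc_left_commute)
    also have "\<dots> \<approx> (\<Sum>a\<in>A. if prefix a1 a then sc (c a) * (QQ a1 * (PP a * VV v)) else 0)"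
    proof (intro eqv_sum)
      fix a assume a: "a \<in> A"
      show "sc (c a) * (QQ a1 * (PP a * VV v)) \<approx> (if prefix a1 a then sc (c a) * (QQ a1 * (PP a * VV v)) else 0)"
      proof (cases "prefix a1 a")
        case False
        have "\<not> prefix a a1" using False a1(2)[OF a] prefix_length_le
          by (metis append_Nil2 append_eq_conv_conj dual_order.antisym prefix_def take_all)
        then have "QQ a1 * (PP a * VV v) \<approx> 0" using QQ_PP_incomp wA A(3)[OF a] False by blast
        then have "sc (c a) * (QQ a1 * (PP a * VV v)) \<approx> sc (c a) * 0" by (rule eqv_lmult)
        then show ?thesis using False by simp
      qed simp
    qed
    also have "\<dots> = (\<Sum>a\<in>{a\<in>A. prefix a1 a}. sc (c a) * (QQ a1 * (PP a * VV v)))"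
      by (simp add: sum.inter_filter[OF A(1)])
    also have "\<dots> = sc (c a1) * (QQ a1 * (PP a1 * VV v)) + (\<Sum>g\<in>\<Gamma>. sc (c (a1 @ g)) * (QQ a1 * (PP (a1 @ g) * VV v)))"
      by (rule split)
    also have "\<dots> \<approx> sc (c a1) * VV v + (\<Sum>g\<in>\<Gamma>. sc (c (a1 @ g)) * (PP g * VV v))"
      using wA w\<Gamma> by (intro eqv_add eqv_sum eqv_lmult QQ_PP QQ_PP_ext) auto
    also have "\<dots> = sc (c a1) * closed_sum v \<Gamma> b" by (simp add: closed_sum_def distrib_left sum_distrib_left sb)
    finally show ?thesis .
  qed
  ultimately show ?thesis using a1 fin w\<Gamma> by blast
qed

lemma closed_sum_corner: assumes "\<And>g. g \<in> \<Gamma> \<Longrightarrow> walk v g v"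
  shows "VV v * (closed_sum v \<Gamma> b * VV v) \<approx> closed_sum v \<Gamma> b"
proof -
  have 1: "VV v * (VV v * VV v) \<approx> VV v" using eqv_trans[OF eqv_lmult[OF rel_VV1] rel_VV1] .
  have 2: "sc (b g) * (VV v * (PP g * (VV v * VV v))) \<approx> sc (b g) * (PP g * VV v)" if "g \<in> \<Gamma>" for g
  proof (rule eqv_lmult)
    have "VV v * (PP g * (VV v * VV v)) \<approx> VV v * (PP g * VV v)" by (intro eqv_lmult rel_VV1)
    also have "\<dots> \<approx> PP g * VV v" by (intro VV_PP assms that)
    finally show "VV v * (PP g * (VV v * VV v)) \<approx> PP g * VV v" .
  qed
  have "VV v * (closed_sum v \<Gamma> b * VV v) = VV v * (VV v * VV v) + (\<Sum>g\<in>\<Gamma>. sc (b g) * (VV v * (PP g * (VV v * VV v))))"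
    by (simp add: closed_sum_def distrib_left distrib_right sum_distrib_right mult.assoc)
       (simp add: sum_distrib_left sc_left_commute)
  also have "\<dots> \<approx> closed_sum v \<Gamma> b" unfolding closed_sum_def by (intro eqv_add eqv_sum 1 2)
  finally show ?thesis .
qed

text \<open>\<open>nu v F\<close> is the element \<open>v\<^sup>H\<close> when \<open>F\<close> is the set of edges from \<open>v\<close> with range outside \<open>H\<close>.\<close>

definition nu :: "'v \<Rightarrow> 'e set \<Rightarrow> ('v, 'e, 'k) fa" where
  "nu v F = VV v - (\<Sum>e\<in>F. DD e * GG e)"

lemma nu_VV: assumes "F \<subseteq> out v" shows "nu v F * VV v \<approx> nu v F" "VV v * nu v F \<approx> nu v F"
proof -
  have "VV v * VV v - (\<Sum>e\<in>F. DD e * (GG e * VV v)) \<approx> nu v F"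
    unfolding nu_def using assms by (intro eqv_diff eqv_sum eqv_lmult rel_VV1) (use rel_GV1 in \<open>auto simp: out_def\<close>)
  then show "nu v F * VV v \<approx> nu v F" by (simp add: nu_def left_diff_distrib sum_distrib_right mult.assoc)
  have "VV v * VV v - (\<Sum>e\<in>F. (VV v * DD e) * GG e) \<approx> nu v F"
    unfolding nu_def using assms by (intro eqv_diff eqv_sum eqv_rmult rel_VV1) (use rel_VD1 in \<open>auto simp: out_def\<close>)
  then show "VV v * nu v F \<approx> nu v F" by (simp add: nu_def right_diff_distrib sum_distrib_left mult.assoc)
qed

lemma nu_DD_gen: assumes "finite F" "F \<subseteq> out v" "f \<in> out v"
  shows "nu v F * DD f \<approx> (if f \<in> F then 0 else DD f)"
proof -
  have "VV v * DD f - (\<Sum>e\<in>F. DD e * (GG e * DD f)) \<approx> DD f - (\<Sum>e\<in>F. if e = f then DD f else 0)"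
  proof (intro eqv_diff eqv_sum)
    show "VV v * DD f \<approx> DD f" using assms(3) rel_VD1[of f] by (auto simp: out_def)
    fix e assume e: "e \<in> F"
    have "DD e * (GG e * DD f) \<approx> DD e * (if e = f then VV (r e) else 0)"
      using e assms by (intro eqv_lmult rel_GD) (auto simp: out_def)
    also have "\<dots> \<approx> (if e = f then DD f else 0)" using rel_DV1[of e] by (auto simp: lideal_0)
    finally show "DD e * (GG e * DD f) \<approx> (if e = f then DD f else 0)" .
  qed
  then show ?thesis using assms(1) by (simp add: nu_def left_diff_distrib sum_distrib_right mult.assoc sum.delta split: if_splits)
qed

text \<open>\<open>nu v F\<close> kills the edges of \<open>F\<close> and is fixed by
  \<open>VV v\<close>, hence it is fixed by \<open>VV v\<close> minus the terms through
  \<open>F\<close>.\<close>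

lemma nu_idem: assumes "finite F" "F \<subseteq> out v" shows "nu v F * nu v F \<approx> nu v F"
proof -
  have "nu v F * nu v F = nu v F * VV v - (\<Sum>e\<in>F. (nu v F * DD e) * GG e)"
    by (subst (2) nu_def) (simp add: right_diff_distrib sum_distrib_left mult.assoc)
  also have "\<dots> \<approx> nu v F - (\<Sum>e\<in>F. 0 * GG e)"
  proof (intro eqv_diff eqv_sum eqv_rmult nu_VV assms)
    fix e assume "e \<in> F"
    then show "nu v F * DD e \<approx> 0" using nu_DD_gen[OF assms, of e] assms(2) by auto
  qed
  finally show ?thesis by simp
qed

end

section \<open>Generators of ideals\<close>

context graph begin

lemma NN_0 [simp]: "0 \<in> NN" by (simp add: lideal_0)

lemma Mon0_sum:
  assumes "y \<in> addspan (Mon 0 u v)"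
  shows "\<exists>A c. finite A \<and> (\<forall>a\<in>A. walk u a v) \<and> y = (\<Sum>a\<in>A. sc (c a) * (PP a * VV v))"
  using assms
proof induction
  case zero
  show ?case by (rule exI[of _ "{}"]) simp
next
  case (add x y)
  obtain A c where A: "finite A" "\<forall>a\<in>A. walk u a v" "y = (\<Sum>a\<in>A. sc (c a) * (PP a * VV v))"
    using add.IH by blast
  obtain k a where x: "x = sc k * (PP a * VV v)" "walk u a v" using add.hyps(1) unfolding Mon_def by auto
  define d where "d b = (if b \<in> A then c b else 0) + (if b = a then k else 0)" for b
  have "(\<Sum>b\<in>insert a A. sc (d b) * (PP b * VV v)) =
      (\<Sum>b\<in>insert a A. if b \<in> A then sc (c b) * (PP b * VV v) else 0) +
      (\<Sum>b\<in>insert a A. if b = a then sc k * (PP b * VV v) else 0)"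
    unfolding sum.distrib[symmetric] by (rule sum.cong) (auto simp: d_def sc_add distrib_right)
  also have "(\<Sum>b\<in>insert a A. if b \<in> A then sc (c b) * (PP b * VV v) else 0) = y"
    unfolding A(3) using A(1) by (intro sum.mono_neutral_cong_right) auto
  also have "(\<Sum>b\<in>insert a A. if b = a then sc k * (PP b * VV v) else 0) = x"
    using A(1) x by (simp add: sum.delta)
  finally have "x + y = (\<Sum>b\<in>insert a A. sc (d b) * (PP b * VV v))" by (simp add: add.commute)
  then show ?case using A x by (intro exI[of _ "insert a A"] exI[of _ d]) auto
qed

text \<open>The last ghost edge of each monomial is peeled off. Requiring \<open>Y e = 0\<close>
  outside \<open>F\<close> allows the sum to be taken over any larger set of edges.\<close>

lemma MonSuc_split:
  assumes "y \<in> addspan (Mon (Suc n) u v)"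
  shows "\<exists>z F Y. z \<in> addspan (Mon 0 u v) \<and> finite F \<and> F \<subseteq> out v \<and>
    (\<forall>e. Y e \<in> addspan (Mon n u (r e))) \<and> (\<forall>e. e \<notin> F \<longrightarrow> Y e = 0) \<and> y = z + (\<Sum>e\<in>F. Y e * GG e)"
  using assms
proof induction
  case zero
  show ?case by (rule exI[of _ 0], rule exI[of _ "{}"], rule exI[of _ "\<lambda>e. 0"]) (simp add: addspan.zero)
next
  case (add x y)
  obtain z F Y where I: "z \<in> addspan (Mon 0 u v)" "finite F" "F \<subseteq> out v"
    "\<And>e. Y e \<in> addspan (Mon n u (r e))" "\<And>e. e \<notin> F \<Longrightarrow> Y e = 0" "y = z + (\<Sum>e\<in>F. Y e * GG e)"
    using add.IH by blast
  obtain k a b m where x: "x = sc k * (PP a * (VV m * QQ b))" "walk u a m" "walk v b m" "length b \<le> Suc n"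
    using add.hyps(1) unfolding Mon_def by blast
  show ?case
  proof (cases b)
    case Nil
    then have "x \<in> Mon 0 u v" unfolding x(1) using x by (intro MonI) auto
    then have "x + z \<in> addspan (Mon 0 u v)" using I(1) by (rule addspan.add)
    then show ?thesis using I by (intro exI[of _ "x + z"] exI[of _ F] exI[of _ Y]) (auto simp: add.assoc)
  next
    case (Cons e b')
    define w where "w = sc k * (PP a * (VV m * QQ b'))"
    have e: "e \<in> out v" "walk (r e) b' m" "length b' \<le> n" using x Cons by (auto simp: out_def)
    have w: "w \<in> Mon n u (r e)" unfolding w_def using x e by (intro MonI) auto
    have xw: "x = w * GG e" unfolding x(1) w_def Cons QQ_Cons by (simp add: mult.assoc)
    define Z where "Z f = Y f + (if f = e then w else 0)" for f
    have "(\<Sum>f\<in>insert e F. Z f * GG f) = (\<Sum>f\<in>insert e F. Y f * GG f) + (\<Sum>f\<in>insert e F. if f = e then w * GG e else 0)"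
      unfolding sum.distrib[symmetric] by (rule sum.cong) (auto simp: Z_def distrib_right)
    also have "(\<Sum>f\<in>insert e F. Y f * GG f) = (\<Sum>f\<in>F. Y f * GG f)"
      using I(2,5) by (intro sum.mono_neutral_right) auto
    also have "(\<Sum>f\<in>insert e F. if f = e then w * GG e else 0) = x"
      using I(2) xw by (simp add: sum.delta)
    finally have s: "x + y = z + (\<Sum>f\<in>insert e F. Z f * GG f)" using I(6) by (simp add: algebra_simps)
    have "Z f \<in> addspan (Mon n u (r f))" for f
      unfolding Z_def using I(4) addspan_plus[OF I(4) addspan_incl[OF w]] by auto
    then show ?thesis using s I e
      by (intro exI[of _ z] exI[of _ "insert e F"] exI[of _ Z]) (auto simp: Z_def)
  qed
qed

lemma MonSpan_VV: assumes "x \<in> MonSpan n u v" shows "x * VV v \<approx> x"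
proof -
  obtain y where y: "y \<in> addspan (Mon n u v)" "x \<approx> y" using assms by (auto simp: MonSpan_def)
  from y(1) have "y * VV v \<approx> y"
  proof induction
    case (add x y)
    obtain k a b m where x: "x = sc k * (PP a * (VV m * QQ b))" "walk v b m"
      using add.hyps(1) unfolding Mon_def by blast
    have "x * VV v \<approx> x" unfolding x(1) using eqv_lmult[OF VV_QQ[OF x(2)], of "sc k * PP a"] by (simp add: mult.assoc)
    then show ?case using add.IH by (simp add: distrib_right eqv_add)
  qed simp
  then show ?thesis using y(2) eqv_rmult[OF y(2)] eqv_sym eqv_trans by meson
qed

lemma MonSpan_DD0:
  assumes "z \<in> MonSpan 0 u v" "e \<in> out v" shows "z * DD e \<in> MonSpan 0 u (r e)"
proof -
  obtain y where y: "y \<in> addspan (Mon 0 u v)" "z \<approx> y" using assms by (auto simp: MonSpan_def)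
  from y(1) have "y * DD e \<in> MonSpan 0 u (r e)"
  proof induction
    case zero then show ?case by (simp add: MonSpan_0)
  next
    case (add x y)
    obtain k a where x: "x = sc k * (PP a * VV v)" "walk u a v" using add.hyps(1) unfolding Mon_def by auto
    have e: "e \<in> E1" "s e = v" using assms by (auto simp: out_def)
    have "x * DD e = (sc k * PP a) * (VV (s e) * DD e)" by (simp add: x e mult.assoc)
    also have "\<dots> \<approx> (sc k * PP a) * DD e" by (intro eqv_lmult rel_VD1)
    also have "\<dots> \<approx> (sc k * PP a) * (DD e * VV (r e))" by (rule eqv_sym, intro eqv_lmult rel_DV1)
    also have "\<dots> = sc k * (PP (a @ [e]) * (VV (r e) * QQ []))" by (simp add: PP_append PP_Cons mult.assoc)
    finally have *: "x * DD e \<approx> sc k * (PP (a @ [e]) * (VV (r e) * QQ []))" .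
    have "sc k * (PP (a @ [e]) * (VV (r e) * QQ [])) \<in> Mon 0 u (r e)"
      using x e r_E0 by (intro MonI) (auto simp: walk_append)
    then have "x * DD e \<in> MonSpan 0 u (r e)" using * MonSpan_mono_mem MonSpan_eqv by blast
    then show ?case using add.IH by (simp add: distrib_right MonSpan_plus)
  qed
  then show ?thesis using eqv_rmult[OF y(2)] MonSpan_eqv by blast
qed

lemma closed_sum_mem_imp:
  assumes I: "lideal I" and I': "lideal I'"
    and C: "\<And>c y. proper_exitless I c \<Longrightarrow> y \<in> I \<Longrightarrow> VV (s (hd c)) * (y * VV (s (hd c))) \<approx> y \<Longrightarrow> y \<in> I'"
    and \<Gamma>: "finite \<Gamma>" "\<forall>g\<in>\<Gamma>. g \<noteq> [] \<and> walk v g v"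
    and y: "closed_sum v \<Gamma> b \<in> I" "VV v \<notin> I"
  shows "closed_sum v \<Gamma> b \<in> I'"
proof -
  obtain c where "proper_exitless I c" "s (hd c) = v" using closed_sum_proper_exitless[OF I \<Gamma>(1) _ y] \<Gamma>(2) by blast
  then show ?thesis using C[OF _ y(1), of c] closed_sum_corner \<Gamma>(2) by blast
qed

text \<open>The extensions of a shortest path form a multiple of a \<open>closed_sum\<close>, which
  lies in \<open>I\<close> and therefore in \<open>I'\<close>; removing them leaves fewer
  terms.\<close>

lemma real_path_mem:
  assumes I: "lideal I" and I': "lideal I'"
    and VI: "\<And>v. VV v \<in> I \<Longrightarrow> VV v \<in> I'"
    and C: "\<And>c y. proper_exitless I c \<Longrightarrow> y \<in> I \<Longrightarrow> VV (s (hd c)) * (y * VV (s (hd c))) \<approx> y \<Longrightarrow> y \<in> I'"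
    and A: "finite A" "\<forall>a\<in>A. walk u a v" "(\<Sum>a\<in>A. sc (c a) * (PP a * VV v)) \<in> I"
  shows "(\<Sum>a\<in>A. sc (c a) * (PP a * VV v)) \<in> I'"
  using A
proof (induction "card A" arbitrary: A rule: less_induct)
  case (less A)
  let ?S = "\<lambda>A. \<Sum>a\<in>A. sc (c a) * (PP a * VV v)"
  consider "VV v \<in> I" | "A = {}" | a where "a \<in> A" "c a = 0" | "VV v \<notin> I" "A \<noteq> {}" "\<forall>a\<in>A. c a \<noteq> 0" by blast
  then show ?case
  proof cases
    case 1
    then show ?thesis using VI by (intro lideal_sum lideal_lmult I') auto
  next
    case 2
    then show ?thesis by (simp add: lideal_0 I')
  next
    case 3
    have eq: "?S A = ?S (A - {a})" using less.prems(1) 3 by (intro sum.mono_neutral_right) auto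
    have "?S (A - {a}) \<in> I'" using less.prems 3 eq by (intro less.hyps psubset_card_mono) auto
    then show ?thesis using eq by simp
  next
    case 4
    obtain a1 \<Gamma> b where l: "a1 \<in> A" "finite \<Gamma>" "\<forall>g\<in>\<Gamma>. g \<noteq> [] \<and> walk v g v"
      "QQ a1 * ?S A \<approx> sc (c a1) * closed_sum v \<Gamma> b"
      "sc (c a1) * (PP a1 * closed_sum v \<Gamma> b) = ?S {a\<in>A. prefix a1 a}"
      using closed_sum_lead[of A u v c] less.prems(1,2) 4 by blast
    have "sc (c a1) * closed_sum v \<Gamma> b \<in> I" using l(4) less.prems(3) I by (meson eqv_mem lideal_lmult)
    then have "sc (1 / c a1) * (sc (c a1) * closed_sum v \<Gamma> b) \<in> I" using I lideal_lmult by blast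
    then have y: "closed_sum v \<Gamma> b \<in> I" using 4(3) l(1) by (simp add: mult.assoc[symmetric] sc_mult[symmetric])
    have y': "closed_sum v \<Gamma> b \<in> I'" by (rule closed_sum_mem_imp[OF I I' C l(2,3) y 4(1)])
    let ?B = "{a\<in>A. prefix a1 a}"
    have d: "?S A = ?S ?B + ?S (A - ?B)"
      using sum.subset_diff[of ?B A "\<lambda>a. sc (c a) * (PP a * VV v)"] less.prems(1) by (simp add: add.commute)
    have "?S ?B \<in> I" "?S ?B \<in> I'" unfolding l(5)[symmetric] using y y' I I' lideal_lmult by blast+
    moreover have "?S (A - ?B) \<in> I'"
    proof (rule less.hyps)
      show "card (A - ?B) < card A" using l(1) less.prems(1) by (intro psubset_card_mono) auto
      show "?S (A - ?B) \<in> I" using d less.prems(3) \<open>?S ?B \<in> I\<close> lideal_diff[OF I, of "?S A" "?S ?B"] by simp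
    qed (use less.prems in auto)
    ultimately show ?thesis using d lideal_add[OF I'] by simp
  qed
qed

text \<open>An edge whose range lies in \<open>J\<close> is itself in \<open>J\<close>, so its term
  does not count modulo \<open>J\<close>.\<close>

lemma sum_nu_tail:
  assumes J: "lideal J" and F: "finite F" "B \<subseteq> F" and B: "\<And>e. e \<in> F - B \<Longrightarrow> VV (r e) \<in> J"
  shows "cg J (nu v F) (nu v B)"
proof -
  have "nu v F - nu v B = - (\<Sum>e\<in>F - B. DD e * GG e)"
    using sum.subset_diff[OF F(2,1), of "\<lambda>e. DD e * GG e"] by (simp add: nu_def)
  also have "\<dots> \<in> J" using B by (intro lideal_uminus lideal_sum lideal_rmult DD_mem_r J) auto
  finally show ?thesis by (simp add: cg_def)
qed

text \<open>An ideal is determined by its vertices, its elements \<open>v^H\<close> and its corners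
  at exitless cycles. The form as an inclusion serves twice: to find generators of \<open>I\<close>,
  and to compare an ideal having square in \<open>J\<close> with \<open>J\<close>. The induction is
  on the ghost length: \<open>x * DD e\<close> has fewer ghosts, and what remains of
  \<open>x\<close> is \<open>z * nu v F'\<close>.\<close>

theorem lideal_structure:
  assumes I: "lideal I" and I': "lideal I'"
    and VI: "\<And>v. VV v \<in> I \<Longrightarrow> VV v \<in> I'"
    and BI: "\<And>v F. infinite_emitter E0 E1 s v \<Longrightarrow> VV v \<notin> I \<Longrightarrow> F = {e \<in> out v. VV (r e) \<notin> I} \<Longrightarrow>
        finite F \<Longrightarrow> F \<noteq> {} \<Longrightarrow> nu v F \<in> I \<Longrightarrow> nu v F \<in> I'"
    and C: "\<And>c y. proper_exitless I c \<Longrightarrow> y \<in> I \<Longrightarrow> VV (s (hd c)) * (y * VV (s (hd c))) \<approx> y \<Longrightarrow> y \<in> I'"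
  shows "I \<subseteq> I'"
proof
  have A: "x \<in> I'" if x: "x \<in> MonSpan 0 u v" "x \<in> I" for x u v
  proof -
    obtain y where y: "y \<in> addspan (Mon 0 u v)" "x \<approx> y" using x(1) by (auto simp: MonSpan_def)
    obtain A c where A: "finite A" "\<forall>a\<in>A. walk u a v" "y = (\<Sum>a\<in>A. sc (c a) * (PP a * VV v))"
      using Mon0_sum[OF y(1)] by blast
    have "y \<in> I" using x(2) y(2) eqv_mem[OF I] by blast
    then have "y \<in> I'" unfolding A(3) by (intro real_path_mem[OF I I' VI C A(1,2)])
    then show ?thesis using y(2) eqv_mem[OF I'] by blast
  qed
  have main: "x \<in> I'" if "x \<in> MonSpan n u v" "x \<in> I" for n x u v
    using that
  proof (induction n arbitrary: v x)
    case 0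
    then show ?case by (rule A)
  next
    case (Suc n)
    obtain y where y: "y \<in> addspan (Mon (Suc n) u v)" "x \<approx> y" using Suc.prems by (auto simp: MonSpan_def)
    obtain z F Y where Y: "z \<in> addspan (Mon 0 u v)" "finite F" "F \<subseteq> out v"
      "\<And>e. Y e \<in> addspan (Mon n u (r e))" "\<And>e. e \<notin> F \<Longrightarrow> Y e = 0" "y = z + (\<Sum>e\<in>F. Y e * GG e)"
      using MonSuc_split[OF y(1)] by blast
    have zM: "z \<in> MonSpan 0 u v" using Y(1) eqv_refl unfolding MonSpan_def by blast
    have zV: "z * VV v \<approx> z" by (rule MonSpan_VV[OF zM])
    have xD: "x * DD e \<approx> z * DD e + Y e" if e: "e \<in> out v" for e
    proof -
      have YM: "Y e \<in> MonSpan n u (r e)" using Y(4) eqv_refl unfolding MonSpan_def by blast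
      have "x * DD e \<approx> y * DD e" by (intro eqv_rmult y)
      also have "\<dots> = z * DD e + (\<Sum>f\<in>F. Y f * (GG f * DD e))" by (simp add: Y(6) distrib_right sum_distrib_right mult.assoc)
      also have "\<dots> \<approx> z * DD e + (\<Sum>f\<in>F. if f = e then Y e else 0)"
      proof (intro eqv_add eqv_refl eqv_sum)
        fix f assume f: "f \<in> F"
        have "Y f * (GG f * DD e) \<approx> Y f * (if f = e then VV (r f) else 0)"
          using Y(3) f by (intro eqv_lmult rel_GD) (auto simp: out_def)
        also have "\<dots> \<approx> (if f = e then Y e else 0)" using MonSpan_VV[OF YM] by (auto simp: lideal_0)
        finally show "Y f * (GG f * DD e) \<approx> (if f = e then Y e else 0)" .
      qed
      also have "\<dots> = z * DD e + Y e" using Y(2,5) by (auto simp: sum.delta)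
      finally show ?thesis .
    qed
    \<comment> \<open>Multiplication by \<open>e\<close> cancels the last ghost edge of the part
      \<open>Y e\<close> and only lengthens the real paths in \<open>z\<close>, so the bound drops
      to \<open>n\<close>.\<close>
    have xDI: "x * DD e \<in> I'" if e: "e \<in> out v" for e
    proof (rule Suc.IH)
      have "Y e \<in> MonSpan n u (r e)" using Y(4) eqv_refl unfolding MonSpan_def by blast
      moreover have "z * DD e \<in> MonSpan n u (r e)" using MonSpan_DD0[OF zM e] MonSpan_mono[of 0 n] by blast
      ultimately show "x * DD e \<in> MonSpan n u (r e)" using xD[OF e] MonSpan_plus MonSpan_eqv by blast
      show "x * DD e \<in> I" using Suc.prems(2) lideal_rmult I by blast
    qed
    \<comment> \<open>The remainder \<open>z * nu v F'\<close> involves real paths only, up to the last factor.\<close>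
    have red: "x - (\<Sum>e\<in>F'. (x * DD e) * GG e) \<approx> z * nu v F'"
      if F': "finite F'" "F \<subseteq> F'" "F' \<subseteq> out v" for F'
    proof -
      have "x - (\<Sum>e\<in>F'. (x * DD e) * GG e) \<approx> y - (\<Sum>e\<in>F'. (z * DD e + Y e) * GG e)"
        using F' by (intro eqv_diff eqv_sum eqv_rmult y(2) xD) auto
      also have "\<dots> = z - (\<Sum>e\<in>F'. z * (DD e * GG e))"
      proof -
        have "(\<Sum>e\<in>F'. Y e * GG e) = (\<Sum>e\<in>F. Y e * GG e)"
          using F' Y(5) by (intro sum.mono_neutral_right) auto
        then show ?thesis by (simp add: Y(6) distrib_right sum.distrib mult.assoc)
      qed
      also have "\<dots> \<approx> z * VV v - (\<Sum>e\<in>F'. z * (DD e * GG e))" by (rule eqv_sym, intro eqv_diff eqv_refl zV)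
      also have "\<dots> = z * nu v F'" by (simp add: nu_def right_diff_distrib sum_distrib_left)
      finally show ?thesis .
    qed
    have fin: "x \<in> I'" if F': "finite F'" "F \<subseteq> F'" "F' \<subseteq> out v" and z: "z * nu v F' \<in> I'" for F'
    proof -
      have "x - (\<Sum>e\<in>F'. (x * DD e) * GG e) \<in> I'" using red[OF F'] z eqv_mem I' by blast
      moreover have "(\<Sum>e\<in>F'. (x * DD e) * GG e) \<in> I'" using F' xDI by (intro lideal_sum[OF I'] lideal_rmult[OF I', of "x * DD _"]) auto
      ultimately show ?thesis using lideal_add[OF I'] by fastforce
    qed
    have zI: "z * nu v F' \<in> I" if F': "finite F'" "F \<subseteq> F'" "F' \<subseteq> out v" for F'
    proof -
      have "x - (\<Sum>e\<in>F'. (x * DD e) * GG e) \<in> I" using Suc.prems(2)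
        by (intro lideal_diff lideal_sum lideal_rmult I)
      then show ?thesis using red[OF F'] eqv_mem I by blast
    qed
    consider "VV v \<in> I" | "VV v \<notin> I" "finite (out v)" | "VV v \<notin> I" "infinite (out v)" by blast
    then show ?case
    proof cases
      case 1
      then have "x * VV v \<in> I'" using VI I' lideal_lmult by blast
      then show ?thesis using MonSpan_VV[OF Suc.prems(1)] eqv_mem I' by blast
    next
      case 2
      show ?thesis
      proof (cases "out v = {}")
        case True
        then have "x \<approx> z" using Y y(2) by auto
        then show ?thesis using A[OF zM] Suc.prems(2) eqv_mem I I' by blast
      next
        case False
        \<comment> \<open>At a regular vertex \<open>F'\<close> may be all of \<open>out v\<close>,
          and then \<open>nu v F'\<close> is one of the defining relations.\<close>
        have "regular_vertex E0 E1 s v" unfolding regular_vertex_def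
          using 2 False VV_E0[OF I] by (auto simp: out_def)
        then have "nu v (out v) \<approx> (\<Sum>e\<in>out v. DD e * GG e) - (\<Sum>e\<in>out v. DD e * GG e)"
          unfolding nu_def by (intro eqv_diff rel_CK2 eqv_refl)
        then have "nu v (out v) \<in> I'" using NN_least[OF I'] by auto
        then show ?thesis using 2 Y by (intro fin[of "out v"] lideal_lmult I') auto
      qed
    next
      case 3
      obtain A c where Ac: "finite A" "\<forall>a\<in>A. walk u a v" "z = (\<Sum>a\<in>A. sc (c a) * (PP a * VV v))"
        using Mon0_sum[OF Y(1)] by blast
      define B where "B = {a \<in> A. c a \<noteq> 0}"
      have zB: "z = (\<Sum>a\<in>B. sc (c a) * (PP a * VV v))" unfolding Ac(3) B_def
        using Ac(1) by (intro sum.mono_neutral_right) auto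
      show ?thesis
      proof (cases "B = {}")
        case True
        then have "z = 0" using zB by simp
        then show ?thesis using fin[OF Y(2) order.refl Y(3)] by (simp add: lideal_0 I')
      next
        case False
        have Bp: "finite B" "\<And>a. a \<in> B \<Longrightarrow> walk u a v \<and> c a \<noteq> 0" using Ac(1,2) by (auto simp: B_def)
        obtain a1 \<Gamma> b where l: "a1 \<in> B" "finite \<Gamma>" "\<forall>g\<in>\<Gamma>. g \<noteq> [] \<and> walk v g v"
          "QQ a1 * z \<approx> sc (c a1) * closed_sum v \<Gamma> b"
          using closed_sum_lead[OF Bp(1) False Bp(2)] unfolding zB[symmetric] by blast
        note l3 = l(3)[rule_format]
        have c1: "c a1 \<noteq> 0" using l(1) by (simp add: B_def)
        \<comment> \<open>The ghost of a shortest path of \<open>z\<close> turns \<open>z\<close>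
          into a closed sum up to a nonzero scalar, so membership of \<open>z * nu v F'\<close>
          becomes a statement about \<open>VV v\<close> plus closed walks.\<close>
        have yn: "closed_sum v \<Gamma> b * nu v F' \<in> I" if F': "finite F'" "F \<subseteq> F'" "F' \<subseteq> out v" for F'
        proof -
          have "(QQ a1 * z) * nu v F' \<in> I" using zI[OF F'] I lideal_lmult by (simp add: mult.assoc)
          then have "(sc (c a1) * closed_sum v \<Gamma> b) * nu v F' \<in> I" using eqv_rmult[OF l(4)] eqv_mem I by blast
          then have "sc (1 / c a1) * ((sc (c a1) * closed_sum v \<Gamma> b) * nu v F') \<in> I" using I lideal_lmult by blast
          then show ?thesis using c1 by (simp add: mult.assoc[symmetric] sc_mult[symmetric])
        qed
        have first: "hd g \<in> out v \<and> VV (r (hd g)) \<notin> I \<and> g = hd g # tl g" if g\<Gamma>: "g \<in> \<Gamma>" for g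
        proof -
          obtain f g' where g: "g = f # g'" using l3[OF g\<Gamma>] by (cases g) auto
          then have "f \<in> out v" "walk (r f) g' v" using l3[OF g\<Gamma>] by (auto simp: out_def)
          then show ?thesis using VV_walk[OF I] 3(1) g by auto
        qed
        define D where "D = {e \<in> out v. VV (r e) \<notin> I}"
        show ?thesis
        proof (cases "finite D")
          case True
          \<comment> \<open>Closed walks at \<open>v\<close> begin with an edge of \<open>D\<close>,
            so \<open>nu v D\<close> kills them all. Multiplying by it on the left isolates
            \<open>nu v D\<close>, which is the element \<open>v^H\<close> of a breaking
            vertex.\<close>
          define F' where "F' = F \<union> D"
          have F': "finite F'" "F \<subseteq> F'" "F' \<subseteq> out v" using True Y by (auto simp: F'_def D_def)
          have D: "D \<subseteq> out v" by (auto simp: D_def)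
          have rest: "VV (r e) \<in> I" if "e \<in> F' - D" for e using that F' by (auto simp: D_def)
          have "cg I (nu v D * (closed_sum v \<Gamma> b * nu v F')) (nu v D * nu v F')"
          proof -
            have "nu v D * closed_sum v \<Gamma> b = nu v D * VV v + (\<Sum>g\<in>\<Gamma>. nu v D * (sc (b g) * (PP g * VV v)))"
              by (simp add: closed_sum_def distrib_left sum_distrib_left)
            also have "\<dots> \<approx> nu v D + (\<Sum>g\<in>\<Gamma>. 0)"
            proof (intro eqv_add eqv_sum nu_VV D)
              fix g assume g: "g \<in> \<Gamma>"
              then have "nu v D * DD (hd g) \<approx> 0" using nu_DD_gen[OF True D, of "hd g"] first[OF g] by (auto simp: D_def)
              then have "(nu v D * DD (hd g)) * (PP (tl g) * VV v) \<approx> 0 * (PP (tl g) * VV v)" by (rule eqv_rmult)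
              then have "nu v D * (PP g * VV v) \<approx> 0" using first[OF g] PP_Cons[of "hd g" "tl g"] by (simp add: mult.assoc)
              then have "sc (b g) * (nu v D * (PP g * VV v)) \<approx> sc (b g) * 0" by (rule eqv_lmult)
              then show "nu v D * (sc (b g) * (PP g * VV v)) \<approx> 0" by (simp add: sc_left_commute)
            qed
            finally have "nu v D * closed_sum v \<Gamma> b \<approx> nu v D" by simp
            from eqv_cg[OF I eqv_rmult[OF this, of "nu v F'"]] show ?thesis by (simp add: mult.assoc)
          qed
          moreover have "cg I (nu v F') (nu v D)"
            by (rule sum_nu_tail[OF I F'(1) _ rest]) (auto simp: F'_def)
          then have "cg I (nu v D * nu v F') (nu v D * nu v D)" by (rule cg_lmult[OF I])
          moreover have "cg I (nu v D * nu v D) (nu v D)" by (rule eqv_cg[OF I nu_idem[OF True D]])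
          moreover have "nu v D * (closed_sum v \<Gamma> b * nu v F') \<in> I" by (rule lideal_lmult[OF I yn[OF F']])
          ultimately have nD: "nu v D \<in> I" using cg_mem[OF I] by blast
          have "D \<noteq> {}" using nD 3(1) by (auto simp: nu_def)
          moreover have "infinite_emitter E0 E1 s v" using 3 VV_E0[OF I] by (auto simp: infinite_emitter_def out_def)
          ultimately have "nu v D \<in> I'" using BI nD 3(1) D_def True by blast
          moreover have "cg I' (nu v F') (nu v D)"
            by (rule sum_nu_tail[OF I' F'(1) _ VI[OF rest]]) (auto simp: F'_def)
          ultimately have "nu v F' \<in> I'" using I' cg_mem by blast
          then show ?thesis using fin[OF F'] I' lideal_lmult by blast
        next
          case False
          \<comment> \<open>An edge \<open>f\<close> outside \<open>F\<close> that begins no walk of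
            \<Gamma> reduces the closed sum between its ghost and itself to \<open>VV (r f)\<close>,
            which \<open>f \<in> D\<close> excludes from \<open>I\<close>.\<close>
          have "infinite (D - (F \<union> hd ` \<Gamma>))" using False Y(2) l(2) by (intro Diff_infinite_finite) auto
          then have "D - (F \<union> hd ` \<Gamma>) \<noteq> {}" by force
          then obtain f where f: "f \<in> D" "f \<notin> F" "f \<notin> hd ` \<Gamma>" by blast
          have fo: "f \<in> out v" "VV (r f) \<notin> I" "f \<in> E1" using f by (auto simp: D_def out_def)
          have "closed_sum v \<Gamma> b * (nu v F * DD f) \<approx> closed_sum v \<Gamma> b * DD f"
            using nu_DD_gen[OF Y(2,3) fo(1)] f by (intro eqv_lmult) auto
          moreover have "closed_sum v \<Gamma> b * (nu v F * DD f) \<in> I"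
            using lideal_rmult[OF I yn[OF Y(2) order.refl Y(3)], of "DD f"] by (simp add: mult.assoc)
          ultimately have "closed_sum v \<Gamma> b * DD f \<in> I" using eqv_mem[OF I] by blast
          then have "GG f * (closed_sum v \<Gamma> b * DD f) \<in> I" using I lideal_lmult by blast
          moreover have "GG f * (closed_sum v \<Gamma> b * DD f) \<approx> VV (r f)"
          proof -
            have "GG f * (closed_sum v \<Gamma> b * DD f) = (GG f * VV v) * DD f + (\<Sum>g\<in>\<Gamma>. (GG f * (sc (b g) * (PP g * VV v))) * DD f)"
              by (simp add: closed_sum_def distrib_left distrib_right sum_distrib_left sum_distrib_right mult.assoc)
            also have "\<dots> \<approx> GG f * DD f + (\<Sum>g\<in>\<Gamma>. 0 * DD f)"
            proof (intro eqv_add eqv_sum eqv_rmult)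
              show "GG f * VV v \<approx> GG f" using rel_GV1[of f] fo by (simp add: out_def)
              fix g assume g: "g \<in> \<Gamma>"
              then have "GG f * DD (hd g) \<approx> 0" using f fo by (intro rel_GD0) auto
              then have "(GG f * DD (hd g)) * (PP (tl g) * VV v) \<approx> 0 * (PP (tl g) * VV v)" by (rule eqv_rmult)
              then have "GG f * (PP g * VV v) \<approx> 0" using first[OF g] PP_Cons[of "hd g" "tl g"] by (simp add: mult.assoc)
              then have "sc (b g) * (GG f * (PP g * VV v)) \<approx> sc (b g) * 0" by (rule eqv_lmult)
              then show "GG f * (sc (b g) * (PP g * VV v)) \<approx> 0" by (simp add: sc_left_commute)
            qed
            also have "\<dots> \<approx> VV (r f)" using rel_GD1[OF fo(3)] by simp
            finally show ?thesis .
          qed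
          ultimately show ?thesis using fo eqv_mem I by blast
        qed
      qed
    qed
  qed
  fix x assume x: "x \<in> I"
  show "x \<in> I'"
  proof (rule lideal_mem_corners[OF I' lideal_augm[OF I x]])
    fix u v
    obtain n where "VV u * (x * VV v) \<in> MonSpan n u v" using corner_MonSpan[OF lideal_augm[OF I x]] by blast
    then show "VV u * (x * VV v) \<in> I'" using main x I lideal_lmult lideal_rmult by meson
  qed
qed

end

section \<open>Corners at cycles\<close>

text \<open>Horner evaluation at an element of a noncommutative algebra; it is multiplicative
  because the scalars \<open>sc k\<close> are central.\<close>

definition eval_at :: "('v, 'e, 'k::field) fa \<Rightarrow> 'k poly \<Rightarrow> ('v, 'e, 'k) fa" where
  "eval_at x p = fold_coeffs (\<lambda>a f. sc a + x * f) p 0"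

lemma eval_at_0 [simp]: "eval_at x 0 = 0" by (simp add: eval_at_def)

lemma eval_at_pCons [simp]: "eval_at x (pCons a p) = sc a + x * eval_at x p"
  by (cases "a = 0 \<and> p = 0") (auto simp: eval_at_def)

lemma eval_at_1 [simp]: "eval_at x 1 = 1" by (simp add: one_pCons)

lemma eval_at_add: "eval_at x (p + q) = eval_at x p + eval_at x q"
  by (induction p q rule: poly_induct2) (simp_all add: algebra_simps sc_add)

lemma eval_at_smult: "eval_at x (smult a p) = sc a * eval_at x p"
  by (induction p) (simp_all add: distrib_left sc_mult sc_left_commute)

lemma eval_at_mult: "eval_at x (p * q) = eval_at x p * eval_at x q"
  by (induction p) (simp_all add: algebra_simps eval_at_add eval_at_smult)

lemma eval_at_uminus: "eval_at x (- p) = - eval_at x p"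
  using eval_at_smult[of x "-1" p] by (simp add: sc_uminus)

lemma eval_at_diff: "eval_at x (p - q) = eval_at x p - eval_at x q"
  using eval_at_add[of x p "- q"] by (simp add: eval_at_uminus)

lemma eval_at_monom: "eval_at x (monom k n) = sc k * x ^ n"
  by (induction n) (simp_all add: monom_0 monom_Suc sc_left_commute)

lemma poly_ideal_principal:
  fixes S :: "'k::field poly set"
  assumes "0 \<in> S" "\<And>p q. p \<in> S \<Longrightarrow> q \<in> S \<Longrightarrow> p - q \<in> S" "\<And>p q. p \<in> S \<Longrightarrow> q * p \<in> S"
  shows "\<exists>f\<in>S. \<forall>p\<in>S. f dvd p"
proof (cases "S = {0}")
  case False
  define P where "P f \<longleftrightarrow> f \<in> S \<and> f \<noteq> 0" for f
  obtain f0 where "P f0" using False assms(1) by (auto simp: P_def)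
  define f where "f = arg_min degree P"
  have f: "P f" unfolding f_def by (rule arg_min_natI[of P, OF \<open>P f0\<close>])
  have min: "degree f \<le> degree g" if "P g" for g unfolding f_def using arg_min_nat_le[of P g degree, OF that] .
  have "f dvd p" if "p \<in> S" for p
  proof -
    have "p mod f = p - (p div f) * f" by (simp add: minus_div_mult_eq_mod)
    then have "p mod f \<in> S" using that f assms(2,3) by (auto simp: P_def)
    moreover have "p mod f = 0 \<or> degree (p mod f) < degree f" using f degree_mod_less by (auto simp: P_def)
    ultimately have "p mod f = 0" using min[of "p mod f"] unfolding P_def by (metis not_less)
    then show ?thesis by (simp add: dvd_eq_mod_eq_0)
  qed
  then show ?thesis using f by (auto simp: P_def)
qed auto

context graph begin

lemma is_cycle_iff: "is_cycle E1 r s c \<longleftrightarrow> c \<noteq> [] \<and> walk (s (hd c)) c (s (hd c)) \<and> distinct (map s c)"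
  using walk_is_path[of "s (hd c)" c "s (hd c)"] is_path_walk[of c] by (auto simp: is_cycle_def is_path_def)

lemma is_cycle_rotate: "is_cycle E1 r s (p @ q) \<Longrightarrow> is_cycle E1 r s (q @ p)"
proof -
  assume c: "is_cycle E1 r s (p @ q)"
  show ?thesis
  proof (cases "p = [] \<or> q = []")
    case False
    define v where "v = s (hd (p @ q))"
    obtain m where m: "walk v p m" "walk m q v" using c by (auto simp: is_cycle_iff walk_append v_def)
    have "s (hd q) = m" using m False walk_is_path by blast
    then show ?thesis using c m False by (auto simp: is_cycle_iff walk_append)
  qed (use c in auto)
qed

text \<open>\<open>v - e e\<^sup>* \<in> G\<close> says that, modulo \<open>G\<close>, the edge \<open>e\<close> is the only one leaving \<open>v\<close>.\<close>

definition exitless :: "('v, 'e, 'k) fa set \<Rightarrow> 'e list \<Rightarrow> bool" where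
  "exitless G c \<longleftrightarrow> is_cycle E1 r s c \<and> (\<forall>e\<in>set c. VV (s e) - DD e * GG e \<in> G)"

lemma proper_exitless_exitless: "proper_exitless G c \<longleftrightarrow> exitless G c \<and> VV (s (hd c)) \<notin> G" by (auto simp: proper_exitless_def exitless_def)

lemma exitless_mono: "G \<subseteq> J \<Longrightarrow> exitless G c \<Longrightarrow> exitless J c" by (auto simp: exitless_def)

lemma exitless_rotate: "exitless G (p @ q) \<Longrightarrow> exitless G (q @ p)"
  using is_cycle_rotate by (auto simp: exitless_def)

text \<open>For \<open>f \<noteq> e\<close> the element \<open>VV (s e) - DD e * GG e\<close> fixes
  \<open>DD f\<close>, so \<open>DD f\<close> and with it \<open>VV (r f)\<close> would lie in
  \<open>G\<close>.\<close>

lemma exitless_exit: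
  assumes G: "lideal G" and c: "exitless G c" "e \<in> set c" and f: "f \<in> E1" "s f = s e" "VV (r f) \<notin> G"
  shows "f = e"
proof (rule ccontr)
  assume ne: "f \<noteq> e"
  have e: "e \<in> E1" using c by (auto simp: exitless_def is_cycle_def is_path_def)
  have "VV (s f) * DD f - DD e * (GG e * DD f) \<approx> DD f - DD e * 0"
    using ne e by (intro eqv_diff eqv_lmult rel_VD1 rel_GD0) auto
  then have "(VV (s e) - DD e * GG e) * DD f \<approx> DD f" using f by (simp add: algebra_simps)
  moreover have "(VV (s e) - DD e * GG e) * DD f \<in> G" using c G by (auto simp: exitless_def intro: lideal_rmult)
  ultimately have "GG f * DD f \<in> G" using eqv_mem[OF G] lideal_lmult[OF G] by blast
  then show False using rel_GD1[OF f(1)] eqv_mem[OF G] f(3) by blast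
qed

lemma cycle_next:
  assumes "is_cycle E1 r s c" "j < length c"
  shows "r (c ! j) = s (c ! (Suc j mod length c))"
proof (cases "Suc j < length c")
  case True
  then show ?thesis using assms by (auto simp: is_cycle_def is_path_def)
next
  case False
  then have "Suc j = length c" using assms by auto
  then have "c ! j = last c" using last_conv_nth[of c] assms by (metis diff_Suc_1 length_greater_0_conv list.size(3) not_less_zero)
  then show ?thesis using assms \<open>Suc j = length c\<close> by (auto simp: is_cycle_def is_path_def hd_conv_nth)
qed

text \<open>Since \<open>VV m \<notin> G\<close>, no vertex on the way to \<open>m\<close> is in
  \<open>G\<close>, so \<open>exitless_exit\<close> determines every edge of the walk.\<close>

lemma walk_along:
  assumes G: "lideal G" and c: "exitless G c" and w: "walk (s (hd c)) a m" and m: "VV m \<notin> G"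
  shows "(\<forall>i<length a. a ! i = c ! (i mod length c)) \<and> m = s (c ! (length a mod length c))"
  using w m
proof (induction a arbitrary: m rule: rev_induct)
  case Nil
  then show ?case using c by (auto simp: exitless_def is_cycle_iff hd_conv_nth)
next
  case (snoc f a)
  obtain w where w: "walk (s (hd c)) a w" "f \<in> E1" "s f = w" "r f = m" using snoc.prems by (auto simp: walk_append)
  have wG: "VV w \<notin> G" using VV_walk[OF G, of w "[f]" m] snoc.prems w walk_E0 by (auto simp: r_E0)
  have IH: "\<forall>i<length a. a ! i = c ! (i mod length c)" "w = s (c ! (length a mod length c))" using snoc.IH[OF w(1) wG] by auto
  have c0: "c \<noteq> []" "is_cycle E1 r s c" using c by (auto simp: exitless_def is_cycle_iff)
  have "f = c ! (length a mod length c)"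
    using c0 w IH(2) snoc.prems by (intro exitless_exit[OF G c]) auto
  moreover have "m = s (c ! (Suc (length a) mod length c))"
    using cycle_next[OF c0(2), of "length a mod length c"] calculation w c0 by (simp add: mod_Suc_eq)
  ultimately show ?case using IH by (auto simp: nth_append less_Suc_eq)
qed

lemma cycle_eq_rep:
  assumes c: "c \<noteq> []" and a: "\<forall>i<length a. a ! i = c ! (i mod length c)"
  shows "length a \<le> n * length c \<Longrightarrow> prefix a (rep n c)"
    and "length a mod length c = 0 \<Longrightarrow> \<exists>j. a = rep j c"
proof -
  show p: "prefix a (rep n c)" if "length a \<le> n * length c" for n
  proof -
    have "a = take (length a) (rep n c)"
      using that a nth_rep[of _ n c] by (intro nth_equalityI) (auto simp: length_rep)
    then show ?thesis by (metis take_is_prefix)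
  qed
  assume "length a mod length c = 0"
  then have "length a = (length a div length c) * length c" by (metis add.right_neutral div_mult_mod_eq)
  then obtain j where j: "length a = j * length c" by blast
  have "prefix a (rep j c)" using p j by simp
  then obtain d where d: "rep j c = a @ d" by (auto simp: prefix_def)
  have "length (rep j c) = length a" using j by (simp add: length_rep)
  then have "a = rep j c" using d by simp
  then show "\<exists>j. a = rep j c" ..
qed

lemma closed_walk_rep:
  assumes G: "lideal G" and c: "exitless G c" and w: "walk (s (hd c)) a (s (hd c))" and m: "VV (s (hd c)) \<notin> G"
  shows "\<exists>j. a = rep j c"
proof -
  have c0: "c \<noteq> []" "distinct (map s c)" using c by (auto simp: exitless_def is_cycle_iff)
  note al = walk_along[OF G c w m]
  have l: "length a mod length c < length (map s c)" "0 < length (map s c)" using c0 by simp_all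
  have "s (hd c) = s (c ! (length a mod length c))" using al by blast
  then have "map s c ! (length a mod length c) = map s c ! 0"
    using l unfolding length_map hd_conv_nth[OF c0(1)] by (simp only: nth_map)
  then have "length a mod length c = 0"
    using nth_eq_iff_index_eq[OF c0(2) l] by blast
  then show ?thesis by (rule cycle_eq_rep(2)[OF c0(1) conjunct1[OF al]])
qed

text \<open>The products \<open>DD e * GG e\<close> collapse to vertices from the inside out. Modulo
  \<open>G\<close> such a path is invertible from both sides.\<close>

lemma PP_QQ_along:
  assumes G: "lideal G" and "walk u p w" "\<forall>e\<in>set p. VV (s e) - DD e * GG e \<in> G"
  shows "cg G (PP p * (VV w * QQ p)) (VV u)"
  using assms(2,3)
proof (induction p arbitrary: u)
  case (Cons e p)
  have "PP (e # p) * (VV w * QQ (e # p)) = DD e * ((PP p * (VV w * QQ p)) * GG e)" by (simp add: PP_Cons QQ_Cons mult.assoc)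
  moreover have "cg G (DD e * ((PP p * (VV w * QQ p)) * GG e)) (DD e * (VV (r e) * GG e))"
    using Cons by (intro cg_lmult cg_rmult G Cons.IH) auto
  moreover have "cg G (DD e * (VV (r e) * GG e)) (DD e * GG e)" by (intro cg_lmult G eqv_cg[OF G rel_VG1])
  moreover have "cg G (DD e * GG e) (VV u)"
    using Cons.prems cg_sym[OF G, of "VV (s e)" "DD e * GG e"] by (auto simp: cg_def)
  ultimately show ?case using cg_trans[OF G] by metis
qed (use G in simp)

section \<open>The corner at a cycle\<close>

definition cyc_elem :: "'e list \<Rightarrow> ('v, 'e, 'k) fa" where "cyc_elem c = PP c * VV (s (hd c))"
definition cyc_poly :: "'e list \<Rightarrow> 'k poly \<Rightarrow> ('v, 'e, 'k) fa" where "cyc_poly c f = eval_at (cyc_elem c) f * VV (s (hd c))"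

definition corner :: "'v \<Rightarrow> ('v, 'e, 'k) fa \<Rightarrow> bool" where
  "corner v y \<longleftrightarrow> VV v * (y * VV v) \<approx> y"

lemma corner_l: "corner v y \<Longrightarrow> VV v * y \<approx> y"
  unfolding corner_def
proof -
  assume c: "VV v * (y * VV v) \<approx> y"
  have "VV v * y \<approx> VV v * (VV v * (y * VV v))" by (rule eqv_sym[OF eqv_lmult[OF c]])
  also have "\<dots> = (VV v * VV v) * (y * VV v)" by (simp add: mult.assoc)
  also have "\<dots> \<approx> VV v * (y * VV v)" by (intro eqv_rmult rel_VV1)
  also have "\<dots> \<approx> y" by (rule c)
  finally show ?thesis .
qed

lemma corner_r: "corner v y \<Longrightarrow> y * VV v \<approx> y"
  unfolding corner_def
proof -
  assume c: "VV v * (y * VV v) \<approx> y"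
  have "y * VV v \<approx> VV v * (y * VV v) * VV v" by (rule eqv_sym[OF eqv_rmult[OF c]])
  also have "\<dots> = VV v * (y * (VV v * VV v))" by (simp add: mult.assoc)
  also have "\<dots> \<approx> VV v * (y * VV v)" by (intro eqv_lmult rel_VV1)
  also have "\<dots> \<approx> y" by (rule c)
  finally show ?thesis .
qed

lemma cornerI: "VV v * y \<approx> y \<Longrightarrow> y * VV v \<approx> y \<Longrightarrow> corner v y"
  unfolding corner_def using eqv_lmult[of "y * VV v" y "VV v"] eqv_trans by blast

context
  fixes c v assumes c: "is_cycle E1 r s c" and v: "v = s (hd c)"
begin

lemma walk_c: "walk v c v" "v \<in> E0" "c \<noteq> []"
  using c v walk_E0 by (auto simp: is_cycle_iff)

lemma cyc_elem_l: "VV v * cyc_elem c \<approx> cyc_elem c" unfolding cyc_elem_def v[symmetric] by (rule VV_PP[OF walk_c(1)])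
lemma cyc_elem_r: "cyc_elem c * VV v \<approx> cyc_elem c"
  using eqv_lmult[OF rel_VV1[of v], of "PP c"] by (simp add: cyc_elem_def v mult.assoc)

lemma eval_at_cyc_elem_comm: "VV v * eval_at (cyc_elem c) f \<approx> eval_at (cyc_elem c) f * VV v"
proof (induction f)
  case (pCons a f)
  have "(VV v * cyc_elem c) * eval_at (cyc_elem c) f \<approx> cyc_elem c * eval_at (cyc_elem c) f" by (intro eqv_rmult cyc_elem_l)
  also have "\<dots> \<approx> (cyc_elem c * VV v) * eval_at (cyc_elem c) f" by (rule eqv_sym, intro eqv_rmult cyc_elem_r)
  also have "\<dots> = cyc_elem c * (VV v * eval_at (cyc_elem c) f)" by (simp add: mult.assoc)
  also have "\<dots> \<approx> cyc_elem c * (eval_at (cyc_elem c) f * VV v)" by (intro eqv_lmult pCons.IH)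
  finally have "sc a * VV v + (VV v * cyc_elem c) * eval_at (cyc_elem c) f \<approx> sc a * VV v + cyc_elem c * (eval_at (cyc_elem c) f * VV v)"
    by (intro eqv_add eqv_refl)
  then show ?case by (simp add: algebra_simps sc_commute)
qed simp

lemma cyc_poly_corner: "corner v (cyc_poly c f)"
proof (rule cornerI)
  have 1: "cyc_poly c f * VV v \<approx> cyc_poly c f" using eqv_lmult[OF rel_VV1[of v], of "eval_at (cyc_elem c) f"] by (simp add: cyc_poly_def v mult.assoc)
  have "VV v * cyc_poly c f \<approx> cyc_poly c f * VV v"
    using eqv_rmult[OF eval_at_cyc_elem_comm, of f "VV v"] by (simp add: cyc_poly_def v mult.assoc)
  also note 1
  finally show "VV v * cyc_poly c f \<approx> cyc_poly c f" .
qed (use eqv_lmult[OF rel_VV1[of v], of "eval_at (cyc_elem c) f"] in \<open>simp add: cyc_poly_def v mult.assoc\<close>)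

lemma cyc_poly_mult: "cyc_poly c (f * g) \<approx> cyc_poly c f * cyc_poly c g"
proof -
  have "cyc_poly c f * cyc_poly c g = eval_at (cyc_elem c) f * (VV v * cyc_poly c g)" by (simp add: cyc_poly_def v mult.assoc)
  also have "\<dots> \<approx> eval_at (cyc_elem c) f * cyc_poly c g" by (intro eqv_lmult corner_l cyc_poly_corner)
  also have "\<dots> = cyc_poly c (f * g)" by (simp add: cyc_poly_def eval_at_mult mult.assoc)
  finally show ?thesis by (rule eqv_sym)
qed

lemma PP_rep: "cyc_elem c ^ n * VV v \<approx> PP (rep n c) * VV v"
proof (induction n)
  case (Suc n)
  have "cyc_elem c ^ Suc n * VV v = cyc_elem c * (cyc_elem c ^ n * VV v)" by (simp add: mult.assoc)
  also have "\<dots> \<approx> cyc_elem c * (PP (rep n c) * VV v)" by (intro eqv_lmult Suc.IH)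
  also have "\<dots> = PP c * (VV v * (PP (rep n c) * VV v))" by (simp add: cyc_elem_def v mult.assoc)
  also have "\<dots> \<approx> PP c * (PP (rep n c) * VV v)" by (intro eqv_lmult VV_PP walk_rep walk_c)
  also have "\<dots> = PP (rep (Suc n) c) * VV v" by (simp add: PP_append mult.assoc)
  finally show ?case .
qed simp

lemma cyc_poly_monom: "cyc_poly c (monom k n) \<approx> sc k * (PP (rep n c) * VV v)"
  using eqv_lmult[OF PP_rep, of "sc k" n] by (simp add: cyc_poly_def eval_at_monom v mult.assoc)

lemma cyc_poly_add: "cyc_poly c (f + g) = cyc_poly c f + cyc_poly c g" by (simp add: cyc_poly_def eval_at_add distrib_right)
lemma cyc_poly_diff: "cyc_poly c (f - g) = cyc_poly c f - cyc_poly c g" by (simp add: cyc_poly_def eval_at_diff left_diff_distrib)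
lemma cyc_poly_0: "cyc_poly c 0 = 0" by (simp add: cyc_poly_def)
text \<open>Modulo \<open>G\<close> the corner consists of Laurent polynomials in \<open>c\<close>,
  and a power of \<open>c\<close> on the right clears the negative exponents: a ghost path
  \<open>b\<close> runs along the cycle, so it is a prefix of that power, and what remains is a
  closed walk, hence again a power of \<open>c\<close>.\<close>

lemma corner_poly:
  assumes G: "lideal G" and e: "exitless G c" and y: "y \<in> augm" "corner v y"
  shows "\<exists>n f. cg G (y * (PP (rep n c) * VV v)) (cyc_poly c f)"
proof -
  obtain l where l: "VV v * (y * VV v) \<in> MonSpan l v v" using corner_MonSpan[OF y(1)] by blast
  then obtain z where z: "z \<in> addspan (Mon l v v)" "y \<approx> z"
    using y(2) eqv_sym eqv_trans unfolding MonSpan_def corner_def by blast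
  have "\<exists>f. cg G (z * (PP (rep l c) * VV v)) (cyc_poly c f)"
    using z(1)
  proof induction
    case zero
    show ?case by (rule exI[of _ 0]) (simp add: cyc_poly_0 lideal_0 G)
  next
    case (add x z)
    obtain f where f: "cg G (z * (PP (rep l c) * VV v)) (cyc_poly c f)" using add.IH by blast
    obtain k a b m where x: "x = sc k * (PP a * (VV m * QQ b))" "walk v a m" "walk v b m" "length b \<le> l"
      using add.hyps(1) unfolding Mon_def by blast
    have "\<exists>g. cg G (x * (PP (rep l c) * VV v)) (cyc_poly c g)"
    proof (cases "VV m \<in> G")
      case True
      then have "x * (PP (rep l c) * VV v) \<in> G"
        unfolding x(1) by (intro lideal_rmult[OF G lideal_lmult[OF G lideal_lmult[OF G lideal_rmult[OF G True]]]])
      then show ?thesis by (intro exI[of _ 0]) (simp add: cyc_poly_0)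
    next
      case False
      have vG: "VV v \<notin> G" using VV_walk[OF G _ x(2)] False by blast
      \<comment> \<open>Crude but sufficient: \<open>l\<close> turns of \<open>c\<close> are at
        least as long as any ghost path \<open>b\<close> of the sum.\<close>
      have "l \<le> l * length c" using walk_c(3) by (cases "length c") auto
      then have "prefix b (rep l c)"
        using cycle_eq_rep(1)[OF walk_c(3) conjunct1[OF walk_along[OF G e x(3)[unfolded v] False]] order.trans[OF x(4)]] by simp
      then obtain d where d: "rep l c = b @ d" by (auto simp: prefix_def)
      have wd: "walk m d v" using walk_rep[OF walk_c(1), of l] x(3) walk_end_unique unfolding d by (auto simp: walk_append)
      have "walk v (a @ d) v" using x(2) wd by (auto simp: walk_append)
      then obtain j where j: "a @ d = rep j c" using closed_walk_rep[OF G e] v vG by auto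
      have "x * (PP (rep l c) * VV v) = (sc k * (PP a * VV m)) * (QQ b * (PP (b @ d) * VV v))"
        by (simp add: x(1) d mult.assoc)
      also have "\<dots> \<approx> (sc k * (PP a * VV m)) * (PP d * VV v)" by (intro eqv_lmult QQ_PP_ext[OF x(3) wd])
      also have "\<dots> = (sc k * PP a) * (VV m * (PP d * VV v))" by (simp add: mult.assoc)
      also have "\<dots> \<approx> (sc k * PP a) * (PP d * VV v)" by (intro eqv_lmult VV_PP[OF wd])
      also have "\<dots> = sc k * (PP (rep j c) * VV v)" by (simp add: j[symmetric] PP_append mult.assoc)
      also have "\<dots> \<approx> cyc_poly c (monom k j)" by (rule eqv_sym[OF cyc_poly_monom])
      finally show ?thesis using eqv_cg[OF G] by blast
    qed
    then obtain g where g: "cg G (x * (PP (rep l c) * VV v)) (cyc_poly c g)" by blast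
    show ?case using cg_add[OF G g f] by (intro exI[of _ "g + f"]) (simp add: cyc_poly_add distrib_right)
  qed
  then obtain f where f: "cg G (z * (PP (rep l c) * VV v)) (cyc_poly c f)" by blast
  show ?thesis using cg_trans[OF G eqv_cg[OF G eqv_rmult[OF z(2)]] f] by blast
qed

lemma rep_unit: assumes G: "lideal G" and e: "exitless G c"
  shows "cg G ((PP (rep n c) * VV v) * QQ (rep n c)) (VV v)"
  using PP_QQ_along[OF G walk_rep[OF walk_c(1), of n]] e by (auto simp: exitless_def mult.assoc)

text \<open>Clearing denominators loses nothing, because the power of \<open>c\<close> has its ghost
  as a right inverse modulo \<open>G\<close>.\<close>

lemma corner_poly_recover:
  assumes G: "lideal G" and e: "exitless G c" and y: "corner v y" and f: "cg G (y * (PP (rep n c) * VV v)) (cyc_poly c f)"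
  shows "cg G y (cyc_poly c f * QQ (rep n c))"
proof -
  let ?X = "PP (rep n c) * VV v" and ?Y = "QQ (rep n c)"
  have 1: "cg G (y * (?X * ?Y)) (y * VV v)" by (intro cg_lmult G rep_unit e)
  have 2: "cg G (y * VV v) y" by (rule eqv_cg[OF G corner_r[OF y]])
  have 3: "cg G ((y * ?X) * ?Y) (cyc_poly c f * ?Y)" by (intro cg_rmult G f)
  have 4: "(y * ?X) * ?Y = y * (?X * ?Y)" by (simp add: mult.assoc)
  show ?thesis by (rule cg_trans[OF G cg_sym[OF G cg_trans[OF G 1 2]] 3[unfolded 4]])
qed

lemma cyc_poly_cyc_elem: "cyc_poly c f * cyc_elem c \<approx> cyc_elem c * cyc_poly c f"
proof -
  have "cyc_poly c f * cyc_elem c = eval_at (cyc_elem c) f * (VV v * cyc_elem c)" by (simp add: cyc_poly_def v mult.assoc)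
  also have "\<dots> \<approx> eval_at (cyc_elem c) f * cyc_elem c" by (intro eqv_lmult cyc_elem_l)
  also have "eval_at (cyc_elem c) f * cyc_elem c = cyc_elem c * eval_at (cyc_elem c) f"
    by (induction f) (simp_all add: algebra_simps sc_commute sc_left_commute)
  also have "\<dots> \<approx> (cyc_elem c * VV v) * eval_at (cyc_elem c) f" by (rule eqv_sym, intro eqv_rmult cyc_elem_r)
  also have "\<dots> = cyc_elem c * (VV v * eval_at (cyc_elem c) f)" by (simp add: mult.assoc)
  also have "\<dots> \<approx> cyc_elem c * cyc_poly c f" using eqv_lmult[OF eval_at_cyc_elem_comm, of "cyc_elem c"] by (simp add: cyc_poly_def v)
  finally show ?thesis .
qed

lemma rep_cyc_elem: "(PP (rep n c) * VV v) * cyc_elem c \<approx> cyc_elem c * (PP (rep n c) * VV v)"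
proof -
  have m: "cyc_poly c (monom 1 n) \<approx> PP (rep n c) * VV v" using cyc_poly_monom[of 1 n] by simp
  have "(PP (rep n c) * VV v) * cyc_elem c \<approx> cyc_poly c (monom 1 n) * cyc_elem c" by (rule eqv_rmult[OF eqv_sym[OF m]])
  also have "\<dots> \<approx> cyc_elem c * cyc_poly c (monom 1 n)" by (rule cyc_poly_cyc_elem)
  also have "\<dots> \<approx> cyc_elem c * (PP (rep n c) * VV v)" by (rule eqv_lmult[OF m])
  finally show ?thesis .
qed

text \<open>Insert \<open>X * Y\<close>, a power of \<open>c\<close> times its ghost, which acts as
  the identity: \<open>X\<close> commutes with \<open>cyc_elem c\<close>, and \<open>y * X\<close>
  is a polynomial in it.\<close>

lemma corner_commute_cyc_elem:
  assumes G: "lideal G" and e: "exitless G c" and y: "y \<in> augm" "corner v y"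
  shows "cg G (y * cyc_elem c) (cyc_elem c * y)"
proof -
  obtain n f where f: "cg G (y * (PP (rep n c) * VV v)) (cyc_poly c f)" using corner_poly[OF G e y] by blast
  define X where "X = PP (rep n c) * VV v"
  define Y where "Y = QQ (rep n c)"
  have XY: "cg G (X * Y) (VV v)" unfolding X_def Y_def by (rule rep_unit[OF G e])
  note tr = cg_trans[OF G]
  have "cg G (y * cyc_elem c) (y * (cyc_elem c * VV v))" by (rule cg_sym[OF G]) (intro cg_lmult G eqv_cg[OF G cyc_elem_r])
  also have "cg G (y * (cyc_elem c * VV v)) (y * (cyc_elem c * (X * Y)))" by (rule cg_sym[OF G]) (intro cg_lmult G XY)
  also (tr) have "cg G \<dots> (y * (X * cyc_elem c * Y))"
    using eqv_lmult[OF eqv_rmult[OF eqv_sym[OF rep_cyc_elem[of n]]], of y Y] eqv_cg[OF G] by (simp add: X_def mult.assoc)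
  also (tr) have "cg G \<dots> (cyc_poly c f * (cyc_elem c * Y))"
    using cg_rmult[OF G f, of "cyc_elem c * Y"] by (simp add: X_def mult.assoc)
  also (tr) have "cg G \<dots> (cyc_elem c * cyc_poly c f * Y)"
    using eqv_cg[OF G eqv_rmult[OF cyc_poly_cyc_elem[of f], of Y]] by (simp add: mult.assoc)
  also (tr) have "cg G \<dots> (cyc_elem c * y)"
    using cg_lmult[OF G cg_sym[OF G corner_poly_recover[OF G e y(2) f]], of "cyc_elem c"] by (simp add: Y_def mult.assoc)
  finally (tr) show ?thesis .
qed

lemma corner_commute:
  assumes G: "lideal G" and e: "exitless G c" and y: "y \<in> augm" "corner v y"
  shows "cg G (y * cyc_poly c b) (cyc_poly c b * y)"
proof -
  note tr = cg_trans[OF G]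
  have p: "cg G (y * eval_at (cyc_elem c) b) (eval_at (cyc_elem c) b * y)"
  proof (induction b)
    case 0 then show ?case by (simp add: lideal_0 G)
  next
    case (pCons a b)
    have "cg G ((y * cyc_elem c) * eval_at (cyc_elem c) b) ((cyc_elem c * y) * eval_at (cyc_elem c) b)"
      by (intro cg_rmult G corner_commute_cyc_elem e y)
    moreover have "cg G (cyc_elem c * (y * eval_at (cyc_elem c) b)) (cyc_elem c * (eval_at (cyc_elem c) b * y))" by (intro cg_lmult G pCons.IH)
    ultimately have "cg G ((y * cyc_elem c) * eval_at (cyc_elem c) b) (cyc_elem c * (eval_at (cyc_elem c) b * y))"
      using tr[of "(y * cyc_elem c) * eval_at (cyc_elem c) b"] by (simp add: mult.assoc)
    then have "cg G (sc a * y + (y * cyc_elem c) * eval_at (cyc_elem c) b) (sc a * y + cyc_elem c * (eval_at (cyc_elem c) b * y))"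
      by (intro cg_add G cg_refl)
    then show ?case by (simp add: algebra_simps sc_commute)
  qed
  have "cg G (y * cyc_poly c b) (eval_at (cyc_elem c) b * (y * VV v))"
    using cg_rmult[OF G p, of "VV v"] by (simp add: cyc_poly_def v mult.assoc)
  also have "cg G (eval_at (cyc_elem c) b * (y * VV v)) (eval_at (cyc_elem c) b * y)" by (intro cg_lmult G eqv_cg[OF G corner_r[OF y(2)]])
  also (tr) have "cg G \<dots> (eval_at (cyc_elem c) b * (VV v * y))"
    by (rule cg_sym[OF G]) (intro cg_lmult G eqv_cg[OF G corner_l[OF y(2)]])
  finally (tr) show ?thesis by (simp add: cyc_poly_def v mult.assoc)
qed

text \<open>The polynomials \<open>p\<close> with \<open>cyc_poly c p \<in> I\<close> form an ideal
  of a principal ideal domain, and \<open>f\<close> generates it. \<open>G\<close> and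
  \<open>J\<close> are quantified after \<open>f\<close> because the ideal \<open>J\<close> of the
  application is built from the chosen polynomials.\<close>

lemma corner_principal:
  assumes I: "lideal I"
  shows "\<exists>f. cyc_poly c f \<in> I \<and> (\<forall>G J y. lideal G \<longrightarrow> lideal J \<longrightarrow> exitless G c \<longrightarrow> G \<subseteq> I \<longrightarrow> G \<subseteq> J \<longrightarrow> cyc_poly c f \<in> J \<longrightarrow>
      y \<in> I \<longrightarrow> corner v y \<longrightarrow> y \<in> J)"
proof -
  define S where "S = {p. cyc_poly c p \<in> I}"
  have "\<exists>f\<in>S. \<forall>p\<in>S. f dvd p"
  proof (rule poly_ideal_principal)
    show "0 \<in> S" by (simp add: S_def cyc_poly_0 lideal_0 I)
    show "p - q \<in> S" if "p \<in> S" "q \<in> S" for p q using that I by (auto simp: S_def cyc_poly_diff intro: lideal_diff)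
    show "q * p \<in> S" if "p \<in> S" for p q
      using that eqv_mem[OF I cyc_poly_mult[of q p]] lideal_lmult[OF I] by (auto simp: S_def)
  qed
  then obtain f where f: "f \<in> S" "\<And>p. p \<in> S \<Longrightarrow> f dvd p" by blast
  have "y \<in> J" if G: "lideal G" and J: "lideal J" and e: "exitless G c" and GI: "G \<subseteq> I" and GJ: "G \<subseteq> J"
    and fJ: "cyc_poly c f \<in> J" and y: "y \<in> I" "corner v y" for G J y
  proof -
    obtain n g where g: "cg G (y * (PP (rep n c) * VV v)) (cyc_poly c g)" using corner_poly[OF G e lideal_augm[OF I y(1)] y(2)] by blast
    have "cyc_poly c g \<in> I" using cg_mem[OF I cg_mono[OF GI g]] lideal_rmult[OF I y(1)] by blast
    then obtain q where "g = f * q" using f(2)[of g] by (auto simp: S_def)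
    then have "cyc_poly c g \<in> J" using eqv_mem[OF J cyc_poly_mult[of f q]] lideal_rmult[OF J fJ] by blast
    then have "cyc_poly c g * QQ (rep n c) \<in> J" by (rule lideal_rmult[OF J])
    then show ?thesis using cg_mem[OF J cg_mono[OF GJ corner_poly_recover[OF G e y(2) g]]] by blast
  qed
  then show ?thesis using f(1) unfolding S_def by blast
qed

end

section \<open>Comparing different cycles and base points\<close>

lemma exitless_share:
  assumes G: "lideal G" and c: "exitless G c" "exitless G c'" and m: "m \<in> s ` set c" "m \<in> s ` set c'" "VV m \<notin> G"
  shows "set c = set c'"
proof -
  have *: "set c' \<subseteq> set c" if c: "exitless G c" "exitless G c'" and m: "m \<in> s ` set c" "m \<in> s ` set c'" for c c'
  proof -
    obtain p e q where p: "c = p @ e # q" "s e = m" using m(1) by (auto dest: split_list)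
    obtain p' e' q' where p': "c' = p' @ e' # q'" "s e' = m" using m(2) by (auto dest: split_list)
    \<comment> \<open>Both cycles are rotated to start at the shared vertex, where
      \<open>walk_along\<close> makes one follow the other.\<close>
    define d where "d = (e # q) @ p"
    define d' where "d' = (e' # q') @ p'"
    have d: "exitless G d" "s (hd d) = m" "set d = set c" using exitless_rotate[of G p "e # q"] c(1) p by (auto simp: d_def)
    have d': "exitless G d'" "s (hd d') = m" "set d' = set c'" using exitless_rotate[of G p' "e' # q'"] c(2) p' by (auto simp: d'_def)
    have "walk m d' m" using d'(1,2) by (auto simp: exitless_def is_cycle_iff)
    then have al: "\<forall>i<length d'. d' ! i = d ! (i mod length d)" using walk_along[OF G d(1), of d' m] d(2) assms(6) by auto
    have "length d > 0" by (simp add: d_def)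
    then have "d' ! i \<in> set d" if "i < length d'" for i using al that by simp
    then have "set d' \<subseteq> set d" by (auto simp: in_set_conv_nth)
    then show ?thesis using d d' by simp
  qed
  show ?thesis using *[OF c m(1,2)] *[OF c(2,1) m(2,1)] by blast
qed

text \<open>In a monomial between the two base points the middle vertex \<open>m\<close> is reached
  from both cycles. Outside \<open>G\<close> it would lie on both, and by
  \<open>exitless_share\<close> they would coincide.\<close>

lemma exitless_orth:
  assumes G: "lideal G" and c: "exitless G c" "exitless G c'" and ne: "set c \<noteq> set c'"
  shows "VV (s (hd c)) * (x * VV (s (hd c'))) \<in> G"
proof -
  let ?v = "s (hd c)" and ?w = "s (hd c')"
  obtain l where l: "VV ?v * ((VV ?v * x) * VV ?w) \<in> MonSpan l ?v ?w" using corner_MonSpan[OF augm_mult1[OF augm_letter]] by blast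
  then obtain z where z: "z \<in> addspan (Mon l ?v ?w)" "VV ?v * ((VV ?v * x) * VV ?w) \<approx> z" unfolding MonSpan_def by blast
  have "z \<in> G" using z(1)
  proof induction
    case (add x z)
    obtain k a b m where x: "x = sc k * (PP a * (VV m * QQ b))" "walk ?v a m" "walk ?w b m"
      using add.hyps(1) unfolding Mon_def by blast
    have "VV m \<in> G"
    proof (rule ccontr)
      assume mG: "VV m \<notin> G"
      have "length c > 0" "length c' > 0" using c by (auto simp: exitless_def is_cycle_iff)
      then have "c ! (length a mod length c) \<in> set c" "c' ! (length b mod length c') \<in> set c'" by simp_all
      then have "m \<in> s ` set c" "m \<in> s ` set c'"
        using walk_along[OF G c(1) x(2) mG] walk_along[OF G c(2) x(3) mG] by blast+
      then show False using exitless_share[OF G c] mG ne by blast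
    qed
    then have "x \<in> G" unfolding x(1) by (intro lideal_lmult[OF G] lideal_rmult[OF G])
    then show ?case using add.IH lideal_add[OF G] by blast
  qed (simp add: lideal_0 G)
  then have "VV ?v * ((VV ?v * x) * VV ?w) \<in> G" using eqv_mem[OF G z(2)] by blast
  moreover have "VV ?v * ((VV ?v * x) * VV ?w) \<approx> VV ?v * (x * VV ?w)"
    using eqv_rmult[OF rel_VV1[of ?v], of "x * VV ?w"] by (simp add: mult.assoc)
  ultimately show ?thesis using eqv_mem[OF G] by blast
qed

text \<open>The arc \<open>p\<close> of \<open>c0\<close> between the two base points conjugates one
  corner into the other, so any representative of an edge set may be used for its cycle.\<close>

lemma proper_exitless_change_base:
  assumes I: "lideal I" and J: "lideal J" and c: "proper_exitless I c" and c0: "is_cycle E1 r s c0" "set c0 = set c"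
    and sub: "\<And>y. y \<in> I \<Longrightarrow> corner (s (hd c0)) y \<Longrightarrow> y \<in> J" and y: "y \<in> I" "corner (s (hd c)) y"
  shows "y \<in> J"
proof -
  let ?v = "s (hd c)" and ?u = "s (hd c0)"
  have "hd c \<in> set c0" using c c0 by (auto simp: proper_exitless_def is_cycle_iff)
  then obtain p q where p: "c0 = p @ hd c # q" by (auto dest: split_list)
  have w: "walk ?u p ?v" using c0(1) unfolding is_cycle_iff by (subst (asm) (2) p) (auto simp: walk_append)
  have PQ: "QQ p * (PP p * y) \<approx> y"
  proof -
    have "QQ p * (PP p * y) \<approx> QQ p * (PP p * (VV ?v * y))" by (rule eqv_sym) (intro eqv_lmult corner_l[OF y(2)])
    also have "\<dots> = (QQ p * (PP p * VV ?v)) * y" by (simp add: mult.assoc)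
    also have "\<dots> \<approx> VV ?v * y" by (intro eqv_rmult QQ_PP[OF w])
    also have "\<dots> \<approx> y" by (rule corner_l[OF y(2)])
    finally show ?thesis .
  qed
  have QP: "y * (QQ p * (PP p * VV ?v)) \<approx> y"
    using eqv_trans[OF eqv_lmult[OF QQ_PP[OF w], of y] corner_r[OF y(2)]] .
  define z where "z = PP p * (VV ?v * (y * (VV ?v * QQ p)))"
  have "z \<in> I" unfolding z_def by (intro lideal_lmult[OF I] lideal_rmult[OF I] y)
  moreover have "corner ?u z"
  proof (rule cornerI)
    show "VV ?u * z \<approx> z" using eqv_rmult[OF VV_PP[OF w], of "y * (VV ?v * QQ p)"] by (simp add: z_def mult.assoc)
    show "z * VV ?u \<approx> z" using eqv_lmult[OF VV_QQ[OF w], of "PP p * (VV ?v * y)"] by (simp add: z_def mult.assoc)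
  qed
  ultimately have "z \<in> J" using sub by blast
  then have zJ: "QQ p * (z * (PP p * VV ?v)) \<in> J" by (intro lideal_lmult[OF J] lideal_rmult[OF J])
  have "QQ p * (z * (PP p * VV ?v)) = (QQ p * (PP p * VV ?v)) * (y * (VV ?v * (QQ p * (PP p * VV ?v))))"
    by (simp add: z_def mult.assoc)
  also have "\<dots> \<approx> VV ?v * (y * (VV ?v * VV ?v))" by (intro eqv_mult eqv_refl QQ_PP[OF w])
  also have "\<dots> \<approx> VV ?v * (y * VV ?v)" by (intro eqv_lmult rel_VV1)
  also have "\<dots> \<approx> y" using y(2) by (simp add: corner_def)
  finally show ?thesis using zJ eqv_mem[OF J] by blast
qed

end

section \<open>Representations on infinite paths\<close>

definition fract_const :: "'k::field \<Rightarrow> 'k poly fract" where "fract_const k = to_fract [:k:]"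
definition fract_X :: "'k::field poly fract" where "fract_X = to_fract [:0, 1:]"

lemma fract_const_0 [simp]: "fract_const 0 = 0" and fract_const_1 [simp]: "fract_const 1 = 1" and fract_const_add: "fract_const (a + b) = fract_const a + fract_const b"
  and fract_const_mult: "fract_const (a * b) = fract_const a * fract_const b"
  by (simp_all add: fract_const_def one_pCons[symmetric] to_fract_add[symmetric] to_fract_mult[symmetric]
      del: to_fract_add to_fract_mult)

lemma fract_X_nz [simp]: "fract_X \<noteq> 0" by (simp add: fract_X_def)

lemma to_fract_power: "to_fract (a ^ n) = to_fract a ^ n"
  by (induction n) simp_all

text \<open>\<open>laurent_ideal h\<close> is the principal ideal generated by \<open>h\<close> in the ring of Laurent polynomials,
  viewed inside the field of fractions.\<close>

definition laurent_ideal :: "'k::field poly \<Rightarrow> 'k poly fract set" where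
  "laurent_ideal h = {f. \<exists>n p. f * fract_X ^ n = to_fract (h * p)}"

lemma laurent_ideal_0: "0 \<in> laurent_ideal h"
  unfolding laurent_ideal_def by (auto intro: exI[of _ 0])

lemma laurent_ideal_add: assumes "f \<in> laurent_ideal h" "g \<in> laurent_ideal h" shows "f + g \<in> laurent_ideal h"
proof -
  obtain n p m q where a: "f * fract_X ^ n = to_fract (h * p)" "g * fract_X ^ m = to_fract (h * q)"
    using assms by (auto simp: laurent_ideal_def)
  have "(f + g) * fract_X ^ (n + m) = (f * fract_X ^ n) * fract_X ^ m + (g * fract_X ^ m) * fract_X ^ n"
    by (simp add: algebra_simps power_add)
  also have "\<dots> = to_fract (h * p) * fract_X ^ m + to_fract (h * q) * fract_X ^ n" by (simp only: a)
  also have "\<dots> = to_fract (h * (p * [:0, 1:] ^ m + q * [:0, 1:] ^ n))"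
    by (simp add: fract_X_def to_fract_power algebra_simps)
  finally show ?thesis unfolding laurent_ideal_def by blast
qed

lemma laurent_ideal_sum: "(\<And>i. i \<in> A \<Longrightarrow> f i \<in> laurent_ideal h) \<Longrightarrow> sum f A \<in> laurent_ideal h"
  by (induction A rule: infinite_finite_induct) (auto intro: laurent_ideal_add laurent_ideal_0)

lemma laurent_ideal_mult: assumes "f \<in> laurent_ideal h" "g \<in> laurent_ideal h'" shows "f * g \<in> laurent_ideal (h * h')"
proof -
  obtain n p m q where a: "f * fract_X ^ n = to_fract (h * p)" "g * fract_X ^ m = to_fract (h' * q)"
    using assms by (auto simp: laurent_ideal_def)
  have "(f * g) * fract_X ^ (n + m) = (f * fract_X ^ n) * (g * fract_X ^ m)"
    by (simp add: algebra_simps power_add)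
  also have "\<dots> = to_fract (h * h' * (p * q))" by (simp add: a algebra_simps)
  finally show ?thesis unfolding laurent_ideal_def by blast
qed

lemma laurent_ideal_mult1: "f \<in> laurent_ideal 1 \<Longrightarrow> g \<in> laurent_ideal h \<Longrightarrow> f * g \<in> laurent_ideal h"
  using laurent_ideal_mult[of f 1 g h] by simp

lemma laurent_idealI: "f * fract_X ^ n = to_fract (h * p) \<Longrightarrow> f \<in> laurent_ideal h"
  unfolding laurent_ideal_def by blast

lemma laurent_ideal_to_fract: "to_fract h \<in> laurent_ideal h"
  by (rule laurent_idealI[of _ 0 _ 1]) simp

lemma laurent_ideal_units: "fract_const k \<in> laurent_ideal 1" "fract_X \<in> laurent_ideal 1" "inverse fract_X \<in> laurent_ideal 1" "1 \<in> laurent_ideal 1"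
  using laurent_idealI[of "fract_const k" 0 1 "[:k:]"] laurent_idealI[of fract_X 0 1 "[:0, 1:]"] laurent_idealI[of "inverse fract_X" 1 1 1] laurent_idealI[of 1 0 1 1]
  by (simp_all add: fract_const_def fract_X_def)

lemma to_fract_laurent_ideal: "to_fract f \<in> laurent_ideal h \<Longrightarrow> \<exists>n q. f * [:0, 1:] ^ n = h * q"
  unfolding laurent_ideal_def fract_X_def
  by (auto simp: to_fract_mult[symmetric] to_fract_power[symmetric] simp del: to_fract_mult)

context graph begin

definition twist :: "'e list \<Rightarrow> 'e \<Rightarrow> 'k poly fract" where
  "twist c e = (if e = hd c then fract_X else 1)"

text \<open>The algebra acts on functions on infinite paths by adding and removing initial edges;
  traversing the first edge of \<open>c\<close> is weighted with the indeterminate.\<close>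

fun gen_act :: "'e list \<Rightarrow> ('v, 'e) gen \<Rightarrow> ((nat \<Rightarrow> 'e) \<Rightarrow> 'k poly fract) \<Rightarrow> (nat \<Rightarrow> 'e) \<Rightarrow> 'k poly fract" where
  "gen_act c (Vt v) \<phi> q = (if v \<in> E0 \<and> s (q 0) = v then \<phi> q else 0)"
| "gen_act c (Ed e) \<phi> q = (if e \<in> E1 \<and> q 0 = e then twist c e * \<phi> (\<lambda>i. q (Suc i)) else 0)"
| "gen_act c (Gh e) \<phi> q = (if e \<in> E1 \<and> r e = s (q 0) then inverse (twist c e) * \<phi> (case_nat e q) else 0)"

definition act :: "'e list \<Rightarrow> ('v, 'e, 'k) fa \<Rightarrow> ((nat \<Rightarrow> 'e) \<Rightarrow> 'k poly fract) \<Rightarrow> (nat \<Rightarrow> 'e) \<Rightarrow> 'k poly fract" where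
  "act c f \<phi> q = (\<Sum>w\<in>Poly_Mapping.keys f. fract_const (Poly_Mapping.lookup f w) * foldr (gen_act c) w \<phi> q)"

lemma act_superset:
  assumes "finite S" "Poly_Mapping.keys f \<subseteq> S"
  shows "act c f \<phi> q = (\<Sum>w\<in>S. fract_const (Poly_Mapping.lookup f w) * foldr (gen_act c) w \<phi> q)"
  unfolding act_def using assms by (intro sum.mono_neutral_left) (auto simp: in_keys_iff)

lemma act_add: "act c (f + g) \<phi> q = act c f \<phi> q + act c g \<phi> q"
proof -
  let ?S = "Poly_Mapping.keys f \<union> Poly_Mapping.keys g"
  have "Poly_Mapping.keys (f + g) \<subseteq> ?S" by (rule keys_add)
  then show ?thesis
    by (simp add: act_superset[of ?S] lookup_add fract_const_add distrib_right sum.distrib)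
qed

lemma act_0 [simp]: "act c 0 \<phi> q = 0" by (simp add: act_def)

lemma act_uminus: "act c (- f) \<phi> q = - act c f \<phi> q"
  using act_add[of c f "- f" \<phi> q] by (simp add: eq_neg_iff_add_eq_0 add.commute)

lemma act_diff: "act c (f - g) \<phi> q = act c f \<phi> q - act c g \<phi> q"
  using act_add[of c f "- g" \<phi> q] by (simp add: act_uminus)

lemma act_sum: "act c (sum f A) \<phi> q = (\<Sum>i\<in>A. act c (f i) \<phi> q)"
  by (induction A rule: infinite_finite_induct) (simp_all add: act_add)

lemma act_single: "act c (Poly_Mapping.single w k) \<phi> q = fract_const k * foldr (gen_act c) w \<phi> q"
  by (subst act_superset[of "{w}"]) auto

lemma gen_act_linear: "gen_act c g (\<lambda>q. a * \<phi> q + b * \<psi> q) q = a * gen_act c g \<phi> q + b * gen_act c g \<psi> q"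
  by (cases g) (auto simp: algebra_simps)

lemma wact_linear: "foldr (gen_act c) w (\<lambda>q. a * \<phi> q + b * \<psi> q) q = a * foldr (gen_act c) w \<phi> q + b * foldr (gen_act c) w \<psi> q"
proof (induction w arbitrary: q)
  case (Cons g w)
  have "foldr (gen_act c) w (\<lambda>q. a * \<phi> q + b * \<psi> q) = (\<lambda>q. a * foldr (gen_act c) w \<phi> q + b * foldr (gen_act c) w \<psi> q)"
    using Cons.IH by (intro ext)
  then show ?case by (simp add: gen_act_linear)
qed simp

lemma wact_add: "foldr (gen_act c) w (\<lambda>q. \<phi> q + \<psi> q) q = foldr (gen_act c) w \<phi> q + foldr (gen_act c) w \<psi> q"
  using wact_linear[of c w 1 \<phi> 1 \<psi> q] by simp
lemma wact_scale: "foldr (gen_act c) w (\<lambda>q. a * \<phi> q) q = a * foldr (gen_act c) w \<phi> q"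
  using wact_linear[of c w a \<phi> 0 \<phi> q] by simp
lemma wact_zero: "foldr (gen_act c) w (\<lambda>q. 0) q = 0"
  using wact_scale[of c w 0 "\<lambda>q. 0" q] by simp

lemma act_mult: "act c (f * g) \<phi> q = act c f (act c g \<phi>) q"
proof (induction f rule: fa_induct)
  case zero then show ?case by simp
next
  case (add f f')
  then show ?case by (simp add: distrib_right act_add)
next
  case (single u a)
  show ?case
  proof (induction g rule: fa_induct)
    case zero
    have "act c 0 \<phi> = (\<lambda>q. 0)" by (intro ext) simp
    then show ?case by (simp add: act_single wact_zero)
  next
    case (add g g')
    have "act c (g + g') \<phi> = (\<lambda>q. act c g \<phi> q + act c g' \<phi> q)" by (intro ext act_add)
    then show ?case using add by (simp add: distrib_left act_add act_single wact_add)
  next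
    case (single w b)
    have "act c (Poly_Mapping.single w b) \<phi> = (\<lambda>q. fract_const b * foldr (gen_act c) w \<phi> q)" by (intro ext act_single)
    then show ?case by (simp add: mult_single_list act_single wact_scale fract_const_mult mult.assoc)
  qed
qed

lemma act_letter: "act c (letter g) \<phi> = gen_act c g \<phi>"
  by (intro ext) (simp add: letter_def act_single)

lemma act_sc: "act c (sc k) \<phi> q = fract_const k * \<phi> q" by (simp add: sc_def act_single)

section \<open>Infinite paths ending in a cycle\<close>

definition cycle_tails :: "'e list \<Rightarrow> (nat \<Rightarrow> 'e) set" where
  "cycle_tails c = {q. (\<forall>i. q i \<in> E1 \<and> r (q i) = s (q (Suc i))) \<and> (\<exists>a. \<forall>i\<ge>a. q i \<in> set c)}"

lemma cycle_tails_Suc: "q \<in> cycle_tails c \<Longrightarrow> (\<lambda>i. q (Suc i)) \<in> cycle_tails c"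
  unfolding cycle_tails_def by (auto intro: le_SucI)

lemma cycle_tails_Cons: assumes "q \<in> cycle_tails c" "e \<in> E1" "r e = s (q 0)" shows "case_nat e q \<in> cycle_tails c"
proof -
  obtain a where a: "\<And>i. i \<ge> a \<Longrightarrow> q i \<in> set c" using assms by (auto simp: cycle_tails_def)
  have "case_nat e q i \<in> set c" if "i \<ge> Suc a" for i using a that by (cases i) auto
  moreover have "case_nat e q i \<in> E1 \<and> r (case_nat e q i) = s (case_nat e q (Suc i))" for i
    using assms by (cases i) (auto simp: cycle_tails_def)
  ultimately show ?thesis unfolding cycle_tails_def by blast
qed

text \<open>\<open>cycle_tails c\<close> is closed under adding and removing initial edges, and the
  weights together with their inverses are Laurent polynomials.\<close>

lemma gen_act_laurent_ideal:
  assumes "\<And>q. q \<in> cycle_tails c \<Longrightarrow> \<phi> q \<in> laurent_ideal h" "q \<in> cycle_tails c" shows "gen_act c g \<phi> q \<in> laurent_ideal h"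
  using assms cycle_tails_Suc[OF assms(2)] cycle_tails_Cons[OF assms(2)]
  by (cases g) (auto simp: twist_def intro: laurent_ideal_0 laurent_ideal_mult1 laurent_ideal_units)

lemma act_laurent_ideal:
  assumes "\<And>q. q \<in> cycle_tails c \<Longrightarrow> \<phi> q \<in> laurent_ideal h" "q \<in> cycle_tails c" shows "act c f \<phi> q \<in> laurent_ideal h"
proof -
  have w: "foldr (gen_act c) w \<phi> q \<in> laurent_ideal h" if "q \<in> cycle_tails c" for w q
    using that by (induction w arbitrary: q) (auto intro: assms(1) gen_act_laurent_ideal)
  show ?thesis unfolding act_def by (intro laurent_ideal_sum laurent_ideal_mult1 laurent_ideal_units w assms(2))
qed

text \<open>The kernel of the action on functions with values in Laurent polynomials modulo
  \<open>h\<close>. For \<open>h = 0\<close> it is the annihilator of all Laurent-valued functions,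
  and for the zero or nonunit \<open>h\<close> used later it detects whether a vertex acts at
  all.\<close>

definition tail_ann :: "'e list \<Rightarrow> 'k poly \<Rightarrow> ('v, 'e, 'k) fa set" where
  "tail_ann c h = {f \<in> augm. \<forall>\<phi>. (\<forall>q\<in>cycle_tails c. \<phi> q \<in> laurent_ideal 1) \<longrightarrow> (\<forall>q\<in>cycle_tails c. act c f \<phi> q \<in> laurent_ideal h)}"

lemma twist_nz [simp]: "twist c e \<noteq> 0" by (simp add: twist_def)

lemma act_VV: "act c (VV v) \<phi> q = (if v \<in> E0 \<and> s (q 0) = v then \<phi> q else 0)"
  by (simp add: act_letter)

lemma cycle_tailsD: "q \<in> cycle_tails c \<Longrightarrow> q i \<in> E1" "q \<in> cycle_tails c \<Longrightarrow> r (q i) = s (q (Suc i))"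
  by (auto simp: cycle_tails_def)

lemma cycle_tails_s: "q \<in> cycle_tails c \<Longrightarrow> s (q i) \<in> E0" using cycle_tailsD s_E0 by blast

lemma case_nat_shift: "case_nat (q 0) (\<lambda>i. q (Suc i)) = q"
  by (rule ext) (simp split: nat.split)

lemma act_DG: "q \<in> cycle_tails c \<Longrightarrow> act c (DD e * GG e) \<phi> q = (if e \<in> E1 \<and> q 0 = e then \<phi> q else 0)"
  using cycle_tailsD(2)[of q c 0] case_nat_shift[of q] by (auto simp: act_mult act_letter)

lemma act_nu:
  assumes "finite F" "F \<subseteq> out v" "q \<in> cycle_tails c"
  shows "act c (nu v F) \<phi> q = (if s (q 0) = v \<and> q 0 \<notin> F then \<phi> q else 0)"
proof -
  have "(\<Sum>e\<in>F. act c (DD e * GG e) \<phi> q) = (\<Sum>e\<in>F. if e = q 0 then \<phi> q else 0)"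
    using assms by (intro sum.cong) (auto simp: act_DG out_def)
  also have "\<dots> = (if q 0 \<in> F then \<phi> q else 0)" using assms(1) by (simp add: sum.delta)
  finally have "act c (nu v F) \<phi> q = (if v \<in> E0 \<and> s (q 0) = v then \<phi> q else 0) - (if q 0 \<in> F then \<phi> q else 0)"
    by (simp add: nu_def act_diff act_sum act_VV)
  then show ?thesis using assms cycle_tails_s[OF assms(3), of 0] by (auto simp: out_def)
qed

text \<open>The relations hold only at genuine paths: for instance \<open>DD e * VV (r e)\<close>
  acts as \<open>DD e\<close> because consecutive edges of \<open>q\<close> fit together.\<close>

lemma act_rels: assumes "x \<in> rels" "q \<in> cycle_tails c" shows "act c x \<phi> q = 0"
proof -
  note T = cycle_tailsD[OF assms(2)] cycle_tails_s[OF assms(2)]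
  have CK: "act c (VV v - (\<Sum>e\<in>out v. DD e * GG e)) \<phi> q = 0" if "regular_vertex E0 E1 s v" for v
    using act_nu[of "out v" v q c \<phi>] that assms(2) T(1)[of 0] by (auto simp: nu_def regular_vertex_def out_def)
  have junk: "gen_act c g \<phi> q = 0" if "g \<notin> gens E0 E1" for g using that by (cases g) (auto simp: gens_def)
  show ?thesis
    using assms(1) unfolding rels_def Un_iff
    by (elim disjE CollectE exE conjE imageE)
       (use T CK junk s_E0 in \<open>auto simp: act_diff act_mult act_letter\<close>)
qed

lemma lideal_tail_ann: "lideal (tail_ann c h)"
  unfolding lideal_def
proof (intro conjI ballI allI)
  show "tail_ann c h \<subseteq> augm" by (auto simp: tail_ann_def)
  show "0 \<in> tail_ann c h" by (simp add: tail_ann_def laurent_ideal_0)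
  fix x assume x: "x \<in> tail_ann c h"
  {
    fix y assume y: "y \<in> tail_ann c h"
    have "act c x \<phi> q - act c y \<phi> q \<in> laurent_ideal h" if "\<forall>q\<in>cycle_tails c. \<phi> q \<in> laurent_ideal 1" "q \<in> cycle_tails c" for \<phi> q
    proof -
      have "act c x \<phi> q \<in> laurent_ideal h" "act c y \<phi> q \<in> laurent_ideal h" using x y that by (auto simp: tail_ann_def)
      moreover have "- 1 \<in> laurent_ideal (1 :: 'k poly)" by (rule laurent_idealI[of _ 0 _ "- 1"]) simp
      ultimately show ?thesis using laurent_ideal_add[of "act c x \<phi> q" h "(- 1) * act c y \<phi> q"] laurent_ideal_mult1 by fastforce
    qed
    then show "x - y \<in> tail_ann c h" using x y by (auto simp: tail_ann_def act_diff augm_diff)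
  }
  fix a
  have "act c a (act c x \<phi>) q \<in> laurent_ideal h" if "\<forall>q\<in>cycle_tails c. \<phi> q \<in> laurent_ideal 1" "q \<in> cycle_tails c" for \<phi> q
    by (rule act_laurent_ideal[OF _ that(2)]) (use x that in \<open>auto simp: tail_ann_def\<close>)
  then show "a * x \<in> tail_ann c h" using x by (auto simp: tail_ann_def augm_mult2 act_mult)
  show "x * a \<in> tail_ann c h" using x act_laurent_ideal[of c _ 1 _ a] by (auto simp: tail_ann_def augm_mult1 act_mult)
next
  show "rels \<subseteq> tail_ann c h" using rels_augm by (auto simp: tail_ann_def act_rels laurent_ideal_0)
qed

lemma VV_tail_ann: "(\<And>q. q \<in> cycle_tails c \<Longrightarrow> s (q 0) \<noteq> v) \<Longrightarrow> VV v \<in> tail_ann c h"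
  by (auto simp: tail_ann_def act_VV laurent_ideal_0)

text \<open>Tested on the constant function 1, a vertex at which some tail starts would produce the
  value 1.\<close>

lemma VV_tail_annD: assumes "VV v \<in> tail_ann c h" "1 \<notin> laurent_ideal h" "q \<in> cycle_tails c" shows "s (q 0) \<noteq> v"
proof
  assume "s (q 0) = v"
  moreover have "act c (VV v) (\<lambda>q. 1) q \<in> laurent_ideal h" using assms laurent_ideal_units(4) by (auto simp: tail_ann_def)
  ultimately show False using cycle_tails_s[OF assms(3), of 0] assms(2) by (auto simp: act_VV)
qed

lemma nu_tail_ann:
  assumes "finite F" "F \<subseteq> out v" "\<And>q. q \<in> cycle_tails c \<Longrightarrow> s (q 0) = v \<Longrightarrow> q 0 \<in> F"
  shows "nu v F \<in> tail_ann c h"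
proof -
  have "nu v F \<in> augm" by (auto simp: nu_def intro!: augm_intros)
  then show ?thesis using assms by (auto simp: tail_ann_def act_nu laurent_ideal_0)
qed

lemma nu_tail_annD:
  assumes "nu v F \<in> tail_ann c h" "1 \<notin> laurent_ideal h" "finite F" "F \<subseteq> out v" "q \<in> cycle_tails c" "s (q 0) = v"
  shows "q 0 \<in> F"
proof (rule ccontr)
  assume "q 0 \<notin> F"
  moreover have "act c (nu v F) (\<lambda>q. 1) q \<in> laurent_ideal h" using assms laurent_ideal_units(4) by (auto simp: tail_ann_def)
  ultimately show False using assms by (simp add: act_nu)
qed

text \<open>A path that enters the hereditary set \<open>H\<close> stays in it, but its tail runs on
  \<open>c\<close>, which misses \<open>H\<close>.\<close>

lemma cycle_tails_avoid:
  assumes "\<And>e. e \<in> E1 \<Longrightarrow> s e \<in> H \<Longrightarrow> r e \<in> H" "s ` set c \<inter> H = {}" "q \<in> cycle_tails c"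
  shows "s (q i) \<notin> H"
proof
  assume "s (q i) \<in> H"
  then have "s (q (i + j)) \<in> H" for j
    by (induction j) (use assms(1) cycle_tailsD[OF assms(3)] in \<open>auto, metis\<close>)
  moreover obtain a where "\<And>i. i \<ge> a \<Longrightarrow> q i \<in> set c" using assms(3) unfolding cycle_tails_def by blast
  then have "q (i + a) \<in> set c" by simp
  ultimately show False using assms(2) by blast
qed

lemma act_PP:
  assumes "q \<in> cycle_tails c" "set p \<subseteq> E1"
  shows "act c (PP p) \<phi> q = (if \<forall>i<length p. q i = p ! i then prod_list (map (twist c) p) * \<phi> (\<lambda>i. q (i + length p)) else 0)"
  using assms
proof (induction p arbitrary: q)
  case Nil
  then show ?case using act_sc[of c 1 \<phi> q] by simp
next
  case (Cons e p)
  have "act c (PP (e # p)) \<phi> q = (if q 0 = e then twist c e * act c (PP p) \<phi> (\<lambda>i. q (Suc i)) else 0)"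
    using Cons.prems by (simp add: PP_Cons act_mult act_letter)
  also have "\<dots> = (if q 0 = e then twist c e * (if \<forall>i<length p. q (Suc i) = p ! i then prod_list (map (twist c) p) * \<phi> (\<lambda>i. q (Suc (i + length p))) else 0) else 0)"
    using Cons.IH[OF cycle_tails_Suc[OF Cons.prems(1)]] Cons.prems(2) by simp
  also have "\<dots> = (if \<forall>i<length (e # p). q i = (e # p) ! i then prod_list (map (twist c) (e # p)) * \<phi> (\<lambda>i. q (i + length (e # p))) else 0)"
    by (auto simp: less_Suc_eq_0_disj mult.assoc)
  finally show ?case .
qed

section \<open>The action of a cycle on its own infinite path\<close>

context
  fixes c v assumes c: "is_cycle E1 r s c" and v: "v = s (hd c)"
begin

definition "cycle_word i = c ! (i mod length c)"

lemma cyc_facts: "c \<noteq> []" "set c \<subseteq> E1" "distinct (map s c)" "length c > 0"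
  using c by (auto simp: is_cycle_def is_path_def)

lemma cycle_word_cycle_tails: "cycle_word \<in> cycle_tails c"
proof -
  have "c ! (i mod length c) \<in> set c" for i using cyc_facts by simp
  moreover have "r (cycle_word i) = s (cycle_word (Suc i))" for i
    using cycle_next[OF c, of "i mod length c"] cyc_facts by (simp add: cycle_word_def mod_Suc_eq)
  ultimately show ?thesis using cyc_facts(2) by (auto simp: cycle_tails_def cycle_word_def)
qed

lemma cycle_word_0: "s (cycle_word 0) = v" using cyc_facts v by (simp add: cycle_word_def hd_conv_nth)

text \<open>Only the first edge carries the weight, and distinct sources prevent it from recurring
  within one turn.\<close>

lemma twist_cycle: "prod_list (map (twist c) c) = fract_X"
proof -
  obtain e p where ep: "c = e # p" using cyc_facts by (cases c) auto
  then have "e \<notin> set p" using cyc_facts(3) by auto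
  then have "map (twist c) p = map (\<lambda>_. 1) p" using ep by (auto simp: twist_def)
  moreover have "prod_list (map (\<lambda>_. 1) p) = (1 :: 'k poly fract)" by (induction p) auto
  ultimately have "prod_list (map (twist c) p) = 1" by (simp only:)
  moreover have "prod_list (map (twist c) c) = twist c e * prod_list (map (twist c) p)" by (subst (2) ep) simp
  ultimately show ?thesis using ep by (simp add: twist_def)
qed

text \<open>Removing one turn of \<open>c\<close> does not change the periodic word, so there
  \<open>c\<close> acts as multiplication by the indeterminate.\<close>

lemma act_eval_at_cycle_word: "act c (eval_at (cyc_elem c) f) \<phi> cycle_word = to_fract f * \<phi> cycle_word"
proof (induction f)
  case (pCons a f)
  have sh: "(\<lambda>i. cycle_word (i + length c)) = cycle_word" by (rule ext) (simp add: cycle_word_def)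
  have "act c (cyc_elem c * eval_at (cyc_elem c) f) \<phi> cycle_word = fract_X * (to_fract f * \<phi> cycle_word)"
  proof -
    have "act c (PP c) \<psi> cycle_word = fract_X * \<psi> cycle_word" for \<psi>
    proof -
      have cond: "\<forall>i<length c. cycle_word i = c ! i" by (simp add: cycle_word_def)
      show ?thesis unfolding act_PP[OF cycle_word_cycle_tails cyc_facts(2)] if_P[OF cond] sh twist_cycle ..
    qed
    moreover have "cyc_elem c * eval_at (cyc_elem c) f = PP c * (VV v * eval_at (cyc_elem c) f)" by (simp add: cyc_elem_def v mult.assoc)
    ultimately show ?thesis using cycle_word_0 walk_c(2)[OF c v] pCons.IH by (simp add: act_mult act_VV)
  qed
  then have "act c (eval_at (cyc_elem c) (pCons a f)) \<phi> cycle_word = (fract_const a + fract_X * to_fract f) * \<phi> cycle_word"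
    by (simp add: act_add act_sc algebra_simps)
  also have "fract_const a + fract_X * to_fract f = to_fract (pCons a f)"
    by (simp add: fract_const_def fract_X_def to_fract_add[symmetric] to_fract_mult[symmetric] del: to_fract_add to_fract_mult)
  finally show ?case .
qed simp

lemma act_cyc_poly_cycle_word: "act c (cyc_poly c f) \<phi> cycle_word = to_fract f * \<phi> cycle_word"
  using cycle_word_0 walk_c(2)[OF c v] by (simp add: cyc_poly_def v[symmetric] act_mult act_eval_at_cycle_word act_VV)

lemma cyc_poly_tail_annD: assumes "cyc_poly c f \<in> tail_ann c h" shows "\<exists>n q. f * [:0, 1:] ^ n = h * q"
proof -
  have "act c (cyc_poly c f) (\<lambda>q. 1) cycle_word \<in> laurent_ideal h" using assms cycle_word_cycle_tails laurent_ideal_units(4) by (auto simp: tail_ann_def)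
  then show ?thesis using to_fract_laurent_ideal by (simp add: act_cyc_poly_cycle_word)
qed

text \<open>The vertex in front kills all values except at tails starting in \<open>v\<close>; by
  assumption that is only the periodic word, where the element multiplies by
  \<open>h\<close>.\<close>

lemma cyc_poly_tail_ann:
  assumes "\<And>q. q \<in> cycle_tails c \<Longrightarrow> s (q 0) = v \<Longrightarrow> q = cycle_word"
  shows "cyc_poly c h \<in> tail_ann c h"
proof -
  have "act c (VV v * cyc_poly c h) \<phi> q \<in> laurent_ideal h" if "\<forall>q\<in>cycle_tails c. \<phi> q \<in> laurent_ideal 1" "q \<in> cycle_tails c" for \<phi> q
  proof (cases "s (q 0) = v")
    case True
    then have "q = cycle_word" using assms that by blast
    then show ?thesis using laurent_ideal_mult1[of "\<phi> cycle_word" "to_fract h" h] that laurent_ideal_to_fract cycle_word_0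
      by (auto simp: act_mult act_VV act_cyc_poly_cycle_word laurent_ideal_0 mult.commute)
  qed (simp add: act_mult act_VV laurent_ideal_0)
  then have "VV v * cyc_poly c h \<in> tail_ann c h" by (auto simp: tail_ann_def augm_mult1)
  moreover have "VV v * cyc_poly c h \<approx> cyc_poly c h" by (rule corner_l[OF cyc_poly_corner[OF c v]])
  ultimately show ?thesis using eqv_mem[OF lideal_tail_ann] by blast
qed

end

lemma cycle_tails_on_cycle:
  assumes c': "is_cycle E1 r s c'"
    and ex: "\<And>e f. e \<in> set c' \<Longrightarrow> f \<in> E1 \<Longrightarrow> s f = s e \<Longrightarrow> r f \<notin> H \<Longrightarrow> f = e"
    and q: "q \<in> cycle_tails c" "\<And>i. s (q i) \<notin> H" "j < length c'" "s (q 0) = s (c' ! j)"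
  shows "q i = c' ! ((j + i) mod length c')"
proof -
  have c0: "length c' > 0" using q(3) by linarith
  have step: "q i = c' ! k" if "s (q i) = s (c' ! k)" "k < length c'" for i k
    using that ex[of "c' ! k" "q i"] cycle_tailsD[OF q(1), of i] q(2)[of "Suc i"] by auto
  show ?thesis
  proof (induction i)
    case 0
    then show ?case using step[of 0 j] q by simp
  next
    case (Suc i)
    have "s (q (Suc i)) = s (c' ! (Suc (j + i) mod length c'))"
      using cycle_next[OF c', of "(j + i) mod length c'"] Suc c0 cycle_tailsD(2)[OF q(1), of i] by (simp add: mod_Suc_eq)
    then show ?case using step[of "Suc i" "Suc (j + i) mod length c'"] c0 by simp
  qed
qed

text \<open>Distinct sources make the next edge within \<open>c\<close> unique, so the tail runs
  round the cycle and meets every edge of it again.\<close>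

lemma cycle_tails_cover:
  assumes c: "is_cycle E1 r s c" and q: "q \<in> cycle_tails c"
  shows "\<exists>a. set c \<subseteq> {q i | i. i \<ge> a} \<and> (\<forall>i\<ge>a. q i \<in> set c)"
proof -
  obtain a where a: "\<And>i. i \<ge> a \<Longrightarrow> q i \<in> set c" using q by (auto simp: cycle_tails_def)
  obtain j where j: "j < length c" "q a = c ! j" using a[of a] by (auto simp: in_set_conv_nth)
  have c0: "length c > 0" "distinct (map s c)" using c by (auto simp: is_cycle_def is_path_def)
  have inj: "e = f" if "e \<in> set c" "f \<in> set c" "s e = s f" for e f
    using that c0(2) by (auto simp: distinct_map dest: inj_onD)
  have st: "q (a + t) = c ! ((j + t) mod length c)" for t
  proof (induction t)
    case 0 then show ?case using j by simp
  next
    case (Suc t)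
    have "s (q (Suc (a + t))) = s (c ! (Suc (j + t) mod length c))"
      using cycle_next[OF c, of "(j + t) mod length c"] Suc c0 cycle_tailsD(2)[OF q, of "a + t"] by (simp add: mod_Suc_eq)
    then show ?case using inj[OF a[of "Suc (a + t)"]] c0 by simp
  qed
  have "set c \<subseteq> {q i | i. i \<ge> a}"
  proof
    fix e assume "e \<in> set c"
    then obtain k where k: "k < length c" "e = c ! k" by (auto simp: in_set_conv_nth)
    have "(j + (length c - j + k)) mod length c = k" using k j by simp
    then have "e = q (a + (length c - j + k))" using st k by simp
    then show "e \<in> {q i | i. i \<ge> a}" by auto
  qed
  then show ?thesis using a by blast
qed

text \<open>A path that avoids \<open>H\<close> and starts on \<open>c'\<close> can never leave
  \<open>c'\<close>, while its tail runs through all of \<open>c\<close>.\<close>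

lemma cycle_tails_other_cycle:
  assumes c: "is_cycle E1 r s c" and c': "is_cycle E1 r s c'"
    and ex: "\<And>e f. e \<in> set c' \<Longrightarrow> f \<in> E1 \<Longrightarrow> s f = s e \<Longrightarrow> r f \<notin> H \<Longrightarrow> f = e"
    and q: "q \<in> cycle_tails c" "\<And>i. s (q i) \<notin> H" "s (q 0) = s (hd c')"
  shows "set c' = set c" and "c' = c \<Longrightarrow> q = cycle_word c"
proof -
  have c0: "length c' > 0" "c' \<noteq> []" using c' by (auto simp: is_cycle_def is_path_def)
  have al: "q i = c' ! (i mod length c')" for i
  proof -
    have "s (q 0) = s (c' ! 0)" using q(3) c0 by (simp add: hd_conv_nth)
    then have "q i = c' ! ((0 + i) mod length c')"
      by (intro cycle_tails_on_cycle[OF c' _ q(1) _ c0(1), where H = H] ex q(2))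
    then show ?thesis by simp
  qed
  then show "c' = c \<Longrightarrow> q = cycle_word c" by (intro ext) (simp add: cycle_word_def[OF c refl])
  obtain a where a: "set c \<subseteq> {q i | i. i \<ge> a}" "\<forall>i\<ge>a. q i \<in> set c" using cycle_tails_cover[OF c q(1)] by (elim exE conjE)
  have "q i \<in> set c'" for i unfolding al[of i] using c0(1) by (intro nth_mem) simp
  then have "set c \<subseteq> set c'" using a(1) by blast
  moreover have "set c' \<subseteq> set c"
  proof
    fix e assume "e \<in> set c'"
    then obtain k where k: "k < length c'" "e = c' ! k" by (auto simp: in_set_conv_nth)
    have "e = q (a * length c' + k)" unfolding al[of "a * length c' + k"] using k by simp
    moreover have "a \<le> a * length c' + k" using c0(1) by (cases "length c'") auto
    ultimately show "e \<in> set c" using a(2) by blast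
  qed
  ultimately show "set c' = set c" by blast
qed

end

section \<open>Products and semiprime ideals\<close>

context graph begin

text \<open>First with \<open>x\<close> fixed and then with \<open>b\<close> fixed, the admissible
  other factors form an ideal. The arbitrary \<open>z\<close> in the middle makes these residuals
  two-sided.\<close>

lemma lgen_prod:
  assumes J: "lideal J" and X: "X \<subseteq> augm" and Y: "Y \<subseteq> augm"
    and XY: "\<And>x y z. x \<in> X \<Longrightarrow> y \<in> Y \<Longrightarrow> x * (z * y) \<in> J"
    and a: "a \<in> lgen X" and b: "b \<in> lgen Y"
  shows "a * b \<in> J"
proof -
  have r: "lideal {y \<in> augm. \<forall>z. x * (z * y) \<in> J}" for x
    unfolding lideal_def
  proof (intro conjI ballI allI)
    show "rels \<subseteq> {y \<in> augm. \<forall>z. x * (z * y) \<in> J}"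
      using rels_augm J lideal_lmult[OF J] by (auto simp: lideal_def)
    fix y w assume "y \<in> {y \<in> augm. \<forall>z. x * (z * y) \<in> J}" "w \<in> {y \<in> augm. \<forall>z. x * (z * y) \<in> J}"
    then show "y - w \<in> {y \<in> augm. \<forall>z. x * (z * y) \<in> J}"
      using lideal_diff[OF J] by (auto simp: right_diff_distrib intro: augm_diff)
  next
    fix y c assume y: "y \<in> {y \<in> augm. \<forall>z. x * (z * y) \<in> J}"
    have "x * (z * (c * y)) = x * ((z * c) * y)" "x * (z * (y * c)) = (x * (z * y)) * c" for z by (simp_all add: mult.assoc)
    then show "c * y \<in> {y \<in> augm. \<forall>z. x * (z * y) \<in> J}" "y * c \<in> {y \<in> augm. \<forall>z. x * (z * y) \<in> J}"
      using y lideal_rmult[OF J] by (auto intro: augm_mult1 augm_mult2)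
  qed (auto simp: lideal_0 J)
  have 1: "x * (z * b) \<in> J" if "x \<in> X" for x z
    using lgen_least[OF r, of Y x] XY[OF that] Y b by auto
  have l: "lideal {x \<in> augm. \<forall>z. x * (z * b) \<in> J}"
    unfolding lideal_def
  proof (intro conjI ballI allI)
    show "rels \<subseteq> {x \<in> augm. \<forall>z. x * (z * b) \<in> J}"
      using rels_augm J lideal_rmult[OF J] by (auto simp: lideal_def)
    fix y w assume "y \<in> {x \<in> augm. \<forall>z. x * (z * b) \<in> J}" "w \<in> {x \<in> augm. \<forall>z. x * (z * b) \<in> J}"
    then show "y - w \<in> {x \<in> augm. \<forall>z. x * (z * b) \<in> J}"
      using lideal_diff[OF J] by (auto simp: left_diff_distrib intro: augm_diff)
  next
    fix y c assume y: "y \<in> {x \<in> augm. \<forall>z. x * (z * b) \<in> J}"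
    have "(c * y) * (z * b) = c * (y * (z * b))" "(y * c) * (z * b) = y * ((c * z) * b)" for z by (simp_all add: mult.assoc)
    then show "c * y \<in> {x \<in> augm. \<forall>z. x * (z * b) \<in> J}" "y * c \<in> {x \<in> augm. \<forall>z. x * (z * b) \<in> J}"
      using y lideal_lmult[OF J] by (auto intro: augm_mult1 augm_mult2)
  qed (auto simp: lideal_0 J)
  \<comment> \<open>The middle factor may be \<open>1\<close>, since it ranges over the free algebra
    with unit.\<close>
  have "a * (1 * b) \<in> J" using lgen_least[OF l, of X] 1 X a by blast
  then show ?thesis by simp
qed

definition addgrp :: "('v, 'e, 'k) fa set \<Rightarrow> bool" where
  "addgrp J \<longleftrightarrow> J \<subseteq> augm \<and> 0 \<in> J \<and> (\<forall>x\<in>J. \<forall>y\<in>J. x - y \<in> J)"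

lemma lideal_addgrp: "lideal J \<Longrightarrow> addgrp J" by (auto simp: lideal_def addgrp_def)

text \<open>The preimage of \<open>ideal_prod\<close>: additive subgroups of the quotient correspond
  to those containing \<open>NN\<close>.\<close>

definition lprod :: "('v, 'e, 'k) fa set \<Rightarrow> ('v, 'e, 'k) fa set \<Rightarrow> ('v, 'e, 'k) fa set" where
  "lprod A B = \<Inter>{J. addgrp J \<and> NN \<subseteq> J \<and> {a * b | a b. a \<in> A \<and> b \<in> B} \<subseteq> J}"

lemma lprod_least: "lideal J \<Longrightarrow> (\<And>a b. a \<in> A \<Longrightarrow> b \<in> B \<Longrightarrow> a * b \<in> J) \<Longrightarrow> lprod A B \<subseteq> J"
  unfolding lprod_def using lideal_addgrp NN_least by blast

lemma lprodI: "a \<in> A \<Longrightarrow> b \<in> B \<Longrightarrow> a * b \<in> lprod A B" unfolding lprod_def by blast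

lemma addgrp_lprod: assumes "A \<subseteq> augm" shows "addgrp (lprod A B)"
proof -
  have "addgrp augm \<and> NN \<subseteq> augm \<and> {a * b | a b. a \<in> A \<and> b \<in> B} \<subseteq> augm"
    using assms lideal_addgrp[OF lideal_augm_self] NN_least[OF lideal_augm_self] by (auto intro: augm_mult1)
  then have "lprod A B \<subseteq> augm" unfolding lprod_def by blast
  then show ?thesis unfolding addgrp_def by (auto simp: lprod_def addgrp_def)
qed

lemma lideal_lprod: assumes A: "lideal A" and B: "lideal B" shows "lideal (lprod A B)"
proof -
  have g: "addgrp (lprod A B)" by (rule addgrp_lprod) (use A in \<open>auto simp: lideal_def\<close>)
  have N: "NN \<subseteq> lprod A B" unfolding lprod_def by blast
  have sub: "lprod A B \<subseteq> augm" using g by (simp add: addgrp_def)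
  have "lprod A B \<subseteq> {x \<in> augm. c * x \<in> lprod A B}" for c
  proof -
    have "addgrp {x \<in> augm. c * x \<in> lprod A B}" using g by (auto simp: addgrp_def right_diff_distrib intro: augm_diff)
    moreover have "NN \<subseteq> {x \<in> augm. c * x \<in> lprod A B}"
      using N lideal_lmult[OF lideal_NN] lideal_augm[OF lideal_NN] by blast
    moreover have "c * (a * b) \<in> lprod A B" if "a \<in> A" "b \<in> B" for a b
      using lprodI[OF lideal_lmult[OF A that(1), of c] that(2)] by (simp add: mult.assoc)
    then have "{a * b | a b. a \<in> A \<and> b \<in> B} \<subseteq> {x \<in> augm. c * x \<in> lprod A B}"
      using lideal_augm[OF A] by (auto intro: augm_mult1)
    ultimately show ?thesis by (subst lprod_def) blast
  qed
  moreover have "lprod A B \<subseteq> {x \<in> augm. x * c \<in> lprod A B}" for c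
  proof -
    have "addgrp {x \<in> augm. x * c \<in> lprod A B}" using g by (auto simp: addgrp_def left_diff_distrib intro: augm_diff)
    moreover have "NN \<subseteq> {x \<in> augm. x * c \<in> lprod A B}"
      using N lideal_rmult[OF lideal_NN] lideal_augm[OF lideal_NN] by blast
    moreover have "(a * b) * c \<in> lprod A B" if "a \<in> A" "b \<in> B" for a b
      using lprodI[OF that(1) lideal_rmult[OF B that(2), of c]] by (simp add: mult.assoc)
    then have "{a * b | a b. a \<in> A \<and> b \<in> B} \<subseteq> {x \<in> augm. x * c \<in> lprod A B}"
      using lideal_augm[OF A] by (auto intro: augm_mult1)
    ultimately show ?thesis by (subst lprod_def) blast
  qed
  ultimately show ?thesis using g N NN_rels unfolding lideal_def addgrp_def by blast
qed

fun lprods :: "('v, 'e, 'k) fa set list \<Rightarrow> ('v, 'e, 'k) fa set" where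
  "lprods [] = augm"
| "lprods [A] = A"
| "lprods (A # B # As) = lprod A (lprods (B # As))"

lemma lideal_lprods: "\<forall>P\<in>set Ps. lideal P \<Longrightarrow> lideal (lprods Ps)"
  by (induction Ps rule: lprods.induct) (auto intro: lideal_lprod lideal_augm_self)

lemma lprods_sub: "\<forall>P\<in>set Ps. lideal P \<Longrightarrow> P \<in> set Ps \<Longrightarrow> lprods Ps \<subseteq> P"
proof (induction Ps rule: lprods.induct)
  case (3 A B As)
  have l: "lideal (lprods (B # As))" using 3 by (intro lideal_lprods) auto
  have "lprod A (lprods (B # As)) \<subseteq> A" using 3 by (intro lprod_least lideal_rmult) auto
  moreover have "lprod A (lprods (B # As)) \<subseteq> lprods (B # As)" using l by (intro lprod_least lideal_lmult) auto
  ultimately show ?case using 3 by auto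
qed auto

text \<open>A local unit of \<open>x\<close>, being a sum of vertices, exhibits \<open>x\<close> as
  a product modulo \<open>NN\<close>.\<close>

lemma lprod_unit_r: assumes J: "lideal J" shows "lprod J augm = J"
proof
  show "lprod J augm \<subseteq> J" using J by (intro lprod_least lideal_rmult) auto
  show "J \<subseteq> lprod J augm"
  proof
    fix x assume x: "x \<in> J"
    obtain U where "x * sum VV U \<approx> x" using local_unit[OF lideal_augm[OF J x]] by blast
    moreover have "x * sum VV U \<in> lprod J augm" by (intro lprodI x augm_sum augm_letter)
    ultimately show "x \<in> lprod J augm" using eqv_mem[OF lideal_lprod[OF J lideal_augm_self]] by blast
  qed
qed

lemma lprod_unit_l: assumes J: "lideal J" shows "lprod augm J = J"
proof
  show "lprod augm J \<subseteq> J" using J by (intro lprod_least lideal_lmult) auto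
  show "J \<subseteq> lprod augm J"
  proof
    fix x assume x: "x \<in> J"
    obtain U where "sum VV U * x \<approx> x" using local_unit[OF lideal_augm[OF J x]] by blast
    moreover have "sum VV U * x \<in> lprod augm J" by (intro lprodI x augm_sum augm_letter)
    ultimately show "x \<in> lprod augm J" using eqv_mem[OF lideal_lprod[OF lideal_augm_self J]] by blast
  qed
qed

text \<open>Semiprimality without properness: padding the factorisations of the \<open>f\<^sub>c\<close> with units can produce
  the whole algebra as a factor.\<close>

definition quasi_semiprime :: "('v, 'e, 'k) fa set \<Rightarrow> bool" where
  "quasi_semiprime J \<longleftrightarrow> lideal J \<and> (\<forall>A. lideal A \<longrightarrow> (\<forall>a\<in>A. \<forall>b\<in>A. a * b \<in> J) \<longrightarrow> A \<subseteq> J)"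

lemma lprods_drop_improper:
  assumes "Js \<noteq> []" "\<forall>J\<in>set Js. quasi_semiprime J" "lprods Js \<noteq> augm"
  shows "\<exists>Ps. Ps \<noteq> [] \<and> (\<forall>P\<in>set Ps. quasi_semiprime P \<and> P \<noteq> augm) \<and> lprods Ps = lprods Js"
  using assms
proof (induction Js rule: lprods.induct)
  case (2 A)
  then show ?case by (intro exI[of _ "[A]"]) auto
next
  case (3 A B As)
  have A: "quasi_semiprime A" "lideal A" using 3 by (auto simp: quasi_semiprime_def)
  let ?R = "lprods (B # As)"
  have R: "lideal ?R" using 3 by (intro lideal_lprods) (auto simp: quasi_semiprime_def)
  show ?case
  proof (cases "?R = augm")
    case True
    then have "lprods (A # B # As) = A" using lprod_unit_r[OF A(2)] by simp
    then show ?thesis using A 3 by (intro exI[of _ "[A]"]) auto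
  next
    case False
    then obtain Ps where Ps: "Ps \<noteq> []" "\<forall>P\<in>set Ps. quasi_semiprime P \<and> P \<noteq> augm" "lprods Ps = ?R" using 3 by auto
    show ?thesis
    proof (cases "A = augm")
      case True
      then have "lprods (A # B # As) = ?R" using lprod_unit_l[OF R] by simp
      then show ?thesis using Ps by auto
    next
      case False
      obtain C Cs where "Ps = C # Cs" using Ps(1) by (cases Ps) auto
      then have "lprods (A # Ps) = lprods (A # B # As)" using Ps(3) by simp
      then show ?thesis using Ps A False by (intro exI[of _ "A # Ps"]) auto
    qed
  qed
qed simp

section \<open>Ideals generated by cycle polynomials\<close>

definition breaking_elem :: "'v set \<Rightarrow> 'v \<Rightarrow> ('v, 'e, 'k) fa" where
  "breaking_elem H v = nu v {e \<in> out v. r e \<notin> H}"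

definition graded_gens :: "'v set \<Rightarrow> 'v set \<Rightarrow> ('v, 'e, 'k) fa set" where
  "graded_gens H S = VV ` H \<union> breaking_elem H ` S"

text \<open>Cycles are counted by edge sets, but a polynomial in a cycle needs a base point; this
  fixes one for each edge set.\<close>

definition cycle_of :: "'e set \<Rightarrow> 'e list" where
  "cycle_of X = (SOME c. is_cycle E1 r s c \<and> set c = X)"

lemma cycle_of: assumes "is_cycle E1 r s c" shows "is_cycle E1 r s (cycle_of (set c)) \<and> set (cycle_of (set c)) = set c"
  unfolding cycle_of_def by (rule someI[of _ c]) (use assms in simp)

definition admissible :: "'v set \<Rightarrow> 'v set \<Rightarrow> bool" where
  "admissible H S \<longleftrightarrow> H \<subseteq> E0 \<and> (\<forall>e\<in>E1. s e \<in> H \<longrightarrow> r e \<in> H) \<and> S \<subseteq> breaking_verts E0 E1 r s H"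

text \<open>At a regular vertex the last defining relation gives v = e e^* modulo \<open>H\<close>.
  At an infinite emitter this has to come from \<open>v^H\<close>, hence the condition involving
  \<open>S\<close>.\<close>

definition exclusive_cycle :: "'v set \<Rightarrow> 'v set \<Rightarrow> 'e list \<Rightarrow> bool" where
  "exclusive_cycle H S c \<longleftrightarrow> is_cycle E1 r s c \<and> s ` set c \<inter> H = {} \<and> (\<forall>f. is_exit E1 s c f \<longrightarrow> r f \<in> H) \<and>
     (\<forall>e\<in>set c. infinite (out (s e)) \<longrightarrow> s e \<in> S)"

definition exclusive_family :: "'v set \<Rightarrow> 'v set \<Rightarrow> 'e set set \<Rightarrow> bool" where
  "exclusive_family H S \<X> \<longleftrightarrow> (\<forall>X\<in>\<X>. exclusive_cycle H S (cycle_of X) \<and> set (cycle_of X) = X)"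

definition cycle_ideal :: "'v set \<Rightarrow> 'v set \<Rightarrow> 'e set set \<Rightarrow> ('e set \<Rightarrow> 'k poly) \<Rightarrow> ('v, 'e, 'k) fa set" where
  "cycle_ideal H S \<X> h = lgen (graded_gens H S \<union> (\<lambda>X. cyc_poly (cycle_of X) (h X)) ` \<X>)"

lemma nu_augm: "nu v F \<in> augm" by (auto simp: nu_def intro!: augm_intros)
lemma cyc_poly_augm: "cyc_poly c f \<in> augm" by (auto simp: cyc_poly_def intro!: augm_intros)
lemma graded_gens_augm: "graded_gens H S \<subseteq> augm" by (auto simp: graded_gens_def breaking_elem_def nu_augm)

lemma lideal_cycle_ideal: "lideal (cycle_ideal H S \<X> h)"
  unfolding cycle_ideal_def using graded_gens_augm cyc_poly_augm by (intro lideal_lgen) auto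

lemma cycle_ideal_graded_gens: "lgen (graded_gens H S) \<subseteq> cycle_ideal H S \<X> h" unfolding cycle_ideal_def by (intro lgen_mono) auto

lemma graded_gens_cycle_ideal: "graded_gens H S \<subseteq> cycle_ideal H S \<X> h" unfolding cycle_ideal_def by (rule order.trans[OF _ lgen_incl]) simp
lemma cyc_poly_cycle_ideal: "X \<in> \<X> \<Longrightarrow> cyc_poly (cycle_of X) (h X) \<in> cycle_ideal H S \<X> h" unfolding cycle_ideal_def by (rule subsetD[OF lgen_incl]) simp

lemma cycle_ideal_least:
  "lideal J \<Longrightarrow> graded_gens H S \<subseteq> J \<Longrightarrow> (\<And>X. X \<in> \<X> \<Longrightarrow> cyc_poly (cycle_of X) (h X) \<in> J) \<Longrightarrow> cycle_ideal H S \<X> h \<subseteq> J"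
  unfolding cycle_ideal_def by (rule lgen_least) blast+

lemma cycle_inj: "is_cycle E1 r s c \<Longrightarrow> e \<in> set c \<Longrightarrow> f \<in> set c \<Longrightarrow> s e = s f \<Longrightarrow> e = f"
  by (auto simp: is_cycle_def distinct_map dest: inj_onD)

lemma cycle_edge: "is_cycle E1 r s c \<Longrightarrow> e \<in> set c \<Longrightarrow> e \<in> E1" by (auto simp: is_cycle_def is_path_def)

lemma cycle_r: assumes "is_cycle E1 r s c" "e \<in> set c" shows "r e \<in> s ` set c"
proof -
  obtain j where j: "j < length c" "e = c ! j" using assms(2) by (auto simp: in_set_conv_nth)
  have "length c > 0" using j(1) by linarith
  then have "c ! (Suc j mod length c) \<in> set c" by (intro nth_mem) simp
  then show ?thesis using cycle_next[OF assms(1) j(1)] j(2) by simp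
qed

lemma exclusive_cycle_exit:
  assumes "exclusive_cycle H S c" "e \<in> set c" "f \<in> E1" "s f = s e" "r f \<notin> H" shows "f = e"
  using assms cycle_inj[of c f e] by (auto simp: exclusive_cycle_def is_exit_def)

lemma exclusive_cycle_out:
  assumes "exclusive_cycle H S c" "e \<in> set c" shows "{f \<in> out (s e). r f \<notin> H} = {e}"
proof -
  have "r e \<notin> H" using assms cycle_r by (auto simp: exclusive_cycle_def)
  then show ?thesis using assms exclusive_cycle_exit[OF assms] cycle_edge by (auto simp: exclusive_cycle_def out_def)
qed

lemma exclusive_cycle_exitless: assumes c: "exclusive_cycle H S c" shows "exitless (lgen (graded_gens H S)) c"
  unfolding exitless_def
proof (intro conjI ballI)
  let ?G = "lgen (graded_gens H S)"
  have G: "lideal ?G" by (rule lideal_lgen[OF graded_gens_augm])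
  show "is_cycle E1 r s c" using c by (simp add: exclusive_cycle_def)
  fix e assume e: "e \<in> set c"
  have eE: "e \<in> out (s e)" "s e \<in> E0" using c e cycle_edge s_E0 by (auto simp: exclusive_cycle_def out_def)
  show "VV (s e) - DD e * GG e \<in> ?G"
  proof (cases "finite (out (s e))")
    case True
    have "regular_vertex E0 E1 s (s e)" using True eE by (auto simp: regular_vertex_def out_def)
    then have "VV (s e) - DD e * GG e \<approx> (\<Sum>f\<in>out (s e). DD f * GG f) - DD e * GG e"
      by (intro eqv_diff eqv_refl rel_CK2)
    also have "\<dots> = (\<Sum>f\<in>out (s e) - {e}. DD f * GG f)" using True eE by (simp add: sum.remove)
    finally have *: "VV (s e) - DD e * GG e \<approx> (\<Sum>f\<in>out (s e) - {e}. DD f * GG f)" .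
    have "(\<Sum>f\<in>out (s e) - {e}. DD f * GG f) \<in> ?G"
    proof (rule lideal_sum[OF G], rule lideal_rmult[OF G])
      fix f assume f: "f \<in> out (s e) - {e}"
      then have "r f \<in> H" using exclusive_cycle_out[OF c e] by auto
      then have "VV (r f) \<in> ?G" using lgen_incl by (fastforce simp: graded_gens_def)
      then show "DD f \<in> ?G" by (rule DD_mem_r[OF G])
    qed
    then show ?thesis using eqv_mem[OF G *] by blast
  next
    case False
    then have "s e \<in> S" using c e by (simp add: exclusive_cycle_def)
    then have "breaking_elem H (s e) \<in> ?G" using lgen_incl by (fastforce simp: graded_gens_def)
    then show ?thesis by (simp add: breaking_elem_def exclusive_cycle_out[OF c e] nu_def)
  qed
qed

text \<open>Only generators have to be multiplied. Different cycles are orthogonal modulo the graded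
  generators; for the same cycle the factor in between is a corner element and commutes with the
  polynomials.\<close>

lemma cycle_ideal_mult:
  assumes ok: "exclusive_family H S \<X>" and x: "x \<in> cycle_ideal H S \<X> a" and y: "y \<in> cycle_ideal H S \<X> b"
  shows "x * y \<in> cycle_ideal H S \<X> (\<lambda>X. a X * b X)"
proof -
  let ?J = "cycle_ideal H S \<X> (\<lambda>X. a X * b X)" and ?G = "lgen (graded_gens H S)"
  have J: "lideal ?J" by (rule lideal_cycle_ideal)
  have G: "lideal ?G" by (rule lideal_lgen[OF graded_gens_augm])
  note GJ = cycle_ideal_graded_gens[of H S \<X> "\<lambda>X. a X * b X"]
  have gen: "p * (z * q) \<in> ?J"
    if p: "p \<in> graded_gens H S \<union> (\<lambda>X. cyc_poly (cycle_of X) (a X)) ` \<X>" and q: "q \<in> graded_gens H S \<union> (\<lambda>X. cyc_poly (cycle_of X) (b X)) ` \<X>" for p q z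
  proof -
    consider "p \<in> graded_gens H S" | "q \<in> graded_gens H S" | X Y where "X \<in> \<X>" "Y \<in> \<X>" "p = cyc_poly (cycle_of X) (a X)" "q = cyc_poly (cycle_of Y) (b Y)"
      using p q by blast
    then show ?thesis
    proof cases
      case 1
      then show ?thesis using graded_gens_cycle_ideal lideal_rmult[OF J] by blast
    next
      case 2
      then show ?thesis using graded_gens_cycle_ideal lideal_lmult[OF J] by blast
    next
      case 3
      have eX: "exitless ?G (cycle_of X)" "is_cycle E1 r s (cycle_of X)" "set (cycle_of X) = X" and eY: "exitless ?G (cycle_of Y)" "is_cycle E1 r s (cycle_of Y)" "set (cycle_of Y) = Y"
        using ok 3 exclusive_cycle_exitless by (auto simp: exclusive_family_def exclusive_cycle_def)
      let ?v = "s (hd (cycle_of X))" and ?w = "s (hd (cycle_of Y))"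
      note kX = cyc_poly_corner[OF eX(2) refl, of "a X"] and kY = cyc_poly_corner[OF eY(2) refl, of "b Y"]
      have "p * (z * q) \<approx> (p * VV ?v) * (z * (VV ?w * q))"
        unfolding 3 by (rule eqv_sym) (intro eqv_mult eqv_refl corner_r[OF kX] corner_l[OF kY])
      then have 1: "p * (z * q) \<approx> p * ((VV ?v * (z * VV ?w)) * q)" by (simp add: mult.assoc)
      have "p * ((VV ?v * (z * VV ?w)) * q) \<in> ?J"
      proof (cases "X = Y")
        case False
        then have "VV ?v * (z * VV ?w) \<in> ?G" using exitless_orth[OF G eX(1) eY(1)] eX eY by simp
        then have "VV ?v * (z * VV ?w) \<in> ?J" using GJ by blast
        then show ?thesis by (rule lideal_lmult[OF J lideal_rmult[OF J]])
      next
        case True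
        define u where "u = VV ?v * (z * VV ?v)"
        have u: "u \<in> augm" by (simp add: u_def augm_mult1)
        have cu: "corner ?v u"
        proof (rule cornerI)
          show "VV ?v * u \<approx> u" using eqv_rmult[OF rel_VV1[of ?v], of "z * VV ?v"] by (simp add: u_def mult.assoc)
          show "u * VV ?v \<approx> u" using eqv_lmult[OF rel_VV1[of ?v], of "VV ?v * z"] by (simp add: u_def mult.assoc)
        qed
        have "cg ?G (u * cyc_poly (cycle_of X) (b X)) (cyc_poly (cycle_of X) (b X) * u)"
          by (rule corner_commute[OF eX(2) refl G eX(1) u cu])
        then have c1: "cg ?J (p * (u * q)) (p * (q * u))"
          using 3 True by (intro cg_lmult[OF J] cg_mono[OF GJ]) auto
        have "p * q \<approx> cyc_poly (cycle_of X) (a X * b X)" unfolding 3 True[symmetric] by (rule eqv_sym[OF cyc_poly_mult[OF eX(2) refl]])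
        then have "p * q \<in> ?J" using cyc_poly_cycle_ideal[OF 3(1), of "\<lambda>X. a X * b X" H S] eqv_mem[OF J] by blast
        then have "(p * q) * u \<in> ?J" by (rule lideal_rmult[OF J])
        then have "p * (u * q) \<in> ?J" using cg_mem[OF J c1] by (simp add: mult.assoc)
        then show ?thesis using True by (simp add: u_def)
      qed
      then show ?thesis using eqv_mem[OF J 1] by blast
    qed
  qed
  show ?thesis
    by (rule lgen_prod[OF J _ _ gen x[unfolded cycle_ideal_def] y[unfolded cycle_ideal_def]])
       (use graded_gens_augm cyc_poly_augm in auto)
qed

lemma breaking_elem_idem: assumes "v \<in> breaking_verts E0 E1 r s H" shows "breaking_elem H v * breaking_elem H v \<approx> breaking_elem H v"
  unfolding breaking_elem_def using assms by (intro nu_idem) (auto simp: breaking_verts_def out_def conj_assoc)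

text \<open>The graded generators are idempotent and so survive in the product; the polynomials
  multiply cycle by cycle.\<close>

lemma cycle_ideal_lprod:
  assumes ok: "exclusive_family H S \<X>" and ad: "admissible H S"
  shows "lprod (cycle_ideal H S \<X> a) (cycle_ideal H S \<X> b) = cycle_ideal H S \<X> (\<lambda>X. a X * b X)"
proof
  show "lprod (cycle_ideal H S \<X> a) (cycle_ideal H S \<X> b) \<subseteq> cycle_ideal H S \<X> (\<lambda>X. a X * b X)"
    by (intro lprod_least lideal_cycle_ideal cycle_ideal_mult ok)
  let ?P = "lprod (cycle_ideal H S \<X> a) (cycle_ideal H S \<X> b)"
  have P: "lideal ?P" by (intro lideal_lprod lideal_cycle_ideal)
  have idem: "x \<in> ?P" if "x * x \<approx> x" "x \<in> graded_gens H S" for x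
    using lprodI[of x "cycle_ideal H S \<X> a" x "cycle_ideal H S \<X> b"] that graded_gens_cycle_ideal eqv_mem[OF P] by blast
  show "cycle_ideal H S \<X> (\<lambda>X. a X * b X) \<subseteq> ?P"
  proof (rule cycle_ideal_least[OF P])
    show "graded_gens H S \<subseteq> ?P"
    proof
      fix x assume x: "x \<in> graded_gens H S"
      have "x * x \<approx> x" using x breaking_elem_idem ad rel_VV1 by (auto simp: graded_gens_def admissible_def)
      then show "x \<in> ?P" using idem x by blast
    qed
    fix X assume X: "X \<in> \<X>"
    have "is_cycle E1 r s (cycle_of X)" using ok X by (auto simp: exclusive_family_def exclusive_cycle_def)
    then have "cyc_poly (cycle_of X) (a X * b X) \<approx> cyc_poly (cycle_of X) (a X) * cyc_poly (cycle_of X) (b X)" by (rule cyc_poly_mult[OF _ refl])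
    moreover have "cyc_poly (cycle_of X) (a X) * cyc_poly (cycle_of X) (b X) \<in> ?P" by (intro lprodI cyc_poly_cycle_ideal X)
    ultimately show "cyc_poly (cycle_of X) (a X * b X) \<in> ?P" using eqv_mem[OF P] by blast
  qed
qed

lemma cycle_ideal_lprods:
  assumes ok: "exclusive_family H S \<X>" and ad: "admissible H S" and "hs \<noteq> []"
  shows "lprods (map (cycle_ideal H S \<X>) hs) = cycle_ideal H S \<X> (\<lambda>X. prod_list (map (\<lambda>h. h X) hs))"
  using assms(3)
proof (induction hs)
  case (Cons h hs)
  show ?case
  proof (cases hs)
    case (Cons h' hs')
    then have "lprods (map (cycle_ideal H S \<X>) (h # hs)) = lprod (cycle_ideal H S \<X> h) (lprods (map (cycle_ideal H S \<X>) hs))" by simp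
    also have "\<dots> = cycle_ideal H S \<X> (\<lambda>X. h X * prod_list (map (\<lambda>h. h X) hs))"
      using Cons.IH Cons by (simp add: cycle_ideal_lprod[OF ok ad])
    finally show ?thesis by simp
  qed simp
qed simp

text \<open>Tails of \<open>c\<close> avoid \<open>H\<close> and the base points of all other
  cycles, so among the generators only the polynomial of \<open>c\<close> itself can act
  nontrivially. If \<open>c\<close> is not in the family, all of them act as zero, whence the
  default \<open>0\<close>. The base point must be that of \<open>cycle_of\<close> to match the
  generator.\<close>

lemma cycle_ideal_tail_ann:
  assumes ok: "exclusive_family H S \<X>" and ad: "admissible H S" and c: "is_cycle E1 r s c" "c = cycle_of (set c)" "s ` set c \<inter> H = {}"
  shows "cycle_ideal H S \<X> h \<subseteq> tail_ann c (if set c \<in> \<X> then h (set c) else 0)" (is "_ \<subseteq> tail_ann c ?h")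
proof (rule cycle_ideal_least[OF lideal_tail_ann])
  have av: "s (q i) \<notin> H" if "q \<in> cycle_tails c" for q i
    using ad by (intro cycle_tails_avoid[OF _ c(3) that]) (auto simp: admissible_def)
  show "graded_gens H S \<subseteq> tail_ann c ?h"
  proof
    fix x assume "x \<in> graded_gens H S"
    then consider v where "v \<in> H" "x = VV v" | v where "v \<in> S" "x = breaking_elem H v" by (auto simp: graded_gens_def)
    then show "x \<in> tail_ann c ?h"
    proof cases
      case 1
      have "s (q 0) \<noteq> v" if "q \<in> cycle_tails c" for q using av[OF that, of 0] 1 by auto
      then show ?thesis using 1 VV_tail_ann by blast
    next
      case 2
      have "v \<in> breaking_verts E0 E1 r s H" using 2 ad by (auto simp: admissible_def)
      then have "finite {e \<in> out v. r e \<notin> H}" by (auto simp: breaking_verts_def out_def conj_assoc)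
      then show ?thesis unfolding 2 breaking_elem_def
      proof (rule nu_tail_ann)
        fix q assume q: "q \<in> cycle_tails c" "s (q 0) = v"
        then show "q 0 \<in> {e \<in> out v. r e \<notin> H}" using av[OF q(1), of "Suc 0"] cycle_tailsD[OF q(1), of 0] by (auto simp: out_def)
      qed auto
    qed
  qed
  fix X assume X: "X \<in> \<X>"
  have g: "exclusive_cycle H S (cycle_of X)" "set (cycle_of X) = X" using ok X by (simp_all add: exclusive_family_def)
  then have g: "exclusive_cycle H S (cycle_of X)" "is_cycle E1 r s (cycle_of X)" "set (cycle_of X) = X" by (simp_all add: exclusive_cycle_def)
  note toc = cycle_tails_other_cycle[where H = H, OF c(1) g(2)]
  show "cyc_poly (cycle_of X) (h X) \<in> tail_ann c ?h"
  proof (cases "X = set c")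
    case True
    then have cr: "cycle_of X = c" using c(2) by simp
    have "q = cycle_word c" if "q \<in> cycle_tails c" "s (q 0) = s (hd c)" for q
      by (rule toc(2)[OF _ that(1)]) (use exclusive_cycle_exit[OF g(1)] av[OF that(1)] that(2) cr in simp_all)
    then have "cyc_poly c (h X) \<in> tail_ann c (h X)" by (rule cyc_poly_tail_ann[OF c(1) refl])
    then show ?thesis using True X cr by simp
  next
    case False
    have "s (q 0) \<noteq> s (hd (cycle_of X))" if "q \<in> cycle_tails c" for q
    proof
      assume "s (q 0) = s (hd (cycle_of X))"
      then have "set (cycle_of X) = set c"
        by (intro toc(1)[OF _ that]) (use exclusive_cycle_exit[OF g(1)] av[OF that] in simp_all)
      then show False using False g(3) by simp
    qed
    then have "VV (s (hd (cycle_of X))) \<in> tail_ann c ?h" using VV_tail_ann by blast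
    then show ?thesis unfolding cyc_poly_def by (rule lideal_lmult[OF lideal_tail_ann])
  qed
qed

text \<open>The principal ideal of \<open>p\<close> is radical; this admits \<open>0\<close> and the
  units besides products of distinct primes.\<close>

definition radical_poly :: "'k poly \<Rightarrow> bool" where "radical_poly p \<longleftrightarrow> (\<forall>g. p dvd g * g \<longrightarrow> p dvd g)"

text \<open>For an ideal \<open>A\<close> with square in \<open>J\<close>, vertices and elements
  \<open>v^H\<close> of \<open>A\<close> are idempotent and so lie in \<open>J\<close>. A corner
  element reduces to a polynomial \<open>f\<close> in the cycle; the action shows that
  \<open>h\<close> divides the square of \<open>f\<close> up to a power of X, and radicality carries
  this over to \<open>f\<close>.\<close>

lemma cycle_ideal_quasi_semiprime:
  assumes ok: "exclusive_family H S \<X>" and ad: "admissible H S" and h: "\<And>X. X \<in> \<X> \<Longrightarrow> radical_poly (h X)"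
  shows "quasi_semiprime (cycle_ideal H S \<X> h)"
  unfolding quasi_semiprime_def
proof (intro conjI allI impI)
  let ?J = "cycle_ideal H S \<X> h"
  show J: "lideal ?J" by (rule lideal_cycle_ideal)
  fix A assume A: "lideal A" and AA: "\<forall>a\<in>A. \<forall>b\<in>A. a * b \<in> ?J"
  have idem: "x \<in> ?J" if "x \<in> A" "x * x \<approx> x" for x using that AA eqv_mem[OF J] by blast
  show "A \<subseteq> ?J"
  proof (rule lideal_structure[OF A J])
    show "VV v \<in> ?J" if "VV v \<in> A" for v using idem[OF that rel_VV1] .
    show "nu v F \<in> ?J" if "F = {e \<in> out v. VV (r e) \<notin> A}" "finite F" "nu v F \<in> A" for v F
      using that by (intro idem nu_idem) auto
    fix c y assume c: "proper_exitless A c" and y: "y \<in> A" "VV (s (hd c)) * (y * VV (s (hd c))) \<approx> y"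
    have cyc: "is_cycle E1 r s c" using c by (simp add: proper_exitless_def)
    define d where "d = cycle_of (set c)"
    have d: "is_cycle E1 r s d" "set d = set c" "d = cycle_of (set d)" using cycle_of[OF cyc] by (auto simp: d_def)
    have eJ: "exitless ?J d" unfolding exitless_def
    proof (intro conjI d ballI)
      fix e assume e: "e \<in> set d"
      then have eA: "VV (s e) - DD e * GG e \<in> A" using c d by (auto simp: proper_exitless_def)
      have "e \<in> out (s e)" using cycle_edge[OF d(1) e] by (simp add: out_def)
      then have "nu (s e) {e} * nu (s e) {e} \<approx> nu (s e) {e}" by (intro nu_idem) auto
      then show "VV (s e) - DD e * GG e \<in> ?J" using idem[OF eA] by (simp add: nu_def)
    qed
    show "y \<in> ?J"
    proof (rule proper_exitless_change_base[OF A J c d(1,2) _ y(1) y(2)[folded corner_def]])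
      let ?v = "s (hd d)"
      fix z assume z: "z \<in> A" "corner ?v z"
      show "z \<in> ?J"
      proof (cases "VV ?v \<in> ?J")
        case True
        then have "VV ?v * z \<in> ?J" by (rule lideal_rmult[OF J])
        then show ?thesis using eqv_mem[OF J corner_l[OF z(2)]] by blast
      next
        case False
        obtain n f where f: "cg ?J (z * (PP (rep n d) * VV ?v)) (cyc_poly d f)"
          using corner_poly[OF d(1) refl J eJ lideal_augm[OF A z(1)] z(2)] by blast
        define w where "w = z * (PP (rep n d) * VV ?v)"
        have wA: "w \<in> A" unfolding w_def by (rule lideal_rmult[OF A z(1)])
        have "w * w \<in> ?J" using AA wA by blast
        then have "cyc_poly d f * cyc_poly d f \<in> ?J" using cg_mem[OF J cg_mult[OF J f f]] by (simp add: w_def)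
        then have ff: "cyc_poly d (f * f) \<in> ?J" using eqv_mem[OF J cyc_poly_mult[OF d(1) refl]] by blast
        \<comment> \<open>For a cycle without generator in the family the value is \<open>0\<close>,
          which is radical too.\<close>
        define hh where "hh = (if set d \<in> \<X> then h (set d) else 0)"
        have "s ` set d \<inter> H = {}"
        proof (rule ccontr)
          assume "s ` set d \<inter> H \<noteq> {}"
          then obtain e where e: "e \<in> set d" "s e \<in> H" by blast
          then have "VV (s e) \<in> ?J" using graded_gens_cycle_ideal by (fastforce simp: graded_gens_def)
          moreover obtain i where i: "i < length d" "e = d ! i" using e(1) by (auto simp: in_set_conv_nth)
          have "walk (s e) (drop i d) ?v" using walk_take_nth(2)[OF walk_c(1)[OF d(1) refl] i(1)] i by simp
          ultimately show False using VV_walk[OF J] False by blast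
        qed
        then have "?J \<subseteq> tail_ann d hh" unfolding hh_def by (rule cycle_ideal_tail_ann[OF ok ad d(1,3)])
        then obtain m q where mq: "f * f * [:0, 1:] ^ m = hh * q" using cyc_poly_tail_annD[OF d(1) refl] ff by blast
        have "radical_poly 0" by (simp add: radical_poly_def)
        then have "radical_poly hh" using h[of "set d"] by (simp add: hh_def)
        \<comment> \<open>Another factor \<open>[:0, 1:] ^ m\<close> turns the multiple of
          \<open>hh\<close> into a square.\<close>
        moreover have "(f * [:0, 1:] ^ m) * (f * [:0, 1:] ^ m) = hh * (q * [:0, 1:] ^ m)"
          using arg_cong[OF mq, of "\<lambda>x. x * [:0, 1:] ^ m"] by (simp add: algebra_simps)
        ultimately obtain q' where q': "f * [:0, 1:] ^ m = hh * q'" unfolding radical_poly_def by (metis dvd_def)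
        have "cyc_poly d hh \<in> ?J" using cyc_poly_cycle_ideal[of "set d" \<X> h H S] d(3) cyc_poly_0[OF d(1) refl] lideal_0[OF J] by (auto simp: hh_def)
        then have "cyc_poly d (hh * q') \<in> ?J" using eqv_mem[OF J cyc_poly_mult[OF d(1) refl]] lideal_rmult[OF J] by blast
        then have fm: "cyc_poly d f * cyc_poly d (monom 1 m) \<in> ?J"
          using eqv_mem[OF J cyc_poly_mult[OF d(1) refl, of f "monom 1 m"]] by (simp add: q'[symmetric] monom_altdef)
        have "cyc_poly d f * (PP (rep m d) * VV ?v) \<in> ?J"
          using eqv_mem[OF J eqv_lmult[OF cyc_poly_monom[OF d(1) refl, of 1 m], of "cyc_poly d f"]] fm by simp
        \<comment> \<open>The surplus power of the cycle is cancelled by its ghost, a right inverse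
          modulo the ideal.\<close>
        then have "(cyc_poly d f * (PP (rep m d) * VV ?v)) * QQ (rep m d) \<in> ?J" by (rule lideal_rmult[OF J])
        then have "cyc_poly d f * ((PP (rep m d) * VV ?v) * QQ (rep m d)) \<in> ?J" by (simp add: mult.assoc)
        then have "cyc_poly d f * VV ?v \<in> ?J" using cg_mem[OF J cg_lmult[OF J rep_unit[OF d(1) refl J eJ]]] by blast
        then have "cyc_poly d f \<in> ?J" using eqv_mem[OF J corner_r[OF cyc_poly_corner[OF d(1) refl]]] by blast
        then have "cyc_poly d f * QQ (rep n d) \<in> ?J" by (rule lideal_rmult[OF J])
        then show ?thesis using cg_mem[OF J corner_poly_recover[OF d(1) refl J eJ z(2) f]] by blast
      qed
    qed
  qed
qed

end

section \<open>The three conditions in the free algebra\<close>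

context graph begin

text \<open>Prime factors are radical, and the leading coefficient enters as a separate unit
  factor.\<close>

lemma radical_poly_factors:
  assumes "f \<noteq> 0" shows "\<exists>ps. (\<forall>p\<in>set ps. radical_poly p) \<and> prod_list ps = f"
proof -
  obtain M where M: "prod_mset M = smult (inverse (lead_coeff f)) f" "\<And>p. p \<in># M \<Longrightarrow> prime_elem p"
    by (rule that[OF field_poly_prod_mset_prime_factorization[OF assms]])
       (rule field_poly_in_prime_factorization_imp_prime)
  obtain qs where qs: "mset qs = M" by (metis ex_mset)
  have "radical_poly q" if "q \<in> set qs" for q
  proof -
    have "prime_elem q" using that qs M(2) by (metis set_mset_mset)
    then show ?thesis by (auto simp: radical_poly_def dest: prime_elem_dvd_multD)
  qed
  moreover have "prod_list qs = smult (inverse (lead_coeff f)) f"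
    using M(1) qs by (metis prod_mset_prod_list)
  then have "prod_list ([:lead_coeff f:] # qs) = f" using assms by simp
  moreover have "[:lead_coeff f:] dvd 1" using assms by (simp add: is_unit_pCons_iff)
  then have "radical_poly [:lead_coeff f:]" unfolding radical_poly_def using dvd_trans one_dvd by blast
  ultimately show ?thesis by (intro exI[of _ "[:lead_coeff f:] # qs"]) auto
qed

definition gr_verts :: "('v, 'e, 'k) fa set \<Rightarrow> 'v set" where "gr_verts I = {v \<in> E0. VV v \<in> I}"
definition gr_breaking :: "('v, 'e, 'k) fa set \<Rightarrow> 'v set" where
  "gr_breaking I = {v \<in> breaking_verts E0 E1 r s (gr_verts I). breaking_elem (gr_verts I) v \<in> I}"
definition exitless_sets :: "('v, 'e, 'k) fa set \<Rightarrow> 'e set set" where "exitless_sets I = {set c | c. proper_exitless I c}"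

lemma VV_gr_verts: "lideal I \<Longrightarrow> e \<in> E1 \<Longrightarrow> r e \<in> gr_verts I \<longleftrightarrow> VV (r e) \<in> I"
  "lideal I \<Longrightarrow> e \<in> E1 \<Longrightarrow> s e \<in> gr_verts I \<longleftrightarrow> VV (s e) \<in> I"
  by (auto simp: gr_verts_def r_E0 s_E0)

lemma gr_verts_edge: "lideal I \<Longrightarrow> e \<in> E1 \<Longrightarrow> s e \<in> gr_verts I \<Longrightarrow> r e \<in> gr_verts I"
  using VV_walk[of I "s e" "[e]" "r e"] by (auto simp: gr_verts_def r_E0)

lemma admissible_gr: "lideal I \<Longrightarrow> admissible (gr_verts I) (gr_breaking I)"
  using gr_verts_edge by (auto simp: admissible_def gr_breaking_def gr_verts_def)

lemma graded_gens_gr: "graded_gens (gr_verts I) (gr_breaking I) \<subseteq> I" by (auto simp: graded_gens_def gr_verts_def gr_breaking_def)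

lemma hereditary_iff: "hereditary E0 E1 r s H \<longleftrightarrow> H \<subseteq> E0 \<and> (\<forall>e\<in>E1. s e \<in> H \<longrightarrow> r e \<in> H)"
proof
  assume H: "hereditary E0 E1 r s H"
  have "r e \<in> H" if "e \<in> E1" "s e \<in> H" for e
  proof -
    have "is_path E1 r s [e]" using that by (simp add: is_path_def)
    then show ?thesis using H that unfolding hereditary_def by (metis last.simps list.sel(1))
  qed
  then show "H \<subseteq> E0 \<and> (\<forall>e\<in>E1. s e \<in> H \<longrightarrow> r e \<in> H)" using H by (auto simp: hereditary_def)
next
  assume H: "H \<subseteq> E0 \<and> (\<forall>e\<in>E1. s e \<in> H \<longrightarrow> r e \<in> H)"
  have "walk u p v \<Longrightarrow> u \<in> H \<Longrightarrow> v \<in> H" for u p v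
    by (induction u p v rule: walk.induct) (use H in auto)
  then show "hereditary E0 E1 r s H" using H is_path_walk unfolding hereditary_def by blast
qed

lemma hereditary_gr: "lideal I \<Longrightarrow> hereditary E0 E1 r s (gr_verts I)"
  using gr_verts_edge by (auto simp: hereditary_iff gr_verts_def)

lemma saturated_gr: assumes I: "lideal I" shows "saturated E0 E1 r s (gr_verts I)"
  unfolding saturated_def
proof (intro allI impI)
  fix v assume v: "regular_vertex E0 E1 s v \<and> r ` {e \<in> E1. s e = v} \<subseteq> gr_verts I"
  have "(\<Sum>e\<in>out v. DD e * GG e) \<in> I"
  proof (rule lideal_sum[OF I], rule lideal_rmult[OF I], rule DD_mem_r[OF I])
    fix e assume "e \<in> out v"
    then show "VV (r e) \<in> I" using v by (auto simp: out_def gr_verts_def)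
  qed
  then show "v \<in> gr_verts I" using eqv_mem[OF I rel_CK2] v by (auto simp: gr_verts_def regular_vertex_def)
qed

text \<open>\<open>exitless_exit\<close> translates the algebraic condition into one on exits; with
  only one edge leading outside \<open>gr_verts I\<close>, the element
  \<open>VV (s e) - DD e * GG e\<close> is the element \<open>v^H\<close> of its source.\<close>

lemma proper_exitless_exclusive_cycle: assumes I: "lideal I" and c: "proper_exitless I c" shows "exclusive_cycle (gr_verts I) (gr_breaking I) c"
proof -
  have cyc: "is_cycle E1 r s c" and e: "exitless I c" using c by (auto simp: proper_exitless_exitless exitless_def)
  have sI: "VV (s e) \<notin> I" if "e \<in> set c" for e
  proof -
    obtain i where i: "i < length c" "e = c ! i" using \<open>e \<in> set c\<close> by (auto simp: in_set_conv_nth)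
    have "walk (s e) (drop i c) (s (hd c))" using walk_take_nth(2)[OF walk_c(1)[OF cyc refl] i(1)] i by simp
    then show ?thesis using VV_walk[OF I] c by (auto simp: proper_exitless_def)
  qed
  have ex: "r f \<in> gr_verts I" if f: "f \<in> E1" "s f = s e" "e \<in> set c" "f \<noteq> e" for e f
    using exitless_exit[OF I e f(3,1,2)] f VV_gr_verts[OF I f(1)] by blast
  have out: "{f \<in> out (s e). r f \<notin> gr_verts I} = {e}" if "e \<in> set c" for e
  proof -
    have "r e \<in> s ` set c" by (rule cycle_r[OF cyc that])
    then have "r e \<notin> gr_verts I" using sI by (auto simp: gr_verts_def)
    then show ?thesis using ex[OF _ _ that] cycle_edge[OF cyc that] by (auto simp: out_def)
  qed
  have "s e \<in> gr_breaking I" if i: "e \<in> set c" "infinite (out (s e))" for e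
  proof -
    have "s e \<in> breaking_verts E0 E1 r s (gr_verts I)"
      using i out[OF i(1)] sI[OF i(1)] s_E0[OF cycle_edge[OF cyc i(1)]]
      by (auto simp: breaking_verts_def infinite_emitter_def gr_verts_def out_def conj_assoc)
    moreover have "breaking_elem (gr_verts I) (s e) \<in> I" using c i by (simp add: breaking_elem_def out nu_def proper_exitless_def)
    ultimately show ?thesis by (simp add: gr_breaking_def)
  qed
  moreover have "r f \<in> gr_verts I" if "is_exit E1 s c f" for f
    using that ex by (auto simp: is_exit_def)
  moreover have "s ` set c \<inter> gr_verts I = {}" using sI by (auto simp: gr_verts_def)
  ultimately show ?thesis using cyc by (auto simp: exclusive_cycle_def)
qed

lemma exitless_sets_cycle_of:
  assumes I: "lideal I" and X: "X \<in> exitless_sets I"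
  shows "proper_exitless I (cycle_of X)" "set (cycle_of X) = X" "exclusive_cycle (gr_verts I) (gr_breaking I) (cycle_of X)"
proof -
  obtain c where c: "X = set c" "proper_exitless I c" using X by (auto simp: exitless_sets_def)
  have d: "is_cycle E1 r s (cycle_of X)" "set (cycle_of X) = X" using cycle_of[of c] c by (auto simp: proper_exitless_def)
  have "exclusive_cycle (gr_verts I) (gr_breaking I) c" by (rule proper_exitless_exclusive_cycle[OF I c(2)])
  moreover have "cycle_of X \<noteq> []" using d(1) by (simp add: is_cycle_def is_path_def)
  then have "hd (cycle_of X) \<in> set c" using d(2) c(1) hd_in_set by metis
  ultimately have "s (hd (cycle_of X)) \<notin> gr_verts I" by (auto simp: exclusive_cycle_def)
  moreover have "s (hd (cycle_of X)) \<in> E0" using walk_c(2)[OF d(1) refl] .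
  ultimately show n: "proper_exitless I (cycle_of X)" using c d by (auto simp: proper_exitless_def gr_verts_def)
  show "set (cycle_of X) = X" by (rule d)
  show "exclusive_cycle (gr_verts I) (gr_breaking I) (cycle_of X)" by (rule proper_exitless_exclusive_cycle[OF I n])
qed

lemma exclusive_family_gr: "lideal I \<Longrightarrow> exclusive_family (gr_verts I) (gr_breaking I) (exitless_sets I)"
  using exitless_sets_cycle_of by (auto simp: exclusive_family_def)

lemma exclusive_family_subset: "exclusive_family H S \<X> \<Longrightarrow> \<Y> \<subseteq> \<X> \<Longrightarrow> exclusive_family H S \<Y>" by (auto simp: exclusive_family_def)

text \<open>Over the graded generators, each corner of \<open>I\<close> at an exitless cycle is
  governed by the single polynomial of \<open>corner_principal\<close>, and by
  \<open>lideal_structure\<close> nothing else is left to generate.\<close>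

lemma lideal_cycle_ideal_form:
  assumes I: "lideal I" shows "\<exists>f. I = cycle_ideal (gr_verts I) (gr_breaking I) (exitless_sets I) f"
proof -
  let ?G = "lgen (graded_gens (gr_verts I) (gr_breaking I))"
  have G: "lideal ?G" by (rule lideal_lgen[OF graded_gens_augm])
  have GI: "?G \<subseteq> I" by (rule lgen_least[OF I graded_gens_gr])
  have "\<forall>X\<in>exitless_sets I. \<exists>f. cyc_poly (cycle_of X) f \<in> I \<and> (\<forall>G J y. lideal G \<longrightarrow> lideal J \<longrightarrow> exitless G (cycle_of X) \<longrightarrow> G \<subseteq> I \<longrightarrow> G \<subseteq> J \<longrightarrow> cyc_poly (cycle_of X) f \<in> J \<longrightarrow>
      y \<in> I \<longrightarrow> corner (s (hd (cycle_of X))) y \<longrightarrow> y \<in> J)"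
    using exitless_sets_cycle_of(1)[OF I] corner_principal[OF _ refl I] by (auto simp: proper_exitless_def)
  then obtain f where f: "\<And>X. X \<in> exitless_sets I \<Longrightarrow> cyc_poly (cycle_of X) (f X) \<in> I"
    and f': "\<And>X G J y. X \<in> exitless_sets I \<Longrightarrow> lideal G \<Longrightarrow> lideal J \<Longrightarrow> exitless G (cycle_of X) \<Longrightarrow> G \<subseteq> I \<Longrightarrow> G \<subseteq> J \<Longrightarrow> cyc_poly (cycle_of X) (f X) \<in> J \<Longrightarrow>
      y \<in> I \<Longrightarrow> corner (s (hd (cycle_of X))) y \<Longrightarrow> y \<in> J"
    by (subst (asm) bchoice_iff) blast
  let ?J = "cycle_ideal (gr_verts I) (gr_breaking I) (exitless_sets I) f"
  have J: "lideal ?J" by (rule lideal_cycle_ideal)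
  have "?J \<subseteq> I" by (rule cycle_ideal_least[OF I graded_gens_gr f])
  moreover have "I \<subseteq> ?J"
  proof (rule lideal_structure[OF I J])
    fix v assume v: "VV v \<in> I"
    show "VV v \<in> ?J"
    proof (cases "v \<in> E0")
      case True
      then have "VV v \<in> graded_gens (gr_verts I) (gr_breaking I)" using v by (simp add: graded_gens_def gr_verts_def)
      then show ?thesis using graded_gens_cycle_ideal by blast
    next
      case False
      then show ?thesis using VV_E0[OF J] by blast
    qed
  next
    fix v F assume F: "infinite_emitter E0 E1 s v" "VV v \<notin> I" "F = {e \<in> out v. VV (r e) \<notin> I}" "finite F" "F \<noteq> {}" "nu v F \<in> I"
    have e: "{e \<in> out v. r e \<notin> gr_verts I} = F" unfolding F(3) using VV_gr_verts(1)[OF I] by (auto simp: out_def)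
    then have "{e \<in> E1. s e = v \<and> r e \<notin> gr_verts I} = F" by (auto simp: out_def)
    then have "v \<in> breaking_verts E0 E1 r s (gr_verts I)" using F by (auto simp: breaking_verts_def gr_verts_def)
    then have "breaking_elem (gr_verts I) v \<in> graded_gens (gr_verts I) (gr_breaking I)" using F(6) e by (auto simp: graded_gens_def gr_breaking_def breaking_elem_def)
    then have "breaking_elem (gr_verts I) v \<in> ?J" by (rule subsetD[OF graded_gens_cycle_ideal])
    then show "nu v F \<in> ?J" by (simp add: breaking_elem_def e)
  next
    fix c y assume c: "proper_exitless I c" and y: "y \<in> I" "VV (s (hd c)) * (y * VV (s (hd c))) \<approx> y"
    have X: "set c \<in> exitless_sets I" using c by (auto simp: exitless_sets_def)
    note cr = exitless_sets_cycle_of[OF I X]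
    have d: "is_cycle E1 r s (cycle_of (set c))" using cr(1) by (simp add: proper_exitless_def)
    show "y \<in> ?J"
    proof (rule proper_exitless_change_base[OF I J c d cr(2) _ y(1) y(2)[folded corner_def]])
      fix z assume "z \<in> I" "corner (s (hd (cycle_of (set c)))) z"
      then show "z \<in> ?J" by (rule f'[OF X G J exclusive_cycle_exitless[OF cr(3)] GI cycle_ideal_graded_gens cyc_poly_cycle_ideal[OF X]])
    qed
  qed
  ultimately show ?thesis by blast
qed

definition exclusive_sets :: "'v set \<Rightarrow> 'e set set" where
  "exclusive_sets H = {set c | c. is_cycle E1 r s c \<and> path_verts r s c \<inter> H = {} \<and> (\<forall>f. is_exit E1 s c f \<longrightarrow> r f \<in> H)}"

lemma exitless_sets_exclusive_sets: assumes I: "lideal I" shows "exitless_sets I \<subseteq> exclusive_sets (gr_verts I)"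
proof
  fix X assume "X \<in> exitless_sets I"
  then obtain c where c: "X = set c" "proper_exitless I c" by (auto simp: exitless_sets_def)
  have g: "exclusive_cycle (gr_verts I) (gr_breaking I) c" by (rule proper_exitless_exclusive_cycle[OF I c(2)])
  then have "path_verts r s c \<inter> gr_verts I = {}" using cycle_r by (auto simp: exclusive_cycle_def path_verts_def)
  then show "X \<in> exclusive_sets (gr_verts I)" using g c by (auto simp: exclusive_sets_def exclusive_cycle_def)
qed

text \<open>Exactly one edge leads out of \<open>H\<close> at each vertex of such a cycle, so an
  infinite emitter on it is a breaking vertex and is covered when \<open>S\<close> consists of all
  of them.\<close>

lemma exclusive_family_exclusive_sets:
  assumes "\<X> \<subseteq> exclusive_sets H" shows "exclusive_family H (breaking_verts E0 E1 r s H) \<X>"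
  unfolding exclusive_family_def
proof (intro ballI)
  fix X assume "X \<in> \<X>"
  then obtain c where c: "X = set c" "is_cycle E1 r s c" "path_verts r s c \<inter> H = {}" "\<forall>f. is_exit E1 s c f \<longrightarrow> r f \<in> H"
    using assms by (auto simp: exclusive_sets_def)
  have d: "is_cycle E1 r s (cycle_of X)" "set (cycle_of X) = set c" using cycle_of[OF c(2)] c(1) by auto
  have sH: "s ` set (cycle_of X) \<inter> H = {}" using c(3) d by (auto simp: path_verts_def)
  have ex: "r f \<in> H" if "is_exit E1 s (cycle_of X) f" for f using that c(4) d by (auto simp: is_exit_def)
  have "s e \<in> breaking_verts E0 E1 r s H" if e: "e \<in> set (cycle_of X)" "infinite (out (s e))" for e
  proof -
    have rH: "r e \<notin> H" using e c(3) d by (auto simp: path_verts_def)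
    have "f = e" if f: "f \<in> E1" "s f = s e" "r f \<notin> H" for f
    proof (cases "f \<in> set (cycle_of X)")
      case True
      then show ?thesis using cycle_inj[OF d(1) _ e(1)] f by blast
    next
      case False
      then have "is_exit E1 s (cycle_of X) f" using f e by (auto simp: is_exit_def)
      then show ?thesis using ex f by blast
    qed
    then have "{f \<in> E1. s f = s e \<and> r f \<notin> H} = {e}" using rH cycle_edge[OF d(1) e(1)] by auto
    then show ?thesis using e sH s_E0[OF cycle_edge[OF d(1) e(1)]]
      by (auto simp: breaking_verts_def infinite_emitter_def out_def)
  qed
  then show "exclusive_cycle H (breaking_verts E0 E1 r s H) (cycle_of X) \<and> set (cycle_of X) = X"
    using d sH ex c(1) by (auto simp: exclusive_cycle_def)
qed

text \<open>The ideals of finite subfamilies are directed under inclusion, so their union is an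
  ideal containing all generators.\<close>

lemma cycle_ideal_finite_support:
  assumes "x \<in> cycle_ideal H S \<X> h" shows "\<exists>\<Z>. finite \<Z> \<and> \<Z> \<subseteq> \<X> \<and> x \<in> cycle_ideal H S \<Z> h"
proof -
  have mono: "cycle_ideal H S \<Y> h \<subseteq> cycle_ideal H S \<Z> h" if "\<Y> \<subseteq> \<Z>" for \<Y> \<Z>
    unfolding cycle_ideal_def using that by (intro lgen_mono) auto
  let ?J = "{x. \<exists>\<Z>. finite \<Z> \<and> \<Z> \<subseteq> \<X> \<and> x \<in> cycle_ideal H S \<Z> h}"
  have "lideal ?J" unfolding lideal_def
  proof (intro conjI ballI allI)
    show "?J \<subseteq> augm" using lideal_augm[OF lideal_cycle_ideal] by blast
    show "0 \<in> ?J" using lideal_0[OF lideal_cycle_ideal[of H S "{}" h]] by (auto intro!: exI[of _ "{}"])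
    show "rels \<subseteq> ?J" using lideal_cycle_ideal[of H S "{}" h] unfolding lideal_def by (auto intro!: exI[of _ "{}"])
    fix x assume "x \<in> ?J"
    then obtain \<Z> where Z: "finite \<Z>" "\<Z> \<subseteq> \<X>" "x \<in> cycle_ideal H S \<Z> h" by blast
    show "a * x \<in> ?J" "x * a \<in> ?J" for a
      using Z lideal_lmult[OF lideal_cycle_ideal Z(3)] lideal_rmult[OF lideal_cycle_ideal Z(3)] by blast+
    fix y assume "y \<in> ?J"
    then obtain \<Y> where Y: "finite \<Y>" "\<Y> \<subseteq> \<X>" "y \<in> cycle_ideal H S \<Y> h" by blast
    have "x \<in> cycle_ideal H S (\<Z> \<union> \<Y>) h" "y \<in> cycle_ideal H S (\<Z> \<union> \<Y>) h" using Z Y mono[of \<Z> "\<Z> \<union> \<Y>"] mono[of \<Y> "\<Z> \<union> \<Y>"] by auto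
    then have "x - y \<in> cycle_ideal H S (\<Z> \<union> \<Y>) h" by (rule lideal_diff[OF lideal_cycle_ideal])
    then show "x - y \<in> ?J" using Z Y by (intro CollectI exI[of _ "\<Z> \<union> \<Y>"]) auto
  qed
  moreover have "graded_gens H S \<subseteq> ?J" using graded_gens_cycle_ideal[of H S "{}" h] by (auto intro!: exI[of _ "{}"])
  moreover have "cyc_poly (cycle_of X) (h X) \<in> ?J" if "X \<in> \<X>" for X
    using that cyc_poly_cycle_ideal[of X "{X}" h H S] by (auto intro!: exI[of _ "{X}"])
  ultimately have "cycle_ideal H S \<X> h \<subseteq> ?J" by (rule cycle_ideal_least)
  then show ?thesis using assms by blast
qed

definition semiprime_products :: bool where
  "semiprime_products \<longleftrightarrow> (\<forall>I. lideal I \<and> I \<noteq> augm \<longrightarrow>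
    (\<exists>Ps. Ps \<noteq> [] \<and> (\<forall>P\<in>set Ps. quasi_semiprime P \<and> P \<noteq> augm) \<and> I = lprods Ps))"

definition fg_over_graded :: bool where
  "fg_over_graded \<longleftrightarrow> (\<forall>I. lideal I \<longrightarrow> (\<exists>F. finite F \<and> F \<subseteq> augm \<and> lgen (graded_gens (gr_verts I) (gr_breaking I) \<union> F) = I))"

definition finite_exclusive :: bool where
  "finite_exclusive \<longleftrightarrow> (\<forall>H. hereditary E0 E1 r s H \<and> saturated E0 E1 r s H \<longrightarrow> finite (exclusive_sets H))"

lemma finite_exclusive_exitless_sets: "finite_exclusive \<Longrightarrow> lideal I \<Longrightarrow> finite (exitless_sets I)"
  unfolding finite_exclusive_def using hereditary_gr saturated_gr exitless_sets_exclusive_sets finite_subset by meson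

section \<open>Consequences of having finitely many exclusive cycles\<close>

lemma finite_exclusive_imp_fg_over_graded: assumes c3: "finite_exclusive" shows "fg_over_graded"
  unfolding fg_over_graded_def
proof (intro allI impI)
  fix I assume I: "lideal I"
  obtain f where f: "I = cycle_ideal (gr_verts I) (gr_breaking I) (exitless_sets I) f" using lideal_cycle_ideal_form[OF I] by blast
  show "\<exists>F. finite F \<and> F \<subseteq> augm \<and> lgen (graded_gens (gr_verts I) (gr_breaking I) \<union> F) = I"
    using finite_exclusive_exitless_sets[OF c3 I] f[unfolded cycle_ideal_def, symmetric] cyc_poly_augm
    by (intro exI[of _ "(\<lambda>X. cyc_poly (cycle_of X) (f X)) ` exitless_sets I"]) auto
qed

lemma finite_exclusive_imp_semiprime_products: assumes c3: "finite_exclusive" shows "semiprime_products"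
  unfolding semiprime_products_def
proof (intro allI impI, elim conjE)
  fix I assume I: "lideal I" "I \<noteq> augm"
  let ?H = "gr_verts I" and ?S = "gr_breaking I"
  obtain f where f: "I = cycle_ideal ?H ?S (exitless_sets I) f" using lideal_cycle_ideal_form[OF I(1)] by blast
  \<comment> \<open>A zero polynomial contributes no generator, and
    \<open>radical_poly_factors\<close> asks for a nonzero one, so its cycle is dropped.\<close>
  define \<X> where "\<X> = {X \<in> exitless_sets I. f X \<noteq> 0}"
  have ok: "exclusive_family ?H ?S \<X>" by (rule exclusive_family_subset[OF exclusive_family_gr[OF I(1)]]) (auto simp: \<X>_def)
  note ad = admissible_gr[OF I(1)]
  have fin: "finite \<X>" using finite_exclusive_exitless_sets[OF c3 I(1)] by (simp add: \<X>_def)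
  have I_eq: "I = cycle_ideal ?H ?S \<X> f"
  proof
    show "I \<subseteq> cycle_ideal ?H ?S \<X> f"
    proof (subst f, rule cycle_ideal_least[OF lideal_cycle_ideal graded_gens_cycle_ideal])
      fix X assume X: "X \<in> exitless_sets I"
      show "cyc_poly (cycle_of X) (f X) \<in> cycle_ideal ?H ?S \<X> f"
      proof (cases "f X = 0")
        case True
        then show ?thesis by (simp add: cyc_poly_def lideal_0[OF lideal_cycle_ideal])
      next
        case False
        then show ?thesis using X by (intro cyc_poly_cycle_ideal) (simp add: \<X>_def)
      qed
    qed
    show "cycle_ideal ?H ?S \<X> f \<subseteq> I"
      by (subst (2) f, rule cycle_ideal_least[OF lideal_cycle_ideal graded_gens_cycle_ideal]) (auto simp: \<X>_def intro: cyc_poly_cycle_ideal)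
  qed
  have "\<forall>X\<in>\<X>. \<exists>ps. (\<forall>p\<in>set ps. radical_poly p) \<and> prod_list ps = f X" using radical_poly_factors by (auto simp: \<X>_def)
  then obtain ps where ps: "\<forall>X\<in>\<X>. (\<forall>p\<in>set (ps X). radical_poly p) \<and> prod_list (ps X) = f X" by metis
  \<comment> \<open>A common length for all factor lists, which are padded with \<open>1\<close>.
    The successor keeps \<open>hs\<close> nonempty when there are no cycles and the ideal itself is
    the only factor.\<close>
  define m where "m = Suc (\<Sum>X\<in>\<X>. length (ps X))"
  define h where "h k X = (if k < length (ps X) then ps X ! k else 1)" for k X
  define hs where "hs = map h [0..<m]"
  have hne: "hs \<noteq> []" by (simp add: hs_def m_def)
  have "prod_list (map (\<lambda>h. h X) hs) = f X" if X: "X \<in> \<X>" for X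
  proof -
    have "length (ps X) \<le> (\<Sum>X\<in>\<X>. length (ps X))" using fin X by (intro member_le_sum) auto
    then obtain t where t: "m = length (ps X) + t" unfolding m_def by (metis le_SucI le_Suc_ex)
    have "map (\<lambda>h. h X) hs = map (\<lambda>k. h k X) [0..<length (ps X)] @ map (\<lambda>k. h k X) [length (ps X)..<m]"
      unfolding hs_def t by (simp add: upt_add_eq_append[of 0, simplified] o_def)
    also have "map (\<lambda>k. h k X) [0..<length (ps X)] = ps X" by (intro nth_equalityI) (auto simp: h_def)
    also have "map (\<lambda>k. h k X) [length (ps X)..<m] = map (\<lambda>k. 1) [length (ps X)..<m]"
      by (intro map_cong) (auto simp: h_def)
    finally have "prod_list (map (\<lambda>h. h X) hs) = prod_list (ps X) * prod_list (map (\<lambda>k. 1) [length (ps X)..<m])" by simp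
    moreover have "prod_list (map (\<lambda>k. 1 :: 'k poly) xs) = 1" for xs :: "nat list" by (induction xs) auto
    ultimately show ?thesis using ps X by simp
  qed
  then have img: "(\<lambda>X. cyc_poly (cycle_of X) (prod_list (map (\<lambda>h. h X) hs))) ` \<X> = (\<lambda>X. cyc_poly (cycle_of X) (f X)) ` \<X>" by auto
  have L: "lprods (map (cycle_ideal ?H ?S \<X>) hs) = I"
    unfolding cycle_ideal_lprods[OF ok ad hne] by (subst I_eq) (simp add: cycle_ideal_def img)
  have q: "quasi_semiprime J" if J: "J \<in> set (map (cycle_ideal ?H ?S \<X>) hs)" for J
  proof -
    obtain k where k: "J = cycle_ideal ?H ?S \<X> (h k)" using J by (auto simp: hs_def)
    have g1: "radical_poly (1 :: 'k poly)" by (simp add: radical_poly_def)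
    have "radical_poly (h k X)" if X: "X \<in> \<X>" for X
    proof (cases "k < length (ps X)")
      case True
      then have "ps X ! k \<in> set (ps X)" by simp
      then have "radical_poly (ps X ! k)" using ps X by blast
      then show ?thesis using True by (simp add: h_def)
    next
      case False
      then show ?thesis using g1 by (simp add: h_def)
    qed
    then show ?thesis unfolding k by (rule cycle_ideal_quasi_semiprime[OF ok ad])
  qed
  have "\<exists>Ps. Ps \<noteq> [] \<and> (\<forall>P\<in>set Ps. quasi_semiprime P \<and> P \<noteq> augm) \<and> lprods Ps = lprods (map (cycle_ideal ?H ?S \<X>) hs)"
  proof (rule lprods_drop_improper)
    show "map (cycle_ideal ?H ?S \<X>) hs \<noteq> []" using hne by simp
    show "\<forall>J\<in>set (map (cycle_ideal ?H ?S \<X>) hs). quasi_semiprime J" using q by blast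
    show "lprods (map (cycle_ideal ?H ?S \<X>) hs) \<noteq> augm" unfolding L by (rule I(2))
  qed
  then show "\<exists>Ps. Ps \<noteq> [] \<and> (\<forall>P\<in>set Ps. quasi_semiprime P \<and> P \<noteq> augm) \<and> I = lprods Ps"
    unfolding L by (elim exE conjE) (intro exI conjI, assumption+, rule sym)
qed

section \<open>Ideals built from infinitely many exclusive cycles\<close>

abbreviation X_minus_1 :: "'k poly" where "X_minus_1 \<equiv> [:- 1, 1:]"

text \<open>Evaluate at 1. In the Laurent ring this says that \<open>X_minus_1\<close> is not a
  unit.\<close>

lemma X_minus_1_not_dvd: "[:0, 1:] ^ n \<noteq> X_minus_1 * q"
proof
  assume "[:0, 1:] ^ n = X_minus_1 * q"
  then have "poly ([:0, 1:] ^ n) 1 = poly (X_minus_1 * q) (1::'k)" by simp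
  then show False by (simp add: poly_power)
qed

lemma one_laurent_ideal: "0 < n \<Longrightarrow> 1 \<notin> laurent_ideal (X_minus_1 ^ n)"
proof
  assume n: "0 < n" and "1 \<in> laurent_ideal (X_minus_1 ^ n)"
  then have "to_fract 1 \<in> laurent_ideal (X_minus_1 ^ n)" by (simp only: to_fract_1)
  then obtain m q where "1 * [:0, 1:] ^ m = X_minus_1 ^ n * q" using to_fract_laurent_ideal by blast
  moreover have "X_minus_1 ^ n = X_minus_1 * X_minus_1 ^ (n - 1)" using n by (metis power_eq_if not_gr_zero)
  ultimately have "[:0, 1:] ^ m = X_minus_1 * (X_minus_1 ^ (n - 1) * q)" by (simp only: mult_1 mult.assoc)
  then show False using X_minus_1_not_dvd by blast
qed

lemma exclusive_sets_cycle_of: assumes "X \<in> exclusive_sets H"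
  shows "is_cycle E1 r s (cycle_of X)" "cycle_of X = cycle_of (set (cycle_of X))" "s ` set (cycle_of X) \<inter> H = {}" "set (cycle_of X) = X"
proof -
  have g: "exclusive_cycle H (breaking_verts E0 E1 r s H) (cycle_of X)" and e: "set (cycle_of X) = X"
    using exclusive_family_exclusive_sets[of "{X}" H] assms by (simp_all add: exclusive_family_def)
  show "is_cycle E1 r s (cycle_of X)" "s ` set (cycle_of X) \<inter> H = {}" using g by (simp_all add: exclusive_cycle_def)
  show "cycle_of X = cycle_of (set (cycle_of X))" "set (cycle_of X) = X" using e by simp_all
qed

text \<open>Finitely many generators involve only a finite family of cycles. For a cycle outside it,
  both these generators and the graded part act as zero on its tails, whereas c - 1 does
  not.\<close>

lemma fg_over_graded_imp_finite_exclusive: assumes c2: "fg_over_graded" shows "finite_exclusive"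
  unfolding finite_exclusive_def
proof (intro allI impI, elim conjE)
  fix H assume H: "hereditary E0 E1 r s H" "saturated E0 E1 r s H"
  let ?S = "breaking_verts E0 E1 r s H"
  have ad: "admissible H ?S" using H(1) by (auto simp: admissible_def hereditary_iff)
  let ?h = "\<lambda>X :: 'e set. X_minus_1"
  define I where "I = cycle_ideal H ?S (exclusive_sets H) ?h"
  have I: "lideal I" unfolding I_def by (rule lideal_cycle_ideal)
  obtain F where F: "finite F" "F \<subseteq> augm" "lgen (graded_gens (gr_verts I) (gr_breaking I) \<union> F) = I" using c2 I by (auto simp: fg_over_graded_def)
  have "\<forall>x\<in>F. \<exists>\<Z>. finite \<Z> \<and> \<Z> \<subseteq> exclusive_sets H \<and> x \<in> cycle_ideal H ?S \<Z> ?h"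
  proof
    fix x assume "x \<in> F"
    then have "x \<in> I" using lgen_incl[of "graded_gens (gr_verts I) (gr_breaking I) \<union> F"] F(3) by auto
    then show "\<exists>\<Z>. finite \<Z> \<and> \<Z> \<subseteq> exclusive_sets H \<and> x \<in> cycle_ideal H ?S \<Z> ?h" unfolding I_def by (rule cycle_ideal_finite_support)
  qed
  then obtain Z where Z: "\<And>x. x \<in> F \<Longrightarrow> finite (Z x) \<and> Z x \<subseteq> exclusive_sets H \<and> x \<in> cycle_ideal H ?S (Z x) ?h" by metis
  define \<Z> where "\<Z> = (\<Union>x\<in>F. Z x)"
  have Zf: "finite \<Z>" "\<Z> \<subseteq> exclusive_sets H" using Z F(1) by (auto simp: \<Z>_def)
  have FZ: "F \<subseteq> cycle_ideal H ?S \<Z> ?h"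
  proof
    fix x assume x: "x \<in> F"
    have "cycle_ideal H ?S (Z x) ?h \<subseteq> cycle_ideal H ?S \<Z> ?h" unfolding cycle_ideal_def using x by (intro lgen_mono) (auto simp: \<Z>_def)
    then show "x \<in> cycle_ideal H ?S \<Z> ?h" using Z[OF x] by blast
  qed
  have "exclusive_sets H \<subseteq> \<Z>"
  proof (rule ccontr)
    assume "\<not> exclusive_sets H \<subseteq> \<Z>"
    then obtain X where X: "X \<in> exclusive_sets H" "X \<notin> \<Z>" by blast
    define c where "c = cycle_of X"
    have c: "is_cycle E1 r s c" "c = cycle_of (set c)" "s ` set c \<inter> H = {}" "set c = X"
      using exclusive_sets_cycle_of[OF X(1)] by (auto simp: c_def)
    have IA: "I \<subseteq> tail_ann c X_minus_1" using cycle_ideal_tail_ann[OF exclusive_family_exclusive_sets[OF order.refl] ad c(1-3), of ?h] X c(4) by (simp add: I_def)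
    have KA: "cycle_ideal H ?S \<Z> ?h \<subseteq> tail_ann c 0" using cycle_ideal_tail_ann[OF exclusive_family_exclusive_sets[OF Zf(2)] ad c(1-3), of ?h] X c(4) by simp
    have 1: "1 \<notin> laurent_ideal X_minus_1" using one_laurent_ideal[of 1] by simp
    \<comment> \<open>Vertices and elements \<open>v^H\<close> act by restricting functions to a set
      of paths. If such an action vanishes modulo the nonunit \<open>X_minus_1\<close>, that set
      contains no tail and the action is zero.\<close>
    have "graded_gens (gr_verts I) (gr_breaking I) \<subseteq> tail_ann c 0"
    proof
      fix x assume "x \<in> graded_gens (gr_verts I) (gr_breaking I)"
      then consider v where "v \<in> gr_verts I" "x = VV v" | v where "v \<in> gr_breaking I" "x = breaking_elem (gr_verts I) v" by (auto simp: graded_gens_def)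
      then show "x \<in> tail_ann c 0"
      proof cases
        case 1
        then have "VV v \<in> tail_ann c X_minus_1" using IA by (auto simp: gr_verts_def)
        then show ?thesis using VV_tail_annD[OF _ \<open>1 \<notin> laurent_ideal X_minus_1\<close>] 1 VV_tail_ann by blast
      next
        case 2
        let ?F = "{e \<in> out v. r e \<notin> gr_verts I}"
        have fF: "finite ?F" using 2 by (auto simp: gr_breaking_def breaking_verts_def out_def conj_assoc)
        have "nu v ?F \<in> tail_ann c X_minus_1" using 2 IA by (auto simp: gr_breaking_def breaking_elem_def)
        then have "q 0 \<in> ?F" if "q \<in> cycle_tails c" "s (q 0) = v" for q
          by (rule nu_tail_annD[OF _ \<open>1 \<notin> laurent_ideal X_minus_1\<close> fF _ that]) auto
        then show ?thesis unfolding 2 breaking_elem_def by (intro nu_tail_ann fF) auto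
      qed
    qed
    then have "I \<subseteq> tail_ann c 0" using F(3) FZ KA lgen_least[OF lideal_tail_ann[of c 0], of "graded_gens (gr_verts I) (gr_breaking I) \<union> F"] by auto
    moreover have "cyc_poly c X_minus_1 \<in> I" unfolding I_def c_def by (rule cyc_poly_cycle_ideal[OF X(1), where h = ?h])
    ultimately have "cyc_poly c X_minus_1 \<in> tail_ann c 0" by blast
    then obtain n q where "X_minus_1 * [:0, 1:] ^ n = 0 * q" using cyc_poly_tail_annD[OF c(1) refl] by blast
    then have "X_minus_1 = 0 \<or> [:0, 1 :: 'k:] ^ n = 0" by (simp only: mult_zero_left mult_eq_0_iff)
    then show False by simp
  qed
  then show "finite (exclusive_sets H)" using Zf finite_subset by blast
qed

text \<open>The exponent is halved repeatedly. With \<open>b\<close> the power at about half the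
  exponent, \<open>b\<close> commutes with corner elements modulo \<open>P\<close>, so every
  \<open>b * (z * b)\<close> is in \<open>P\<close> and the ideal generated by \<open>b\<close> has
  its square there.\<close>

lemma quasi_semiprime_cyc_poly_root:
  assumes P: "quasi_semiprime P" and e: "exitless P c" and j: "j > 0" "cyc_poly c (p ^ j) \<in> P"
  shows "cyc_poly c p \<in> P"
  using j
proof (induction j rule: less_induct)
  case (less j)
  have Pl: "lideal P" using P by (simp add: quasi_semiprime_def)
  have cyc: "is_cycle E1 r s c" using e by (simp add: exitless_def)
  let ?v = "s (hd c)"
  show ?case
  proof (cases "j = 1")
    case False
    \<comment> \<open>Half of \<open>j\<close>, rounded up: twice \<open>i\<close> reaches
      \<open>j\<close>, and \<open>i < j\<close> because \<open>j\<close> exceeds 1.\<close>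
    define i where "i = (j + 1) div 2"
    have i: "0 < i" "i < j" "j \<le> 2 * i" using False less.prems(1) by (auto simp: i_def)
    define b where "b = cyc_poly c (p ^ i)"
    have cb: "corner ?v b" unfolding b_def by (rule cyc_poly_corner[OF cyc refl])
    have "cyc_poly c (p ^ j * p ^ (2 * i - j)) \<in> P"
      using eqv_mem[OF Pl cyc_poly_mult[OF cyc refl]] lideal_rmult[OF Pl less.prems(2)] by blast
    moreover have "p ^ j * p ^ (2 * i - j) = p ^ i * p ^ i"
      unfolding power_add[symmetric] using i(3) by (simp add: mult_2)
    ultimately have bb: "b * b \<in> P" using eqv_mem[OF Pl cyc_poly_mult[OF cyc refl, of "p ^ i" "p ^ i"]] by (simp add: b_def)
    have bzb: "b * (z * b) \<in> P" for z
    proof -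
      define u where "u = VV ?v * (z * VV ?v)"
      have cu: "corner ?v u"
      proof (rule cornerI)
        show "VV ?v * u \<approx> u" using eqv_rmult[OF rel_VV1[of ?v], of "z * VV ?v"] by (simp add: u_def mult.assoc)
        show "u * VV ?v \<approx> u" using eqv_lmult[OF rel_VV1[of ?v], of "VV ?v * z"] by (simp add: u_def mult.assoc)
      qed
      have "cg P (u * b) (b * u)" unfolding b_def
        by (rule corner_commute[OF cyc refl Pl e _ cu]) (simp add: u_def augm_mult1)
      then have "cg P (b * (u * b)) (b * (b * u))" by (rule cg_lmult[OF Pl])
      moreover have "b * (b * u) \<in> P" using lideal_rmult[OF Pl bb, of u] by (simp add: mult.assoc)
      ultimately have "b * (u * b) \<in> P" using cg_mem[OF Pl] by blast
      moreover have "(b * VV ?v) * (z * (VV ?v * b)) \<approx> b * (z * b)"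
        by (intro eqv_mult eqv_refl corner_r[OF cb] corner_l[OF cb])
      then have "b * (u * b) \<approx> b * (z * b)" by (simp add: u_def mult.assoc)
      ultimately show ?thesis using eqv_mem[OF Pl] by blast
    qed
    have ba: "{b} \<subseteq> augm" by (simp add: b_def cyc_poly_augm)
    have "\<forall>x\<in>lgen {b}. \<forall>y\<in>lgen {b}. x * y \<in> P" using lgen_prod[OF Pl ba ba] bzb by blast
    then have "lgen {b} \<subseteq> P" using P lideal_lgen[OF ba] by (auto simp: quasi_semiprime_def)
    then have "b \<in> P" using lgen_incl by blast
    then show ?thesis using less.IH[OF i(2,1)] by (simp add: b_def)
  qed (use less in simp)
qed

lemma cyc_poly_power_lprods:
  assumes cyc: "is_cycle E1 r s c" and "Ps \<noteq> []" "\<forall>P\<in>set Ps. lideal P \<and> cyc_poly c p \<in> P"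
  shows "cyc_poly c (p ^ length Ps) \<in> lprods Ps"
  using assms(2,3)
proof (induction Ps rule: lprods.induct)
  case (3 A B As)
  have "lideal (lprods (A # B # As))" using 3 by (intro lideal_lprods) auto
  moreover have "cyc_poly c p * cyc_poly c (p ^ length (B # As)) \<in> lprods (A # B # As)"
    using 3 by (auto intro!: lprodI)
  ultimately show ?case using eqv_mem[OF _ cyc_poly_mult[OF cyc refl, of p "p ^ length (B # As)"]] by simp
qed auto

lemma semiprime_products_imp_finite_exclusive: assumes c1: "semiprime_products" shows "finite_exclusive"
  unfolding finite_exclusive_def
proof (intro allI impI, elim conjE, rule ccontr)
  fix H assume H: "hereditary E0 E1 r s H" "saturated E0 E1 r s H" and inf: "infinite (exclusive_sets H)"
  let ?S = "breaking_verts E0 E1 r s H"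
  have ad: "admissible H ?S" using H(1) by (auto simp: admissible_def hereditary_iff)
  obtain g :: "nat \<Rightarrow> 'e set" where g: "inj g" "range g \<subseteq> exclusive_sets H" using infinite_countable_subset[OF inf] by blast
  \<comment> \<open>The n-th cycle receives exponent n, so no single exponent serves all
    cycles.\<close>
  define h where "h X = X_minus_1 ^ (inv g X)" for X
  define I where "I = cycle_ideal H ?S (range g) h"
  have I: "lideal I" unfolding I_def by (rule lideal_cycle_ideal)
  have X: "g n \<in> exclusive_sets H" for n using g by blast
  have hn: "h (g n) = X_minus_1 ^ n" for n using g by (simp add: h_def)
  have IA: "I \<subseteq> tail_ann (cycle_of (g n)) (X_minus_1 ^ n)" for n
    using cycle_ideal_tail_ann[OF exclusive_family_exclusive_sets[OF g(2)] ad exclusive_sets_cycle_of(1-3)[OF X[of n]], of h] exclusive_sets_cycle_of(4)[OF X[of n]]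
    by (simp add: I_def hn)
  have notin: "cyc_poly (cycle_of (g n)) (X_minus_1 ^ m) \<notin> I" if mn: "m < n" for m n
  proof
    assume "cyc_poly (cycle_of (g n)) (X_minus_1 ^ m) \<in> I"
    then obtain k q where "X_minus_1 ^ m * [:0, 1:] ^ k = X_minus_1 ^ n * q"
      using IA[of n] cyc_poly_tail_annD[OF exclusive_sets_cycle_of(1)[OF X[of n]] refl] by blast
    moreover obtain t where "n = m + Suc t" using mn less_iff_Suc_add by auto
    ultimately have "X_minus_1 ^ m * [:0, 1:] ^ k = X_minus_1 ^ m * (X_minus_1 * (X_minus_1 ^ t * q))" by (simp only: power_add power_Suc mult.assoc)
    moreover have "X_minus_1 ^ m \<noteq> 0" by (rule power_not_zero) simp
    ultimately have "[:0, 1:] ^ k = X_minus_1 * (X_minus_1 ^ t * q)" using mult_left_cancel[of "X_minus_1 ^ m"] by blast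
    then show False using X_minus_1_not_dvd by blast
  qed
  have "cyc_poly (cycle_of (g 1)) (X_minus_1 ^ 0) \<in> augm" by (rule cyc_poly_augm)
  \<comment> \<open>The zeroth power is the base vertex itself, which is missing from
    \<open>I\<close>.\<close>
  then have "I \<noteq> augm" using notin[of 0 1] by auto
  then obtain Ps where Ps: "Ps \<noteq> []" "\<forall>P\<in>set Ps. quasi_semiprime P \<and> P \<noteq> augm" "I = lprods Ps"
    using c1 I unfolding semiprime_products_def by blast
  \<comment> \<open>One more than the number of factors: the product then contains a power of c - 1
    that is too low for \<open>I\<close>.\<close>
  define n where "n = Suc (length Ps)"
  define c where "c = cycle_of (g n)"
  have cyc: "is_cycle E1 r s c" unfolding c_def by (rule exclusive_sets_cycle_of(1)[OF X])
  have lP: "\<forall>P\<in>set Ps. lideal P" using Ps(2) by (auto simp: quasi_semiprime_def)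
  have "cyc_poly c X_minus_1 \<in> P" if P: "P \<in> set Ps" for P
  proof (rule quasi_semiprime_cyc_poly_root[of P c n])
    have IP: "I \<subseteq> P" using Ps(3) lprods_sub[OF lP P] by simp
    show "quasi_semiprime P" using Ps(2) P by blast
    have "exclusive_cycle H ?S c" using exclusive_family_exclusive_sets[OF g(2)] by (auto simp: exclusive_family_def c_def)
    then have "exitless (lgen (graded_gens H ?S)) c" by (rule exclusive_cycle_exitless)
    moreover have "lgen (graded_gens H ?S) \<subseteq> P" using cycle_ideal_graded_gens IP unfolding I_def by blast
    ultimately show "exitless P c" using exitless_mono by blast
    have "cyc_poly c (h (g n)) \<in> I" unfolding I_def c_def by (rule cyc_poly_cycle_ideal) simp
    then show "cyc_poly c (X_minus_1 ^ n) \<in> P" using IP by (auto simp: hn)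
  qed (simp add: n_def)
  then have "cyc_poly c (X_minus_1 ^ length Ps) \<in> lprods Ps" using lP by (intro cyc_poly_power_lprods cyc Ps(1)) auto
  then show False using notin[of "length Ps" n] Ps(3) by (simp add: n_def c_def)
qed

end

section \<open>Passage to the quotient\<close>

text \<open>A quotient map with kernel \<open>N\<close> from a part \<open>T\<close> of a ring;
  \<open>T\<close> is a subset because the algebra without unit lives inside a unital one. A
  quotient of \<open>L\<close> is again of this form over the same \<open>T\<close>, so the same
  lemmas serve the free algebra, the Leavitt path algebra and its quotients.\<close>

locale nhom =
  fixes T N :: "'a::ring set" and cl :: "'a \<Rightarrow> 'b" and L :: "'b nrng"
  assumes T0: "0 \<in> T" and T_add: "x \<in> T \<Longrightarrow> y \<in> T \<Longrightarrow> x + y \<in> T"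
    and T_mult: "x \<in> T \<Longrightarrow> y \<in> T \<Longrightarrow> x * y \<in> T" and T_uminus: "x \<in> T \<Longrightarrow> - x \<in> T"
    and N_T: "N \<subseteq> T" and carr: "rcarr L = cl ` T"
    and cl_add: "x \<in> T \<Longrightarrow> y \<in> T \<Longrightarrow> radd L (cl x) (cl y) = cl (x + y)"
    and cl_mult: "x \<in> T \<Longrightarrow> y \<in> T \<Longrightarrow> rmul L (cl x) (cl y) = cl (x * y)"
    and cl_uminus: "x \<in> T \<Longrightarrow> rneg L (cl x) = cl (- x)"
    and cl_zero: "rzero L = cl 0"
    and cl_eq: "x \<in> T \<Longrightarrow> y \<in> T \<Longrightarrow> cl x = cl y \<longleftrightarrow> x - y \<in> N"
begin

lemma T_diff: "x \<in> T \<Longrightarrow> y \<in> T \<Longrightarrow> x - y \<in> T" using T_add[of x "- y"] T_uminus by simp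

definition tsub :: "'a set \<Rightarrow> bool" where
  "tsub J \<longleftrightarrow> J \<subseteq> T \<and> 0 \<in> J \<and> (\<forall>x\<in>J. \<forall>y\<in>J. x - y \<in> J)"

definition tid :: "'a set \<Rightarrow> bool" where
  "tid J \<longleftrightarrow> tsub J \<and> (\<forall>x\<in>J. \<forall>a\<in>T. a * x \<in> J \<and> x * a \<in> J)"

definition pre :: "'b set \<Rightarrow> 'a set" where "pre I = {x \<in> T. cl x \<in> I}"

lemma tsub_uminus: "tsub J \<Longrightarrow> x \<in> J \<Longrightarrow> - x \<in> J" unfolding tsub_def by (metis diff_0)
lemma tsub_add: "tsub J \<Longrightarrow> x \<in> J \<Longrightarrow> y \<in> J \<Longrightarrow> x + y \<in> J"
  using tsub_uminus[of J y] unfolding tsub_def by (metis diff_minus_eq_add)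

lemma cl_N: "x \<in> T \<Longrightarrow> cl x = cl 0 \<longleftrightarrow> x \<in> N" using cl_eq[of x 0] T0 by simp

lemma pre_tsub: assumes I: "add_subgroup L I" shows "tsub (pre I)" "N \<subseteq> pre I" "cl ` pre I = I"
proof -
  have z: "cl 0 \<in> I" using I by (simp add: add_subgroup_def cl_zero)
  have d: "cl (x - y) \<in> I" if "x \<in> T" "y \<in> T" "cl x \<in> I" "cl y \<in> I" for x y
  proof -
    have "radd L (cl x) (rneg L (cl y)) \<in> I" using I that by (simp add: add_subgroup_def)
    then show ?thesis using that cl_add[of x "- y"] T_uminus by (simp add: cl_uminus)
  qed
  show "tsub (pre I)" using z d by (auto simp: tsub_def pre_def T0 intro: T_diff)
  show "N \<subseteq> pre I"
  proof
    fix x assume "x \<in> N"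
    then show "x \<in> pre I" using cl_N[of x] N_T z by (auto simp: pre_def)
  qed
  show "cl ` pre I = I" using I carr by (auto simp: pre_def add_subgroup_def)
qed

lemma pre_tid: assumes I: "rideal L I" shows "tid (pre I)"
proof -
  have "cl (a * x) \<in> I \<and> cl (x * a) \<in> I" if "x \<in> T" "a \<in> T" "cl x \<in> I" for x a
  proof -
    have "rmul L (cl a) (cl x) \<in> I" "rmul L (cl x) (cl a) \<in> I" using I that carr by (auto simp: rideal_def)
    then show ?thesis using that by (simp add: cl_mult)
  qed
  then show ?thesis using pre_tsub(1) I by (auto simp: tid_def rideal_def pre_def intro: T_mult)
qed

lemma cl_tsub: assumes J: "tsub J" shows "add_subgroup L (cl ` J)"
  unfolding add_subgroup_def
proof (intro conjI ballI)
  have JT: "J \<subseteq> T" using J by (simp add: tsub_def)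
  show "cl ` J \<subseteq> rcarr L" using JT carr by auto
  show "rzero L \<in> cl ` J" using J by (simp add: cl_zero tsub_def)
  fix a assume "a \<in> cl ` J"
  then obtain x where x: "x \<in> J" "a = cl x" by blast
  show "rneg L a \<in> cl ` J" using x JT tsub_uminus[OF J x(1)] cl_uminus by auto
  fix b assume "b \<in> cl ` J"
  then obtain y where y: "y \<in> J" "b = cl y" by blast
  have "radd L a b = cl (x + y)" using x y JT cl_add by blast
  then show "radd L a b \<in> cl ` J" using tsub_add[OF J x(1) y(1)] by blast
qed

lemma pre_cl: assumes J: "tsub J" "N \<subseteq> J" shows "pre (cl ` J) = J"
proof
  show "J \<subseteq> pre (cl ` J)" using J by (auto simp: pre_def tsub_def)
  show "pre (cl ` J) \<subseteq> J"
  proof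
    fix x assume "x \<in> pre (cl ` J)"
    then obtain y where y: "x \<in> T" "y \<in> J" "cl x = cl y" by (auto simp: pre_def)
    then have "x - y \<in> J" using cl_eq[of x y] J by (auto simp: tsub_def)
    then show "x \<in> J" using tsub_add[OF J(1) _ y(2)] by fastforce
  qed
qed

lemma cl_tid: assumes J: "tid J" shows "rideal L (cl ` J)"
proof -
  have "rmul L a x \<in> cl ` J \<and> rmul L x a \<in> cl ` J" if xa: "x \<in> cl ` J" "a \<in> rcarr L" for a x
  proof -
    obtain y b where yb: "y \<in> J" "x = cl y" "b \<in> T" "a = cl b" using xa carr by blast
    then have "y \<in> T" using J by (auto simp: tid_def tsub_def)
    then show ?thesis using yb J cl_mult by (auto simp: tid_def)
  qed
  then show ?thesis using cl_tsub[of J] J by (auto simp: rideal_def tid_def)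
qed

lemma cl_image_eq: "tsub A \<Longrightarrow> N \<subseteq> A \<Longrightarrow> tsub B \<Longrightarrow> N \<subseteq> B \<Longrightarrow> cl ` A = cl ` B \<longleftrightarrow> A = B"
  using pre_cl by metis

lemma tsub_T: "tsub T" by (auto simp: tsub_def T0 intro: T_diff)
lemma tid_T: "tid T" using tsub_T by (auto simp: tid_def intro: T_mult)

definition tgen :: "'a set \<Rightarrow> 'a set" where "tgen X = \<Inter>{J. tid J \<and> N \<subseteq> J \<and> X \<subseteq> J}"

lemma tgen_tid: assumes "X \<subseteq> T" shows "tid (tgen X)"
proof -
  have "tgen X \<subseteq> T" using tid_T N_T assms unfolding tgen_def by blast
  then show ?thesis unfolding tid_def tsub_def by (auto simp: tgen_def tid_def tsub_def)
qed

lemma tgen_incl: "X \<subseteq> tgen X" "N \<subseteq> tgen X" unfolding tgen_def by blast+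

lemma rgenideal_cl: assumes X: "X \<subseteq> T" shows "rgenideal L (cl ` X) = cl ` tgen X"
proof
  show "rgenideal L (cl ` X) \<subseteq> cl ` tgen X"
    unfolding rgenideal_def using cl_tid[OF tgen_tid[OF X]] tgen_incl(1)[of X] by blast
  show "cl ` tgen X \<subseteq> rgenideal L (cl ` X)" unfolding rgenideal_def
  proof (rule Inter_greatest, elim CollectE conjE)
    fix I assume I: "rideal L I" "cl ` X \<subseteq> I"
    have "N \<subseteq> pre I" "cl ` pre I = I" using pre_tsub I by (auto simp: rideal_def)
    moreover have "X \<subseteq> pre I" using I X by (auto simp: pre_def)
    ultimately have "tgen X \<subseteq> pre I" using pre_tid[OF I(1)] unfolding tgen_def by blast
    then show "cl ` tgen X \<subseteq> I" by (auto simp: pre_def)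
  qed
qed

definition tprod :: "'a set \<Rightarrow> 'a set \<Rightarrow> 'a set" where
  "tprod A B = \<Inter>{J. tsub J \<and> N \<subseteq> J \<and> {a * b | a b. a \<in> A \<and> b \<in> B} \<subseteq> J}"

lemma ideal_prod_cl: assumes A: "A \<subseteq> T" and B: "B \<subseteq> T"
  shows "ideal_prod L (cl ` A) (cl ` B) = cl ` tprod A B"
proof
  have P: "{rmul L a b | a b. a \<in> cl ` A \<and> b \<in> cl ` B} = cl ` {a * b | a b. a \<in> A \<and> b \<in> B}"
  proof (intro equalityI subsetI)
    fix x assume "x \<in> {rmul L a b | a b. a \<in> cl ` A \<and> b \<in> cl ` B}"
    then obtain a b where ab: "a \<in> A" "b \<in> B" "x = rmul L (cl a) (cl b)" by blast
    then have "x = cl (a * b)" using A B cl_mult by blast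
    then show "x \<in> cl ` {a * b | a b. a \<in> A \<and> b \<in> B}" using ab by blast
  next
    fix x assume "x \<in> cl ` {a * b | a b. a \<in> A \<and> b \<in> B}"
    then obtain a b where ab: "a \<in> A" "b \<in> B" "x = cl (a * b)" by blast
    then have "a \<in> T" "b \<in> T" using A B by blast+
    then have "x = rmul L (cl a) (cl b)" using ab(3) by (simp add: cl_mult)
    then show "x \<in> {rmul L a b | a b. a \<in> cl ` A \<and> b \<in> cl ` B}" using ab by blast
  qed
  have PT: "{a * b | a b. a \<in> A \<and> b \<in> B} \<subseteq> T" using A B T_mult by blast
  have "tprod A B \<subseteq> T" using tsub_T N_T PT unfolding tprod_def by blast
  then have s: "tsub (tprod A B)" unfolding tsub_def by (auto simp: tprod_def tsub_def)
  have "{a * b | a b. a \<in> A \<and> b \<in> B} \<subseteq> tprod A B" unfolding tprod_def by blast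
  then show "ideal_prod L (cl ` A) (cl ` B) \<subseteq> cl ` tprod A B"
    unfolding ideal_prod_def P using cl_tsub[OF s] by blast
  show "cl ` tprod A B \<subseteq> ideal_prod L (cl ` A) (cl ` B)" unfolding ideal_prod_def P
  proof (rule Inter_greatest, elim CollectE conjE)
    fix I assume I: "add_subgroup L I" "cl ` {a * b | a b. a \<in> A \<and> b \<in> B} \<subseteq> I"
    have "{a * b | a b. a \<in> A \<and> b \<in> B} \<subseteq> pre I" using I(2) PT by (auto simp: pre_def)
    then have "tprod A B \<subseteq> pre I" using pre_tsub(1,2)[OF I(1)] unfolding tprod_def by blast
    then show "cl ` tprod A B \<subseteq> I" by (auto simp: pre_def)
  qed
qed

lemma rcoset_cl: assumes G: "rideal L G" and x: "x \<in> T"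
  shows "rcoset L G (cl x) = cl ` {z \<in> T. z - x \<in> pre G}"
proof (intro equalityI subsetI)
  fix y assume "y \<in> rcoset L G (cl x)"
  then obtain z where z: "z \<in> T" "y = cl z" "radd L (cl z) (rneg L (cl x)) \<in> G" by (auto simp: rcoset_def carr)
  then have "cl (z - x) \<in> G" using x cl_add[of z "- x"] cl_uminus T_uminus by simp
  then show "y \<in> cl ` {z \<in> T. z - x \<in> pre G}" using z x T_diff by (auto simp: pre_def)
next
  fix y assume "y \<in> cl ` {z \<in> T. z - x \<in> pre G}"
  then obtain z where z: "z \<in> T" "y = cl z" "cl (z - x) \<in> G" by (auto simp: pre_def)
  then show "y \<in> rcoset L G (cl x)"
    using x cl_add[of z "- x"] cl_uminus T_uminus by (auto simp: rcoset_def carr)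
qed

text \<open>The operations of \<open>rquot\<close> act on representatives chosen by
  \<open>SOME\<close>, which are known only up to \<open>pre G\<close>. As \<open>pre G\<close> is a
  two-sided ideal, the choice does not affect the resulting coset.\<close>

lemma nhom_rquot: assumes G: "rideal L G"
  shows "nhom T (pre G) (\<lambda>x. rcoset L G (cl x)) (rquot L G)"
proof -
  let ?c = "\<lambda>x. rcoset L G (cl x)"
  have P: "tid (pre G)" "tsub (pre G)" using pre_tid[OF G] by (auto simp: tid_def)
  have eq: "?c x = ?c y \<longleftrightarrow> x - y \<in> pre G" if xy: "x \<in> T" "y \<in> T" for x y
  proof
    assume "?c x = ?c y"
    moreover have "cl x \<in> ?c x" unfolding rcoset_cl[OF G xy(1)] using xy P by (auto simp: tsub_def)
    ultimately obtain z where z: "z \<in> T" "cl x = cl z" "z - y \<in> pre G" unfolding rcoset_cl[OF G xy(2)] by auto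
    have "x - z \<in> pre G" using z xy cl_eq[of x z] pre_tsub(2) G by (auto simp: rideal_def)
    then show "x - y \<in> pre G" using tsub_add[OF P(2) _ z(3)] by fastforce
  next
    assume d: "x - y \<in> pre G"
    have "z - x \<in> pre G \<longleftrightarrow> z - y \<in> pre G" for z
      using tsub_add[OF P(2) _ d, of "z - x"] P(2) d unfolding tsub_def
      by (metis (no_types, lifting) add_diff_cancel_right' diff_add_cancel diff_diff_eq2)
    then show "?c x = ?c y" unfolding rcoset_cl[OF G xy(1)] rcoset_cl[OF G xy(2)] by simp
  qed
  have some: "\<exists>z\<in>T. (SOME y. y \<in> ?c x) = cl z \<and> z - x \<in> pre G" if x: "x \<in> T" for x
  proof -
    have "cl x \<in> ?c x" unfolding rcoset_cl[OF G x] using x P by (auto simp: tsub_def)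
    then have "(SOME y. y \<in> ?c x) \<in> ?c x" by (rule someI)
    then show ?thesis unfolding rcoset_cl[OF G x] by auto
  qed
  show ?thesis
  proof unfold_locales
    show "pre G \<subseteq> T" by (auto simp: pre_def)
    show "rcarr (rquot L G) = ?c ` T" by (auto simp: rquot_def carr)
    show "rzero (rquot L G) = ?c 0" by (simp add: rquot_def cl_zero)
    fix x assume x: "x \<in> T"
    obtain x' where x': "x' \<in> T" "(SOME y. y \<in> ?c x) = cl x'" "x' - x \<in> pre G" using some[OF x] by blast
    have "- x' - (- x) \<in> pre G" using tsub_uminus[OF P(2) x'(3)] by simp
    then have "?c (- x') = ?c (- x)" using eq[of "- x'" "- x"] x x' T_uminus by auto
    then show "rneg (rquot L G) (?c x) = ?c (- x)" using x' by (simp add: rquot_def cl_uminus)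
    fix y assume y: "y \<in> T"
    obtain y' where y': "y' \<in> T" "(SOME z. z \<in> ?c y) = cl y'" "y' - y \<in> pre G" using some[OF y] by blast
    have "(x' - x) + (y' - y) \<in> pre G" by (rule tsub_add[OF P(2) x'(3) y'(3)])
    then have "(x' + y') - (x + y) \<in> pre G" by (simp add: algebra_simps)
    then have "?c (x' + y') = ?c (x + y)" using eq[of "x' + y'" "x + y"] x x' y y' T_add by auto
    then show "radd (rquot L G) (?c x) (?c y) = ?c (x + y)" using x' y' by (simp add: rquot_def cl_add)
    have "(x' - x) * y' \<in> pre G" "x * (y' - y) \<in> pre G" using P(1) x x' y' by (auto simp: tid_def)
    then have "(x' - x) * y' + x * (y' - y) \<in> pre G" by (rule tsub_add[OF P(2)])
    then have "x' * y' - x * y \<in> pre G" by (simp add: algebra_simps)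
    then have "?c (x' * y') = ?c (x * y)" using eq[of "x' * y'" "x * y"] x x' y y' T_mult by auto
    then show "rmul (rquot L G) (?c x) (?c y) = ?c (x * y)" using x' y' by (simp add: rquot_def cl_mult)
    show "?c x = ?c y \<longleftrightarrow> x - y \<in> pre G" by (rule eq[OF x y])
  qed (auto intro: T0 T_add T_mult T_uminus)
qed

end

section \<open>Identifying the two presentations of the free algebra\<close>

lemma lookup_mult_list:
  "Poly_Mapping.lookup (f * g) w = (\<Sum>i\<le>length w. Poly_Mapping.lookup f (take i w) * Poly_Mapping.lookup g (drop i w))"
  for f g :: "('v, 'e, 'k::field) fa"
proof (induction f rule: fa_induct)
  case (add f f')
  then show ?case by (simp add: distrib_right lookup_add sum.distrib)
next
  case (single u a)
  show ?case
  proof (induction g rule: fa_induct)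
    case (add g g')
    then show ?case by (simp add: distrib_left lookup_add sum.distrib)
  next
    case (single t b)
    show ?case
    proof (cases "w = u @ t")
      case True
      have "(\<Sum>i\<le>length w. Poly_Mapping.lookup (Poly_Mapping.single u a) (take i w) * Poly_Mapping.lookup (Poly_Mapping.single t b) (drop i w))
        = (\<Sum>i\<le>length w. if i = length u then a * b else 0)"
      proof (rule sum.cong)
        fix i assume "i \<in> {..length w}"
        then have "length (take i w) = i" by simp
        then have "u = take i w \<longleftrightarrow> i = length u" using True by (metis append_eq_conv_conj)
        then show "Poly_Mapping.lookup (Poly_Mapping.single u a) (take i w) * Poly_Mapping.lookup (Poly_Mapping.single t b) (drop i w)
          = (if i = length u then a * b else 0)" using True by (auto simp: lookup_single when_def)
      qed simp
      then show ?thesis using True by (simp add: mult_single_list lookup_single)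
    next
      case False
      have "Poly_Mapping.lookup (Poly_Mapping.single u a) (take i w) * Poly_Mapping.lookup (Poly_Mapping.single t b) (drop i w) = 0" for i
        using False append_take_drop_id[of i w] by (auto simp: lookup_single when_def)
      then have "(\<Sum>i\<le>length w. Poly_Mapping.lookup (Poly_Mapping.single u a) (take i w) * Poly_Mapping.lookup (Poly_Mapping.single t b) (drop i w)) = 0"
        by (intro sum.neutral ballI)
      then show ?thesis using False by (simp add: mult_single_list lookup_single when_def)
    qed
  qed simp
qed simp

context graph begin

text \<open>Words with a letter outside the graph are deleted. On \<open>augm\<close> this loses
  only elements of \<open>NN\<close>, so the quotients by the relations agree.\<close>

definition restrict_gens :: "('v, 'e, 'k) fa \<Rightarrow> ('v, 'e) gen list \<Rightarrow> 'k" where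
  "restrict_gens f = (\<lambda>w. if set w \<subseteq> gens E0 E1 then Poly_Mapping.lookup f w else 0)"

lemma restrict_gens_add: "restrict_gens (f + g) = (\<lambda>w. restrict_gens f w + restrict_gens g w)" by (rule ext) (simp add: restrict_gens_def lookup_add)
lemma restrict_gens_uminus: "restrict_gens (- f) = (\<lambda>w. - restrict_gens f w)" by (rule ext) (simp add: restrict_gens_def)
lemma restrict_gens_diff: "restrict_gens (f - g) = (\<lambda>w. restrict_gens f w - restrict_gens g w)" by (rule ext) (simp add: restrict_gens_def lookup_minus)
lemma restrict_gens_0: "restrict_gens 0 = (\<lambda>w. 0)" by (rule ext) (simp add: restrict_gens_def)
lemma restrict_gens_sum: "restrict_gens (sum f A) = (\<lambda>w. \<Sum>i\<in>A. restrict_gens (f i) w)" by (rule ext) (simp add: restrict_gens_def lookup_sum)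

lemma restrict_gens_mult: "restrict_gens (f * g) = fa_mul (restrict_gens f) (restrict_gens g)"
proof
  fix w
  show "restrict_gens (f * g) w = fa_mul (restrict_gens f) (restrict_gens g) w"
  proof (cases "set w \<subseteq> gens E0 E1")
    case True
    then have "set (take i w) \<subseteq> gens E0 E1" "set (drop i w) \<subseteq> gens E0 E1" for i
      using set_take_subset[of i w] set_drop_subset[of i w] by blast+
    then show ?thesis using True by (simp add: restrict_gens_def fa_mul_def lookup_mult_list)
  next
    case False
    have "restrict_gens f (take i w) * restrict_gens g (drop i w) = 0" for i
    proof -
      have "set w = set (take i w) \<union> set (drop i w)" by (metis append_take_drop_id set_append)
      then show ?thesis using False by (auto simp: restrict_gens_def)
    qed
    then have "fa_mul (restrict_gens f) (restrict_gens g) w = 0" unfolding fa_mul_def by (intro sum.neutral ballI)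
    then show ?thesis using False by (simp add: restrict_gens_def)
  qed
qed

lemma restrict_gens_sc: "restrict_gens (sc k * f) = fa_smult k (restrict_gens f)"
proof
  fix w
  have "Poly_Mapping.lookup (sc k * f) w = (\<Sum>i\<le>length w. if i = 0 then k * Poly_Mapping.lookup f w else 0)"
    unfolding lookup_mult_list by (rule sum.cong) (auto simp: sc_def lookup_single when_def)
  then show "restrict_gens (sc k * f) w = fa_smult k (restrict_gens f) w" by (simp add: restrict_gens_def fa_smult_def)
qed

lemma restrict_gens_letter: "g \<in> gens E0 E1 \<Longrightarrow> restrict_gens (letter g) = fa_gen g"
  by (rule ext) (auto simp: restrict_gens_def letter_def fa_gen_def lookup_single when_def)

lemma restrict_gens_junk: "g \<notin> gens E0 E1 \<Longrightarrow> restrict_gens (letter g) = (\<lambda>w. 0)"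
  by (rule ext) (auto simp: restrict_gens_def letter_def lookup_single when_def)

definition junk :: "('v, 'e, 'k) fa set" where "junk = {f \<in> augm. restrict_gens f = (\<lambda>w. 0)}"

lemma nhom_free: "nhom augm junk restrict_gens (free_alg E0 E1)"
proof unfold_locales
  have "fa_carr E0 E1 = restrict_gens ` augm"
  proof (intro equalityI subsetI)
    fix h assume h: "h \<in> (fa_carr E0 E1 :: (('v, 'e) gen list \<Rightarrow> 'k) set)"
    define f where "f = Abs_poly_mapping h"
    have l: "Poly_Mapping.lookup f = h" unfolding f_def using h by (intro lookup_Abs_poly_mapping) (simp add: fa_carr_def)
    have "restrict_gens f = h" using h by (intro ext) (auto simp: restrict_gens_def l fa_carr_def)
    moreover have "f \<in> augm" using h by (simp add: augm_def l fa_carr_def)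
    ultimately show "h \<in> restrict_gens ` augm" by blast
  next
    fix h assume "h \<in> restrict_gens ` augm"
    then obtain f where f: "f \<in> augm" "h = restrict_gens f" by blast
    have "{w. restrict_gens f w \<noteq> 0} \<subseteq> Poly_Mapping.keys f" by (auto simp: restrict_gens_def in_keys_iff)
    then have "finite {w. restrict_gens f w \<noteq> 0}" by (rule finite_subset) simp
    moreover have "restrict_gens f [] = 0" using f by (simp add: restrict_gens_def augm_def)
    moreover have "set w \<subseteq> gens E0 E1" if "restrict_gens f w \<noteq> 0" for w using that by (auto simp: restrict_gens_def split: if_splits)
    ultimately show "h \<in> fa_carr E0 E1" unfolding f(2) fa_carr_def by blast
  qed
  then show "rcarr (free_alg E0 E1) = restrict_gens ` augm" by (simp add: free_alg_def)
qed (auto simp: free_alg_def restrict_gens_add restrict_gens_mult restrict_gens_uminus restrict_gens_0 restrict_gens_diff junk_def fun_eq_iff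
    intro: augm_intros)

lemma junk_single: "\<not> set w \<subseteq> gens E0 E1 \<Longrightarrow> Poly_Mapping.single w k \<in> NN"
proof (induction w)
  case (Cons g w)
  show ?case
  proof (cases "g \<in> gens E0 E1")
    case True
    then show ?thesis unfolding single_Cons using Cons by (intro lideal_lmult) auto
  next
    case False
    then show ?thesis unfolding single_Cons by (intro lideal_rmult junk_letter) auto
  qed
qed simp

lemma junk_NN: "junk \<subseteq> NN"
proof
  fix f assume f: "f \<in> junk"
  have "Poly_Mapping.single w (Poly_Mapping.lookup f w) \<in> NN" if "w \<in> Poly_Mapping.keys f" for w
  proof (rule junk_single)
    have "restrict_gens f w = 0" using f by (simp add: junk_def)
    then show "\<not> set w \<subseteq> gens E0 E1" using that by (auto simp: restrict_gens_def in_keys_iff)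
  qed
  then have "(\<Sum>w\<in>Poly_Mapping.keys f. Poly_Mapping.single w (Poly_Mapping.lookup f w)) \<in> NN"
    by (rule lideal_sum[OF lideal_NN])
  then show "f \<in> NN" using fa_expand[of f] by simp
qed

lemma augm_split: "\<exists>a'\<in>augm. a = sc (Poly_Mapping.lookup a []) + a'"
proof
  show "a = sc (Poly_Mapping.lookup a []) + (a - sc (Poly_Mapping.lookup a []))" by simp
  show "a - sc (Poly_Mapping.lookup a []) \<in> augm" by (simp add: augm_def lookup_minus sc_def)
qed

interpretation F: nhom augm junk restrict_gens "free_alg E0 E1" by (rule nhom_free)

text \<open>Multipliers in \<open>lideal\<close> may have a constant term, those in
  \<open>F.tid\<close> may not; the constant term is split off and handled by closure under
  scalars.\<close>

lemma tid_sc_lideal: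
  assumes J: "F.tid J" and s: "\<And>k x. x \<in> J \<Longrightarrow> sc k * x \<in> J" and R: "rels \<subseteq> J"
  shows "lideal J"
  unfolding lideal_def
proof (intro conjI ballI allI)
  fix x a :: "('v, 'e, 'k) fa" assume x: "x \<in> J"
  obtain a' where a': "a' \<in> augm" "a = sc (Poly_Mapping.lookup a []) + a'" using augm_split by blast
  have t: "a' * x \<in> J" "x * a' \<in> J" using J x a' by (auto simp: F.tid_def)
  have ts: "F.tsub J" using J by (simp add: F.tid_def)
  show "a * x \<in> J" by (subst a'(2)) (use F.tsub_add[OF ts s[OF x] t(1)] in \<open>simp add: distrib_right\<close>)
  show "x * a \<in> J" by (subst a'(2)) (use F.tsub_add[OF ts s[OF x] t(2)] in \<open>simp add: distrib_left sc_commute\<close>)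
qed (use J R in \<open>auto simp: F.tid_def F.tsub_def\<close>)

text \<open>Closure under scalars is automatic because the algebra has local units.\<close>

lemma lideal_iff_tid: "lideal J \<longleftrightarrow> F.tid J \<and> NN \<subseteq> J"
proof
  assume "lideal J"
  then show "F.tid J \<and> NN \<subseteq> J" using NN_least by (auto simp: F.tid_def F.tsub_def lideal_def)
next
  assume J: "F.tid J \<and> NN \<subseteq> J"
  have ts: "F.tsub J" using J by (simp add: F.tid_def)
  show "lideal J"
  proof (rule tid_sc_lideal)
    fix k x assume x: "x \<in> J"
    then have "x \<in> augm" using ts by (auto simp: F.tsub_def)
    then obtain U where U: "sum VV U * x \<approx> x" using local_unit by blast
    have "sc k * sum VV U \<in> augm" by (intro augm_mult2 augm_sum augm_letter)
    then have "(sc k * sum VV U) * x \<in> J" using J x unfolding F.tid_def by blast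
    moreover have "(sc k * sum VV U) * x - sc k * x \<in> J"
      using eqv_lmult[OF U, of "sc k"] J by (auto simp: cg_def mult.assoc)
    ultimately have "(sc k * sum VV U) * x - ((sc k * sum VV U) * x - sc k * x) \<in> J"
      using ts unfolding F.tsub_def by blast
    then show "sc k * x \<in> J" by simp
  qed (use J NN_rels in auto)
qed

lemma restrict_gens_rels: "x \<in> rels \<Longrightarrow> restrict_gens x \<in> lpa_rels E0 E1 r s \<or> restrict_gens x = (\<lambda>w. 0)"
  and lpa_rels_restrict_gens: "y \<in> lpa_rels E0 E1 r s \<Longrightarrow> y \<in> restrict_gens ` rels"
proof -
  have g: "v \<in> E0 \<Longrightarrow> Vt v \<in> gens E0 E1" "e \<in> E1 \<Longrightarrow> Ed e \<in> gens E0 E1" "e \<in> E1 \<Longrightarrow> Gh e \<in> gens E0 E1" for v e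
    by (auto simp: gens_def)
  note c = restrict_gens_diff restrict_gens_mult restrict_gens_letter[OF g(1)] restrict_gens_letter[OF g(2)] restrict_gens_letter[OF g(3)] s_E0 r_E0 restrict_gens_0 fa_sub_def
  have 1: "v \<in> E0 \<Longrightarrow> w \<in> E0 \<Longrightarrow> restrict_gens (VV v * VV w - (if v = w then VV v else 0)) =
      fa_sub (fa_mul (fa_gen (Vt v)) (fa_gen (Vt w))) (if v = w then fa_gen (Vt v) else (\<lambda>_. 0))" for v w
    by (simp add: c)
  have 2: "e \<in> E1 \<Longrightarrow> restrict_gens (VV (s e) * DD e - DD e) = fa_sub (fa_mul (fa_gen (Vt (s e))) (fa_gen (Ed e))) (fa_gen (Ed e))" for e
    by (simp add: c)
  have 3: "e \<in> E1 \<Longrightarrow> restrict_gens (DD e * VV (r e) - DD e) = fa_sub (fa_mul (fa_gen (Ed e)) (fa_gen (Vt (r e)))) (fa_gen (Ed e))" for e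
    by (simp add: c)
  have 4: "e \<in> E1 \<Longrightarrow> restrict_gens (VV (r e) * GG e - GG e) = fa_sub (fa_mul (fa_gen (Vt (r e))) (fa_gen (Gh e))) (fa_gen (Gh e))" for e
    by (simp add: c)
  have 5: "e \<in> E1 \<Longrightarrow> restrict_gens (GG e * VV (s e) - GG e) = fa_sub (fa_mul (fa_gen (Gh e)) (fa_gen (Vt (s e)))) (fa_gen (Gh e))" for e
    by (simp add: c)
  have 6: "e \<in> E1 \<Longrightarrow> f \<in> E1 \<Longrightarrow> restrict_gens (GG e * DD f - (if e = f then VV (r e) else 0)) =
      fa_sub (fa_mul (fa_gen (Gh e)) (fa_gen (Ed f))) (if e = f then fa_gen (Vt (r e)) else (\<lambda>_. 0))" for e f
    by (simp add: c)
  have 7: "regular_vertex E0 E1 s v \<Longrightarrow> restrict_gens (VV v - (\<Sum>e\<in>out v. DD e * GG e)) =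
      (\<lambda>w. fa_gen (Vt v) w - (\<Sum>e\<in>{e \<in> E1. s e = v}. fa_mul (fa_gen (Ed e)) (fa_gen (Gh e)) w))" for v
    by (rule ext) (simp add: c restrict_gens_sum regular_vertex_def out_def)
  show "restrict_gens x \<in> lpa_rels E0 E1 r s \<or> restrict_gens x = (\<lambda>w. 0)" if "x \<in> rels"
    using that unfolding rels_def Un_iff
  proof (elim disjE)
    assume "x \<in> letter ` (- gens E0 E1)"
    then show ?thesis using restrict_gens_junk by auto
  qed (elim CollectE exE conjE; hypsubst; rule disjI1;
       simp only: 1 2 3 4 5 6 7 lpa_rels_def Un_iff; blast)+
  show "y \<in> restrict_gens ` rels" if "y \<in> lpa_rels E0 E1 r s"
    using that unfolding lpa_rels_def Un_iff
  proof (elim disjE CollectE exE conjE)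
    fix v w assume h: "y = fa_sub (fa_mul (fa_gen (Vt v)) (fa_gen (Vt w))) (if v = w then fa_gen (Vt v) else (\<lambda>_. 0))" "v \<in> E0" "w \<in> E0"
    show ?thesis unfolding h(1) 1[OF h(2,3), symmetric] by (rule imageI[OF rels_VV[OF h(2,3)]])
  next
    fix e assume h: "y = fa_sub (fa_mul (fa_gen (Vt (s e))) (fa_gen (Ed e))) (fa_gen (Ed e))" "e \<in> E1"
    show ?thesis unfolding h(1) 2[OF h(2), symmetric] by (rule imageI[OF rels_VD[OF h(2)]])
  next
    fix e assume h: "y = fa_sub (fa_mul (fa_gen (Ed e)) (fa_gen (Vt (r e)))) (fa_gen (Ed e))" "e \<in> E1"
    show ?thesis unfolding h(1) 3[OF h(2), symmetric] by (rule imageI[OF rels_DV[OF h(2)]])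
  next
    fix e assume h: "y = fa_sub (fa_mul (fa_gen (Vt (r e))) (fa_gen (Gh e))) (fa_gen (Gh e))" "e \<in> E1"
    show ?thesis unfolding h(1) 4[OF h(2), symmetric] by (rule imageI[OF rels_VG[OF h(2)]])
  next
    fix e assume h: "y = fa_sub (fa_mul (fa_gen (Gh e)) (fa_gen (Vt (s e)))) (fa_gen (Gh e))" "e \<in> E1"
    show ?thesis unfolding h(1) 5[OF h(2), symmetric] by (rule imageI[OF rels_GV[OF h(2)]])
  next
    fix e f assume h: "y = fa_sub (fa_mul (fa_gen (Gh e)) (fa_gen (Ed f))) (if e = f then fa_gen (Vt (r e)) else (\<lambda>_. 0))" "e \<in> E1" "f \<in> E1"
    show ?thesis unfolding h(1) 6[OF h(2,3), symmetric] by (rule imageI[OF rels_GD[OF h(2,3)]])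
  next
    fix v assume h: "y = (\<lambda>w. fa_gen (Vt v) w - (\<Sum>e\<in>{e \<in> E1. s e = v}. fa_mul (fa_gen (Ed e)) (fa_gen (Gh e)) w))" "regular_vertex E0 E1 s v"
    show ?thesis unfolding h(1) 7[OF h(2), symmetric] by (rule imageI[OF rels_CK2[OF h(2)]])
  qed
qed

abbreviation RI :: "(('v, 'e) gen list \<Rightarrow> 'k) set" where "RI \<equiv> lpa_relideal E0 E1 r s"

lemma relideal_eq: "RI = restrict_gens ` NN"
proof
  have N: "F.tid NN" using lideal_NN lideal_iff_tid by blast
  have "fa_smult c x \<in> restrict_gens ` NN" if "x \<in> restrict_gens ` NN" for c x
    using that lideal_lmult[OF lideal_NN] restrict_gens_sc by (metis (no_types, lifting) image_iff)
  moreover have "lpa_rels E0 E1 r s \<subseteq> restrict_gens ` NN" using lpa_rels_restrict_gens NN_rels by blast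
  ultimately show "RI \<subseteq> restrict_gens ` NN"
    unfolding lpa_relideal_def using F.cl_tid[OF N] by blast
  show "restrict_gens ` NN \<subseteq> RI" unfolding lpa_relideal_def
  proof (rule Inter_greatest, elim CollectE conjE)
    fix J :: "(('v, 'e) gen list \<Rightarrow> 'k) set" assume J: "rideal (free_alg E0 E1) J" "\<forall>c x. x \<in> J \<longrightarrow> fa_smult c x \<in> J" "lpa_rels E0 E1 r s \<subseteq> J"
    have z: "(\<lambda>w. 0) \<in> J" using J(1) by (simp add: rideal_def add_subgroup_def free_alg_def)
    have "lideal (F.pre J)"
    proof (rule tid_sc_lideal[OF F.pre_tid[OF J(1)]])
      fix k x assume "x \<in> F.pre J"
      then show "sc k * x \<in> F.pre J" using J(2) by (auto simp: F.pre_def restrict_gens_sc augm_mult2)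
    next
      show "rels \<subseteq> F.pre J"
      proof
        fix x assume x: "x \<in> rels"
        then show "x \<in> F.pre J" using restrict_gens_rels[OF x] J(3) z rels_augm by (auto simp: F.pre_def)
      qed
    qed
    then have "NN \<subseteq> F.pre J" by (rule NN_least)
    then show "restrict_gens ` NN \<subseteq> J" by (auto simp: F.pre_def)
  qed
qed

abbreviation LK :: "('v, 'e, 'k) lpa_elem nrng" where "LK \<equiv> LPA E0 E1 r s"
definition cl :: "('v, 'e, 'k) fa \<Rightarrow> ('v, 'e, 'k) lpa_elem" where
  "cl x = rcoset (free_alg E0 E1) RI (restrict_gens x)"

lemma nhom_LPA: "nhom augm NN cl LK"
proof -
  have N: "F.tid NN" using lideal_NN lideal_iff_tid by blast
  have "rideal (free_alg E0 E1) RI" unfolding relideal_eq by (rule F.cl_tid[OF N])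
  from F.nhom_rquot[OF this]
  have "nhom augm (F.pre RI) cl LK" unfolding LPA_def cl_def[abs_def] .
  moreover have "F.pre RI = NN"
    unfolding relideal_eq using N junk_NN by (intro F.pre_cl) (auto simp: F.tid_def)
  ultimately show ?thesis by simp
qed

end

section \<open>The equivalence for the Leavitt path algebra\<close>

context graph begin

interpretation L: nhom augm NN cl LK by (rule nhom_LPA)

lemma lideal_tid: "lideal J \<longleftrightarrow> L.tid J \<and> NN \<subseteq> J" by (rule lideal_iff_tid)

lemma lideal_tsub: "lideal J \<Longrightarrow> L.tsub J \<and> NN \<subseteq> J" using lideal_tid L.tid_def by blast

lemma pre_lideal: "rideal LK I \<Longrightarrow> lideal (L.pre I)" "rideal LK I \<Longrightarrow> cl ` L.pre I = I"
  using L.pre_tid L.pre_tsub(2,3) lideal_tid by (auto simp: rideal_def)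

lemma cl_lideal: "lideal J \<Longrightarrow> rideal LK (cl ` J)" "lideal J \<Longrightarrow> L.pre (cl ` J) = J"
  using L.cl_tid L.pre_cl lideal_tid lideal_tsub by blast+

lemma cl_inj: "lideal A \<Longrightarrow> lideal B \<Longrightarrow> cl ` A = cl ` B \<longleftrightarrow> A = B"
  by (rule L.cl_image_eq) (simp_all add: lideal_tsub)

lemma cl_subset: assumes A: "lideal A" and B: "lideal B" shows "cl ` A \<subseteq> cl ` B \<longleftrightarrow> A \<subseteq> B"
proof
  assume "cl ` A \<subseteq> cl ` B"
  then have "L.pre (cl ` A) \<subseteq> L.pre (cl ` B)" by (auto simp: L.pre_def)
  then show "A \<subseteq> B" unfolding cl_lideal(2)[OF A] cl_lideal(2)[OF B] .
qed (rule image_mono)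

lemma rgenideal_lgen: "X \<subseteq> augm \<Longrightarrow> rgenideal LK (cl ` X) = cl ` lgen X"
  using L.rgenideal_cl[of X] by (simp add: L.tgen_def lgen_def lideal_tid conj_assoc)

lemma ideal_prod_lprod: "A \<subseteq> augm \<Longrightarrow> B \<subseteq> augm \<Longrightarrow> ideal_prod LK (cl ` A) (cl ` B) = cl ` lprod A B"
  using L.ideal_prod_cl[of A B] by (simp add: L.tprod_def lprod_def L.tsub_def addgrp_def)

lemma lideal_sub: "lideal J \<Longrightarrow> J \<subseteq> augm" by (simp add: lideal_def)

lemma ideal_prods_lprods: "\<forall>P\<in>set Ps. lideal P \<Longrightarrow> ideal_prods LK (map ((`) cl) Ps) = cl ` lprods Ps"
proof (induction Ps rule: lprods.induct)
  case 1
  then show ?case by (simp add: L.carr)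
next
  case (3 A B As)
  have "lideal A" using 3 by simp
  moreover have "lideal (lprods (B # As))" by (rule lideal_lprods) (use 3 in simp)
  ultimately show ?case using 3 by (simp add: ideal_prod_lprod lideal_sub)
qed simp

lemma semiprime_quasi_semiprime: assumes J: "lideal J" shows "semiprime LK (cl ` J) \<longleftrightarrow> quasi_semiprime J \<and> J \<noteq> augm"
proof -
  have p: "ideal_prod LK (cl ` A) (cl ` A) \<subseteq> cl ` J \<longleftrightarrow> (\<forall>a\<in>A. \<forall>b\<in>A. a * b \<in> J)" if A: "lideal A" for A
  proof -
    have "ideal_prod LK (cl ` A) (cl ` A) \<subseteq> cl ` J \<longleftrightarrow> lprod A A \<subseteq> J"
      using ideal_prod_lprod[OF lideal_sub[OF A] lideal_sub[OF A]] cl_subset[OF lideal_lprod[OF A A] J] by simp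
    also have "lprod A A \<subseteq> J \<longleftrightarrow> (\<forall>a\<in>A. \<forall>b\<in>A. a * b \<in> J)"
    proof
      assume s: "lprod A A \<subseteq> J"
      show "\<forall>a\<in>A. \<forall>b\<in>A. a * b \<in> J"
      proof (intro ballI)
        fix a b assume "a \<in> A" "b \<in> A"
        then show "a * b \<in> J" by (rule subsetD[OF s lprodI])
      qed
    next
      assume "\<forall>a\<in>A. \<forall>b\<in>A. a * b \<in> J"
      then show "lprod A A \<subseteq> J" by (intro lprod_least J) simp
    qed
    finally show ?thesis .
  qed
  have "(\<forall>A. rideal LK A \<and> ideal_prod LK A A \<subseteq> cl ` J \<longrightarrow> A \<subseteq> cl ` J) \<longleftrightarrow>
      (\<forall>A. lideal A \<longrightarrow> (\<forall>a\<in>A. \<forall>b\<in>A. a * b \<in> J) \<longrightarrow> A \<subseteq> J)"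
  proof (intro iffI allI impI)
    fix A assume *: "\<forall>A. rideal LK A \<and> ideal_prod LK A A \<subseteq> cl ` J \<longrightarrow> A \<subseteq> cl ` J" "lideal A" "\<forall>a\<in>A. \<forall>b\<in>A. a * b \<in> J"
    then have "cl ` A \<subseteq> cl ` J" using p[OF *(2)] cl_lideal(1)[OF *(2)] by blast
    then show "A \<subseteq> J" using cl_subset[OF *(2) J] by simp
  next
    fix A assume *: "\<forall>A. lideal A \<longrightarrow> (\<forall>a\<in>A. \<forall>b\<in>A. a * b \<in> J) \<longrightarrow> A \<subseteq> J" "rideal LK A \<and> ideal_prod LK A A \<subseteq> cl ` J"
    then have l: "lideal (L.pre A)" "cl ` L.pre A = A" using pre_lideal by auto
    then have "L.pre A \<subseteq> J" using p[OF l(1)] *(1) *(2) by simp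
    then show "A \<subseteq> cl ` J" using l(2) by blast
  qed
  moreover have "cl ` J \<noteq> rcarr LK \<longleftrightarrow> J \<noteq> augm" using cl_inj[OF J lideal_augm_self] by (simp add: L.carr)
  ultimately show ?thesis using J cl_lideal(1)[OF J] by (simp add: semiprime_def quasi_semiprime_def conj_commute)
qed

lemma semiprime_products_iff:
  "(\<forall>I. rideal LK I \<and> I \<noteq> rcarr LK \<longrightarrow>
     (\<exists>Ps. Ps \<noteq> [] \<and> (\<forall>P\<in>set Ps. semiprime LK P) \<and> I = ideal_prods LK Ps)) \<longleftrightarrow> semiprime_products"
  unfolding semiprime_products_def
proof (intro iffI allI impI)
  fix J assume *: "\<forall>I. rideal LK I \<and> I \<noteq> rcarr LK \<longrightarrow>
     (\<exists>Ps. Ps \<noteq> [] \<and> (\<forall>P\<in>set Ps. semiprime LK P) \<and> I = ideal_prods LK Ps)" and J: "lideal J \<and> J \<noteq> augm"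
  have "rideal LK (cl ` J) \<and> cl ` J \<noteq> rcarr LK" using J cl_lideal(1) cl_inj[OF _ lideal_augm_self] by (simp add: L.carr)
  then obtain Ps where Ps: "Ps \<noteq> []" "\<forall>P\<in>set Ps. semiprime LK P" "cl ` J = ideal_prods LK Ps" using * by blast
  define Qs where "Qs = map L.pre Ps"
  have r: "rideal LK P" if "P \<in> set Ps" for P using Ps(2) that by (auto simp: semiprime_def)
  have lQ: "\<forall>Q\<in>set Qs. lideal Q" using r pre_lideal(1) by (auto simp: Qs_def)
  have "map ((`) cl) Qs = Ps" unfolding Qs_def using r pre_lideal(2) by (simp add: map_idI)
  then have "cl ` J = cl ` lprods Qs" using ideal_prods_lprods[OF lQ] Ps(3) by simp
  then have "J = lprods Qs" using cl_inj J lideal_lprods[OF lQ] by blast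
  moreover have "quasi_semiprime Q \<and> Q \<noteq> augm" if Q: "Q \<in> set Qs" for Q
  proof -
    obtain P where P: "P \<in> set Ps" "Q = L.pre P" using Q by (auto simp: Qs_def)
    then show ?thesis using semiprime_quasi_semiprime[of Q] pre_lideal[OF r[OF P(1)]] Ps(2) by auto
  qed
  moreover have "Qs \<noteq> []" using Ps(1) by (simp add: Qs_def)
  ultimately show "\<exists>Ps. Ps \<noteq> [] \<and> (\<forall>P\<in>set Ps. quasi_semiprime P \<and> P \<noteq> augm) \<and> J = lprods Ps" by blast
next
  fix I assume *: "\<forall>I. lideal I \<and> I \<noteq> augm \<longrightarrow> (\<exists>Ps. Ps \<noteq> [] \<and> (\<forall>P\<in>set Ps. quasi_semiprime P \<and> P \<noteq> augm) \<and> I = lprods Ps)"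
    and I: "rideal LK I \<and> I \<noteq> rcarr LK"
  have l: "lideal (L.pre I)" "cl ` L.pre I = I" using pre_lideal I by auto
  have "L.pre I \<noteq> augm" using l(2) I by (auto simp: L.carr)
  then obtain Ps where Ps: "Ps \<noteq> []" "\<forall>P\<in>set Ps. quasi_semiprime P \<and> P \<noteq> augm" "L.pre I = lprods Ps" using * l(1) by blast
  have lP: "\<forall>P\<in>set Ps. lideal P" using Ps(2) by (auto simp: quasi_semiprime_def)
  have "I = ideal_prods LK (map ((`) cl) Ps)" using ideal_prods_lprods[OF lP] Ps(3) l(2) by simp
  moreover have "\<forall>P\<in>set (map ((`) cl) Ps). semiprime LK P" using semiprime_quasi_semiprime lP Ps(2) by auto
  ultimately show "\<exists>Ps. Ps \<noteq> [] \<and> (\<forall>P\<in>set Ps. semiprime LK P) \<and> I = ideal_prods LK Ps"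
    using Ps(1) by (intro exI[of _ "map ((`) cl) Ps"]) auto
qed

lemma cl_vertex: "v \<in> E0 \<Longrightarrow> lpa_vertex E0 E1 r s v = cl (VV v)"
  by (simp add: lpa_vertex_def lpa_cls_def cl_def restrict_gens_letter gens_def)

lemma cl_vH: assumes "v \<in> E0" shows "vH E0 E1 r s H v = cl (breaking_elem H v)"
proof -
  have F: "{e \<in> E1. s e = v \<and> r e \<notin> H} = {e \<in> out v. r e \<notin> H}" by (auto simp: out_def)
  have "restrict_gens (breaking_elem H v) = (\<lambda>w. fa_gen (Vt v) w - (\<Sum>e\<in>{e \<in> out v. r e \<notin> H}. fa_mul (fa_gen (Ed e)) (fa_gen (Gh e)) w))"
    unfolding breaking_elem_def nu_def restrict_gens_diff restrict_gens_sum restrict_gens_mult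
    using assms by (intro ext arg_cong2[where f = minus] sum.cong) (auto simp: restrict_gens_letter gens_def out_def)
  then show ?thesis unfolding vH_def lpa_cls_def cl_def F by simp
qed

lemma graded_part_cl: assumes I: "rideal LK I"
  shows "graded_part E0 E1 r s I = cl ` lgen (graded_gens (gr_verts (L.pre I)) (gr_breaking (L.pre I)))"
proof -
  let ?J = "L.pre I"
  have H: "ideal_verts E0 E1 r s I = gr_verts ?J" by (auto simp: ideal_verts_def gr_verts_def L.pre_def cl_vertex)
  have br: "v \<in> E0" if "v \<in> breaking_verts E0 E1 r s H" for v H
    using that by (auto simp: breaking_verts_def infinite_emitter_def)
  have S: "{v \<in> breaking_verts E0 E1 r s (gr_verts ?J). vH E0 E1 r s (gr_verts ?J) v \<in> I} = gr_breaking ?J"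
    unfolding gr_breaking_def by (rule Collect_cong) (use br in \<open>auto simp: L.pre_def cl_vH breaking_elem_def nu_augm\<close>)
  have "lpa_vertex E0 E1 r s ` gr_verts ?J = cl ` VV ` gr_verts ?J"
    unfolding image_image by (rule image_cong) (auto simp: gr_verts_def cl_vertex)
  moreover have "vH E0 E1 r s (gr_verts ?J) ` gr_breaking ?J = cl ` breaking_elem (gr_verts ?J) ` gr_breaking ?J"
    unfolding image_image by (rule image_cong) (auto simp: gr_breaking_def cl_vH br)
  ultimately have "lpa_vertex E0 E1 r s ` gr_verts ?J \<union> vH E0 E1 r s (gr_verts ?J) ` gr_breaking ?J = cl ` graded_gens (gr_verts ?J) (gr_breaking ?J)"
    by (simp add: graded_gens_def image_Un)
  then show ?thesis unfolding graded_part_def Let_def H S using rgenideal_lgen[OF graded_gens_augm] by simp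
qed

text \<open>Ideals of the quotient correspond to ideals above the graded part, so generating there
  by a finite set amounts to generating by lifts of it together with the graded generators.\<close>

lemma quotient_fg_iff:
  assumes I: "rideal LK I"
  shows "(let G = graded_part E0 E1 r s I; Q = rquot LK G in
       \<exists>F. finite F \<and> F \<subseteq> rcarr Q \<and> rgenideal Q F = rcoset LK G ` I) \<longleftrightarrow>
     (\<exists>F. finite F \<and> F \<subseteq> augm \<and> lgen (graded_gens (gr_verts (L.pre I)) (gr_breaking (L.pre I)) \<union> F) = L.pre I)"
proof -
  let ?B = "graded_gens (gr_verts (L.pre I)) (gr_breaking (L.pre I))"
  let ?J = "L.pre I" and ?g = "lgen ?B"
  define G where "G = graded_part E0 E1 r s I"
  have lg: "lideal ?g" by (rule lideal_lgen[OF graded_gens_augm])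
  have lJ: "lideal ?J" "cl ` ?J = I" using pre_lideal I by auto
  have G: "G = cl ` ?g" unfolding G_def by (rule graded_part_cl[OF I])
  have rG: "rideal LK G" unfolding G by (rule cl_lideal(1)[OF lg])
  have pG: "L.pre G = ?g" unfolding G by (rule cl_lideal(2)[OF lg])
  let ?c = "\<lambda>x. rcoset LK G (cl x)"
  interpret Q: nhom augm ?g ?c "rquot LK G" using L.nhom_rquot[OF rG] unfolding pG .
  have tl: "Q.tid A \<and> ?g \<subseteq> A \<longleftrightarrow> lideal A \<and> ?B \<subseteq> A" for A
    using lideal_tid[of A] lgen_least[of A ?B] lgen_incl[of ?B] NN_least[OF lg] by blast
  have gen: "Q.tgen X = lgen (?B \<union> X)" for X
    unfolding Q.tgen_def lgen_def[of "?B \<union> X"] using tl by (intro arg_cong[of _ _ Inter] Collect_cong) blast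
  have img: "rcoset LK G ` I = ?c ` ?J" using lJ(2) by (metis image_image)
  have ci: "rgenideal (rquot LK G) (?c ` X) = ?c ` ?J \<longleftrightarrow> lgen (?B \<union> X) = ?J" if X: "X \<subseteq> augm" for X
  proof -
    have l: "lideal (lgen (?B \<union> X))" using X graded_gens_augm by (intro lideal_lgen) auto
    have "?g \<subseteq> lgen (?B \<union> X)" by (intro lgen_mono) auto
    moreover have "?g \<subseteq> ?J" by (rule lgen_least[OF lJ(1) graded_gens_gr])
    ultimately show ?thesis
      using Q.rgenideal_cl[OF X] Q.cl_image_eq[of "lgen (?B \<union> X)" ?J] lideal_tsub[OF l] lideal_tsub[OF lJ(1)]
      by (simp add: gen)
  qed
  show ?thesis unfolding Let_def G_def[symmetric] img Q.carr
  proof (intro iffI; elim exE conjE)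
    fix F assume F: "finite F" "F \<subseteq> ?c ` augm" "rgenideal (rquot LK G) F = ?c ` ?J"
    obtain X where X: "X \<subseteq> augm" "finite X" "F = ?c ` X" using finite_subset_image[OF F(1,2)] by blast
    have "lgen (?B \<union> X) = ?J" using ci[OF X(1)] F(3) unfolding X(3) by (rule iffD1)
    then show "\<exists>F. finite F \<and> F \<subseteq> augm \<and> lgen (?B \<union> F) = ?J" using X(1,2) by (intro exI conjI)
  next
    fix X assume X: "finite X" "X \<subseteq> augm" "lgen (?B \<union> X) = ?J"
    have "rgenideal (rquot LK G) (?c ` X) = ?c ` ?J" using ci[OF X(2)] X(3) by (rule iffD2)
    then show "\<exists>F. finite F \<and> F \<subseteq> ?c ` augm \<and> rgenideal (rquot LK G) F = ?c ` ?J"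
      using X by (intro exI[of _ "?c ` X"]) auto
  qed
qed

lemma fg_over_graded_iff:
  "(\<forall>I. rideal LK I \<longrightarrow>
       (let G = graded_part E0 E1 r s I; Q = rquot LK G in
         \<exists>F. finite F \<and> F \<subseteq> rcarr Q \<and> rgenideal Q F = rcoset LK G ` I)) \<longleftrightarrow> fg_over_graded"
proof -
  have "(\<forall>I. rideal LK I \<longrightarrow> P (L.pre I)) \<longleftrightarrow> (\<forall>J. lideal J \<longrightarrow> P J)" for P
    using pre_lideal cl_lideal by metis
  from this[of "\<lambda>J. \<exists>F. finite F \<and> F \<subseteq> augm \<and> lgen (graded_gens (gr_verts J) (gr_breaking J) \<union> F) = J"]
  show ?thesis unfolding fg_over_graded_def using quotient_fg_iff by (simp cong: imp_cong)
qed

end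

theorem theorem5p9:
  fixes E0 :: "'v set" and E1 :: "'e set" and r s :: "'e \<Rightarrow> 'v"
    and L :: "('v, 'e, 'k::field) lpa_elem nrng"
  assumes "E0 \<noteq> {}"
    and "\<forall>e\<in>E1. s e \<in> E0 \<and> r e \<in> E0"
    and "L = LPA E0 E1 r s"
  shows "((\<forall>I. rideal L I \<and> I \<noteq> rcarr L \<longrightarrow>
            (\<exists>Ps. Ps \<noteq> [] \<and> (\<forall>P\<in>set Ps. semiprime L P) \<and> I = ideal_prods L Ps))
      \<longleftrightarrow>
         (\<forall>I. rideal L I \<longrightarrow>
            (let G = graded_part E0 E1 r s I; Q = rquot L G in
             \<exists>F. finite F \<and> F \<subseteq> rcarr Q \<and> rgenideal Q F = rcoset L G ` I)))
    \<and> ((\<forall>I. rideal L I \<longrightarrow>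
            (let G = graded_part E0 E1 r s I; Q = rquot L G in
             \<exists>F. finite F \<and> F \<subseteq> rcarr Q \<and> rgenideal Q F = rcoset L G ` I))
      \<longleftrightarrow>
         (\<forall>H. hereditary E0 E1 r s H \<and> saturated E0 E1 r s H \<longrightarrow>
            finite {set c | c. is_cycle E1 r s c \<and> path_verts r s c \<inter> H = {} \<and>
                      (\<forall>f. is_exit E1 s c f \<longrightarrow> r f \<in> H)}))"
proof -
  interpret graph E0 E1 r s "TYPE('k)" using assms(2) by unfold_locales auto
  have 3: "(\<forall>H. hereditary E0 E1 r s H \<and> saturated E0 E1 r s H \<longrightarrow>
            finite {set c | c. is_cycle E1 r s c \<and> path_verts r s c \<inter> H = {} \<and>
                      (\<forall>f. is_exit E1 s c f \<longrightarrow> r f \<in> H)}) \<longleftrightarrow> finite_exclusive"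
    by (simp add: finite_exclusive_def exclusive_sets_def)
  \<comment> \<open>Both equivalences pass through the finiteness of cycles, which implies each of
    the other conditions and follows from each.\<close>
  show ?thesis unfolding assms(3) semiprime_products_iff fg_over_graded_iff 3
    using semiprime_products_imp_finite_exclusive fg_over_graded_imp_finite_exclusive finite_exclusive_imp_semiprime_products finite_exclusive_imp_fg_over_graded by blast
qed

end
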